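(* Let $V=\mathbb Z^g$ with the Euclidean distance and let $\Phi$ be a local interaction on $V$ with $\sup_{x\in V}\sum_{X\ni x}\|\Phi_X\|e^{\lambda|X|+\mu\operatorname{diam}(X)}\le\Delta$ for some $\lambda,\mu,\Delta>0$. Let $0<\beta<\lambda/(2\Delta)$ be such that: (a) $\Phi$ has weak local effective Hamiltonians at $\beta$, i.e. for every $L\subset V$ there is a local interaction $\widehat\Phi^{L,\beta}$ with (i) $\widehat\Phi^{L,\beta}_X$ supported in $X\cap L$ for every finite $X$, (ii) $\widehat\Phi^{L,\beta}_X=\widehat\Phi^{L',\beta}_X$ whenever $L'\subset V$ and $X\cap L'=X\cap L$, (iii) for every finite $\Lambda$, $-\frac1\beta\log(\operatorname{tr}_{\Lambda\setminus L}[e^{-\beta H_\Lambda}])+\frac1\beta\log(Z_{\Lambda\setminus L})\mathbb 1=\sum_{X\subset\Lambda,X\cap L\ne\emptyset}\widehat\Phi^{L,\beta}_X$; and for every $L$, $\sup_{x}\sum_{X\ni x}\|\widehat\Phi^{L,\beta}_X\|e^{\lambda|X|+\mu\operatorname{diam}(X)}\le\Delta$; (b) $H=(H_\Lambda)_\Lambda$ is $\epsilon(\ell)$-uniform clustering at $\beta$ with an exponentially decaying $\epsilon$. Then there exist constants $c',K_1,K_2>0$, independent of $\Lambda,A,C$, such that for every finite $\Lambda\subset\mathbb Z^g$ and every pair of disjoint nonempty subsets $A,C\subset\Lambda$, the Gibbs state $\rho=\rho^\Lambda_\beta$ satisfies $$\big\|\rho_{AC}\rho_A^{-1}\otimes\rho_C^{-1}-\mathbb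 1\big\|\le K_2\min\Big\{e^{K_1|\partial A|}\big(|\partial A|+|C|g(A)\big),\;e^{K_1|\partial C|}\big(|\partial C|+|A|g(C)\big)\Big\}e^{-c'\operatorname{dist}(A,C)}.$$
   Context: Each site of $\mathbb Z^g$ carries $\mathbb C^D$; $\mathfrak A_X=\mathcal B(\mathcal H_X)$, $\mathcal H_X=\bigotimes_{v\in X}\mathbb C^D$, embedded in larger algebras by tensoring with identity. A local interaction is a family $(\Phi_X)$ indexed by finite $X$ with $\Phi_X=\Phi_X^*\in\mathfrak A_X$; $H_\Lambda=\sum_{X\subset\Lambda}\Phi_X$; $Z_X=\operatorname{Tr}[e^{-\beta H_X}]$ ($Z_\emptyset=1$); $\operatorname{tr}_{\Lambda\setminus L}$ is the partial trace over $\Lambda\setminus L$; $\log$ is the self-adjoint logarithm. $\rho^\Lambda_\beta=e^{-\beta H_\Lambda}/Z_\Lambda$, $\rho_X=\operatorname{tr}_{\Lambda\setminus X}\rho^\Lambda_\beta$, and $\rho_{AC}\rho_A^{-1}\otimes\rho_C^{-1}$ is a product of operators on $\mathcal H_{A\cup C}$. Distances and diameters are Euclidean; $\partial A$ is the set of sites of $A$ at distance at most $1$ from $\mathbb Z^g\setminus A$. $\operatorname{Cov}_\rho(O_A,O_B)=|\operatorname{Tr}[\rho O_AO_B]-\operatorname{Tr}[\rho O_A]\operatorname{Tr}[\rho O_B]|$. $\epsilon(\ell)$-uniform clustering at $\beta$: there are $b\in\mathbb N$, a function $g$ from finite subsets to $[0,\infty)$, and $f(A,B)\le g(A)|B|^b$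 such that for all finite $\Lambda$, all $A,B\subset\Lambda$ with $\operatorname{dist}(A,B)\ge\ell$ and all $O_A\in\mathfrak A_A,O_B\in\mathfrak A_B$, $\operatorname{Cov}_{\rho^\Lambda_\beta}(O_A,O_B)\le f(A,B)\|O_A\|\|O_B\|\epsilon(\ell)$. Exponentially decaying: $\epsilon(\ell)\le C_\epsilon e^{-\alpha\ell}$ for some $C_\epsilon,\alpha>0$. *)

theory Defs
  imports "HOL-Analysis.Analysis"
begin

text \<open>Sites of Z^g are integer vectors indexed by a finite type 'g (so g = CARD('g)).
  A basis configuration of a region X assigns to each site of X a value in {0..<D}
  and the value 0 to every site outside X.  An operator on H_X (an element of
  the algebra A_X) is a matrix indexed by configurations of X; only its entries on
  configurations of X are meaningful.\<close>

type_synonym 'g site = "int ^ 'g"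
type_synonym 'g cfg = "'g site \<Rightarrow> nat"
type_synonym 'g op = "'g cfg \<Rightarrow> 'g cfg \<Rightarrow> complex"
type_synonym 'g vect = "'g cfg \<Rightarrow> complex"

definition rv :: "'g::finite site \<Rightarrow> real ^ 'g" where
  "rv x = (\<chi> i. real_of_int (x $ i))"

definition sdiam :: "'g::finite site set \<Rightarrow> real" where
  "sdiam X = diameter (rv ` X)"

definition sdist :: "'g::finite site set \<Rightarrow> 'g site set \<Rightarrow> real" where
  "sdist A B = setdist (rv ` A) (rv ` B)"

definition bdry :: "'g::finite site set \<Rightarrow> 'g site set" where
  "bdry A = {v \<in> A. \<exists>w. w \<notin> A \<and> dist (rv v) (rv w) \<le> 1}"

definition conf :: "nat \<Rightarrow> 'g site set \<Rightarrow> 'g cfg set" where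
  "conf D X = {\<sigma>. (\<forall>v\<in>X. \<sigma> v < D) \<and> (\<forall>v. v \<notin> X \<longrightarrow> \<sigma> v = 0)}"

definition restr :: "'g site set \<Rightarrow> 'g cfg \<Rightarrow> 'g cfg" where
  "restr X \<sigma> = (\<lambda>v. if v \<in> X then \<sigma> v else 0)"

definition canon :: "nat \<Rightarrow> 'g site set \<Rightarrow> 'g op \<Rightarrow> bool" where
  "canon D X A \<longleftrightarrow> (\<forall>\<sigma> \<tau>. \<sigma> \<notin> conf D X \<or> \<tau> \<notin> conf D X \<longrightarrow> A \<sigma> \<tau> = 0)"

definition op_eq :: "nat \<Rightarrow> 'g site set \<Rightarrow> 'g op \<Rightarrow> 'g op \<Rightarrow> bool" where
  "op_eq D X A B \<longleftrightarrow> (\<forall>\<sigma>\<in>conf D X. \<forall>\<tau>\<in>conf D X. A \<sigma> \<tau> = B \<sigma> \<tau>)"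

text \<open>Embedding of A in A_X into A_Y (X \<subseteq> Y) as A tensor identity.\<close>
definition emb :: "nat \<Rightarrow> 'g site set \<Rightarrow> 'g site set \<Rightarrow> 'g op \<Rightarrow> 'g op" where
  "emb D X Y A = (\<lambda>\<sigma> \<tau>. if \<sigma> \<in> conf D Y \<and> \<tau> \<in> conf D Y \<and> restr (Y - X) \<sigma> = restr (Y - X) \<tau>
                        then A (restr X \<sigma>) (restr X \<tau>) else 0)"

definition idop :: "nat \<Rightarrow> 'g site set \<Rightarrow> 'g op" where
  "idop D X = (\<lambda>\<sigma> \<tau>. if \<sigma> \<in> conf D X \<and> \<sigma> = \<tau> then 1 else 0)"

definition opadd :: "nat \<Rightarrow> 'g site set \<Rightarrow> 'g op \<Rightarrow> 'g op \<Rightarrow> 'g op" where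
  "opadd D X A B = (\<lambda>\<sigma> \<tau>. if \<sigma> \<in> conf D X \<and> \<tau> \<in> conf D X then A \<sigma> \<tau> + B \<sigma> \<tau> else 0)"

definition opsub :: "nat \<Rightarrow> 'g site set \<Rightarrow> 'g op \<Rightarrow> 'g op \<Rightarrow> 'g op" where
  "opsub D X A B = (\<lambda>\<sigma> \<tau>. if \<sigma> \<in> conf D X \<and> \<tau> \<in> conf D X then A \<sigma> \<tau> - B \<sigma> \<tau> else 0)"

definition opscale :: "nat \<Rightarrow> 'g site set \<Rightarrow> complex \<Rightarrow> 'g op \<Rightarrow> 'g op" where
  "opscale D X c A = (\<lambda>\<sigma> \<tau>. if \<sigma> \<in> conf D X \<and> \<tau> \<in> conf D X then c * A \<sigma> \<tau> else 0)"

definition opmult :: "nat \<Rightarrow> 'g site set \<Rightarrow> 'g op \<Rightarrow> 'g op \<Rightarrow> 'g op" where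
  "opmult D X A B = (\<lambda>\<sigma> \<tau>. if \<sigma> \<in> conf D X \<and> \<tau> \<in> conf D X
                         then (\<Sum>\<rho>\<in>conf D X. A \<sigma> \<rho> * B \<rho> \<tau>) else 0)"

fun oppow :: "nat \<Rightarrow> 'g site set \<Rightarrow> 'g op \<Rightarrow> nat \<Rightarrow> 'g op" where
  "oppow D X A 0 = idop D X"
| "oppow D X A (Suc n) = opmult D X A (oppow D X A n)"

definition mexp :: "nat \<Rightarrow> 'g site set \<Rightarrow> 'g op \<Rightarrow> 'g op" where
  "mexp D X A = (\<lambda>\<sigma> \<tau>. \<Sum>n. oppow D X A n \<sigma> \<tau> / of_nat (fact n))"

definition selfadj :: "nat \<Rightarrow> 'g site set \<Rightarrow> 'g op \<Rightarrow> bool" where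
  "selfadj D X A \<longleftrightarrow> (\<forall>\<sigma>\<in>conf D X. \<forall>\<tau>\<in>conf D X. A \<sigma> \<tau> = cnj (A \<tau> \<sigma>))"

definition oplog :: "nat \<Rightarrow> 'g site set \<Rightarrow> 'g op \<Rightarrow> 'g op" where
  "oplog D X M = (THE K. canon D X K \<and> selfadj D X K \<and> op_eq D X (mexp D X K) M)"

definition opinv :: "nat \<Rightarrow> 'g site set \<Rightarrow> 'g op \<Rightarrow> 'g op" where
  "opinv D X A = (THE B. canon D X B \<and> op_eq D X (opmult D X A B) (idop D X))"

definition optrace :: "nat \<Rightarrow> 'g site set \<Rightarrow> 'g op \<Rightarrow> complex" where
  "optrace D X A = (\<Sum>\<sigma>\<in>conf D X. A \<sigma> \<sigma>)"

definition ptrace :: "nat \<Rightarrow> 'g site set \<Rightarrow> 'g site set \<Rightarrow> 'g op \<Rightarrow> 'g op" where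
  "ptrace D Lam L A = (\<lambda>\<sigma> \<tau>. if \<sigma> \<in> conf D (Lam \<inter> L) \<and> \<tau> \<in> conf D (Lam \<inter> L)
      then (\<Sum>\<rho>\<in>conf D (Lam - L). A (\<lambda>v. if v \<in> L then \<sigma> v else \<rho> v)
                                       (\<lambda>v. if v \<in> L then \<tau> v else \<rho> v))
      else 0)"

definition vnorm :: "nat \<Rightarrow> 'g site set \<Rightarrow> 'g vect \<Rightarrow> real" where
  "vnorm D X v = sqrt (\<Sum>\<sigma>\<in>conf D X. (cmod (v \<sigma>))\<^sup>2)"

definition opapply :: "nat \<Rightarrow> 'g site set \<Rightarrow> 'g op \<Rightarrow> 'g vect \<Rightarrow> 'g vect" where
  "opapply D X A v = (\<lambda>\<sigma>. \<Sum>\<tau>\<in>conf D X. A \<sigma> \<tau> * v \<tau>)"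

definition opnorm :: "nat \<Rightarrow> 'g site set \<Rightarrow> 'g op \<Rightarrow> real" where
  "opnorm D X A = Sup {vnorm D X (opapply D X A v) | v. vnorm D X v \<le> 1}"

text \<open>A local interaction: Phi X \<in> A_X self-adjoint for every finite X
  (only nonempty X contribute to Hamiltonians).\<close>
definition local_interaction :: "nat \<Rightarrow> ('g site set \<Rightarrow> 'g op) \<Rightarrow> bool" where
  "local_interaction D Phi \<longleftrightarrow> (\<forall>X. finite X \<longrightarrow> selfadj D X (Phi X))"

definition ham :: "nat \<Rightarrow> ('g site set \<Rightarrow> 'g op) \<Rightarrow> 'g site set \<Rightarrow> 'g op" where
  "ham D Phi Lam = (\<lambda>\<sigma> \<tau>. \<Sum>X\<in>{X. X \<subseteq> Lam \<and> X \<noteq> {}}. emb D X Lam (Phi X) \<sigma> \<tau>)"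

definition bexp :: "nat \<Rightarrow> ('g site set \<Rightarrow> 'g op) \<Rightarrow> real \<Rightarrow> 'g site set \<Rightarrow> 'g op" where
  "bexp D Phi \<beta> Lam = mexp D Lam (opscale D Lam (complex_of_real (- \<beta>)) (ham D Phi Lam))"

text \<open>Partition function Z_X = Tr exp(-beta H_X) (equals 1 for X = {}).\<close>
definition Zpart :: "nat \<Rightarrow> ('g site set \<Rightarrow> 'g op) \<Rightarrow> real \<Rightarrow> 'g site set \<Rightarrow> real" where
  "Zpart D Phi \<beta> X = Re (optrace D X (bexp D Phi \<beta> X))"

definition gibbs :: "nat \<Rightarrow> ('g site set \<Rightarrow> 'g op) \<Rightarrow> real \<Rightarrow> 'g site set \<Rightarrow> 'g op" where
  "gibbs D Phi \<beta> Lam = opscale D Lam (complex_of_real (1 / Zpart D Phi \<beta> Lam)) (bexp D Phi \<beta> Lam)"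

definition decay_bound :: "nat \<Rightarrow> ('g::finite site set \<Rightarrow> 'g op) \<Rightarrow> real \<Rightarrow> real \<Rightarrow> real \<Rightarrow> bool" where
  "decay_bound D Phi lam mu Delta \<longleftrightarrow>
     (\<forall>x. (\<lambda>X. opnorm D X (Phi X) * exp (lam * real (card X) + mu * sdiam X))
             summable_on {X. finite X \<and> x \<in> X}
        \<and> (\<Sum>\<^sub>\<infinity>X\<in>{X. finite X \<and> x \<in> X}. opnorm D X (Phi X) * exp (lam * real (card X) + mu * sdiam X)) \<le> Delta)"

definition weak_local_eff_ham ::
  "nat \<Rightarrow> ('g site set \<Rightarrow> 'g op) \<Rightarrow> real \<Rightarrow> ('g site set \<Rightarrow> 'g site set \<Rightarrow> 'g op) \<Rightarrow> bool" where
  "weak_local_eff_ham D Phi \<beta> PhiH \<longleftrightarrow>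
     (\<forall>L. local_interaction D (PhiH L)
        \<and> (\<forall>X. finite X \<longrightarrow> (\<exists>B. op_eq D X (PhiH L X) (emb D (X \<inter> L) X B)))
        \<and> (\<forall>L' X. finite X \<and> X \<inter> L' = X \<inter> L \<longrightarrow> op_eq D X (PhiH L X) (PhiH L' X))
        \<and> (\<forall>Lam. finite Lam \<longrightarrow>
             op_eq D Lam
               (emb D (Lam \<inter> L) Lam
                  (opadd D (Lam \<inter> L)
                    (opscale D (Lam \<inter> L) (complex_of_real (- 1 / \<beta>))
                       (oplog D (Lam \<inter> L) (ptrace D Lam L (bexp D Phi \<beta> Lam))))
                    (opscale D (Lam \<inter> L) (complex_of_real (ln (Zpart D Phi \<beta> (Lam - L)) / \<beta>))
                       (idop D (Lam \<inter> L)))))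
               (\<lambda>\<sigma> \<tau>. \<Sum>X\<in>{X. X \<subseteq> Lam \<and> X \<inter> L \<noteq> {}}. emb D X Lam (PhiH L X) \<sigma> \<tau>)))"

definition cov :: "nat \<Rightarrow> 'g site set \<Rightarrow> 'g op \<Rightarrow> 'g site set \<Rightarrow> 'g op \<Rightarrow> 'g site set \<Rightarrow> 'g op \<Rightarrow> real" where
  "cov D Lam \<rho> A OA B OB =
     cmod (optrace D Lam (opmult D Lam \<rho> (opmult D Lam (emb D A Lam OA) (emb D B Lam OB)))
           - optrace D Lam (opmult D Lam \<rho> (emb D A Lam OA))
             * optrace D Lam (opmult D Lam \<rho> (emb D B Lam OB)))"

definition uniform_clustering ::
  "nat \<Rightarrow> ('g::finite site set \<Rightarrow> 'g op) \<Rightarrow> real \<Rightarrow> (real \<Rightarrow> real) \<Rightarrow> nat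
     \<Rightarrow> ('g site set \<Rightarrow> real) \<Rightarrow> ('g site set \<Rightarrow> 'g site set \<Rightarrow> real) \<Rightarrow> bool" where
  "uniform_clustering D Phi \<beta> \<epsilon> b gf f \<longleftrightarrow>
     (\<forall>A. finite A \<longrightarrow> gf A \<ge> 0)
   \<and> (\<forall>A B. finite A \<and> finite B \<longrightarrow> f A B \<le> gf A * real (card B) ^ b)
   \<and> (\<forall>Lam A B l OA OB. finite Lam \<and> A \<subseteq> Lam \<and> B \<subseteq> Lam \<and> l \<ge> 0 \<and> sdist A B \<ge> l \<longrightarrow>
        cov D Lam (gibbs D Phi \<beta> Lam) A OA B OB
          \<le> f A B * opnorm D A OA * opnorm D B OB * \<epsilon> l)"

definition exp_decaying :: "(real \<Rightarrow> real) \<Rightarrow> bool" where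
  "exp_decaying \<epsilon> \<longleftrightarrow> (\<exists>C \<alpha>. C > 0 \<and> \<alpha> > 0 \<and> (\<forall>l\<ge>0. \<epsilon> l \<le> C * exp (- \<alpha> * l)))"

definition red :: "nat \<Rightarrow> ('g site set \<Rightarrow> 'g op) \<Rightarrow> real \<Rightarrow> 'g site set \<Rightarrow> 'g site set \<Rightarrow> 'g op" where
  "red D Phi \<beta> Lam X = ptrace D Lam X (gibbs D Phi \<beta> Lam)"

end

theory Submission
  imports Defs
begin

text \<open>Write \<open>Hh L\<close> for the sum of the effective terms meeting \<open>L\<close>, so that the marginal on \<open>L\<close> is a
  positive multiple of \<open>exp (- \<beta> Hh L)\<close>. By locality of the effective interaction, the terms of
  \<open>W = Hh (A \<union> C) - Hh A - Hh C\<close> all meet both \<open>A\<close> and \<open>C\<close>; a lattice path from \<open>A\<close> to \<open>C\<close> leaves \<open>A\<close>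
  through its boundary, so their total weight is at most a constant times
  \<open>|\<partial>A| exp (- mu dist(A, C) / 2)\<close>. For \<open>\<beta> < lam / (2 Delta)\<close> the imaginary-time evolution
  \<open>exp (- s Hh) W exp (s Hh)\<close> generated by \<open>Hh = Hh (A \<union> C)\<close> converges and is bounded by this weight,
  hence \<open>U = exp (- \<beta> Hh) exp (\<beta> (Hh - W))\<close> and its inverse differ from the identity by at most
  \<open>exp (\<beta> \<omega>) - 1\<close>, where \<open>\<omega>\<close> is that bound. The operator in question is \<open>\<kappa> U\<close> for a scalar \<open>\<kappa>\<close>, which is the expectation of the
  inverse of \<open>U\<close> in the marginal on \<open>A \<union> C\<close> and therefore equally close to 1.\<close>

section \<open>Estimates in Banach algebras\<close>

text \<open>Comparing the exponentials directly would cost a factor growing with the norm of the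
  Hamiltonian, hence with the volume. In the commutator expansion only terms meeting the support
  reached so far survive at each order, and after the factorials cancel the order n costs
  \<open>(2 * Delta / lam) ^ n\<close>. This is the origin of the temperature threshold. The scalar
  \<open>\<kappa>\<close> mixes normalisations that have no direct comparison, while traces of
  marginals are 1; this is why the inverse of \<open>U\<close> is estimated along with
  \<open>U\<close>. The rate \<open>mu\<close> is spent in halves: one half gives the decay in the
  distance, the other makes the sum over all sites of \<open>A\<close> converge around each boundary
  site. The inequality \<open>exp x - 1 \<le> x * exp x\<close> then yields the exponential of the
  boundary size. Two constructions answer the definitions. Regions are sets and not types, so all
  local algebras are packed into one Banach algebra. \<open>oplog\<close> is a definite description,
  so existence and uniqueness of self-adjoint logarithms are proved, by power series and positivity
  of diagonals instead of diagonalisation.\<close>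

lemma norm_diff_le_exp_if_norm_deriv_le:
  fixes u :: "real \<Rightarrow> 'a::real_normed_vector"
  assumes "b \<ge> 0" "w \<ge> 0"
    and deriv: "\<And>s. (u has_vector_derivative u' s) (at s)"
    and bound: "\<And>s. 0 \<le> s \<Longrightarrow> s \<le> b \<Longrightarrow> norm (u' s) \<le> w * norm (u s)"
  shows "norm (u b - u 0) \<le> norm (u 0) * (exp (w * b) - 1)"
proof -
  have cont: "continuous_on T u" for T
    using deriv by (meson continuous_at_imp_continuous_on has_vector_derivative_continuous)
  have "compact (u ` {0..b})"
    by (rule compact_continuous_image[OF cont]) simp
  then obtain N where N: "\<And>s. s \<in> {0..b} \<Longrightarrow> norm (u s) \<le> N"
    using compact_imp_bounded bounded_iff by (metis imageI)
  \<comment> \<open>Picard iteration in place of an integral form of Gronwall: \<open>P 0\<close> is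
    the constant bound \<open>N\<close>, and \<open>P (Suc n)\<close> is the primitive of
    \<open>w * P n\<close> with value \<open>norm (u 0)\<close> at 0. The term with \<open>N\<close>
    tends to 0, so the crude compactness bound leaves no trace.\<close>
  define P where "P n s = norm (u 0) * (\<Sum>k<n. (w * s) ^ k / fact k) + N * ((w * s) ^ n / fact n)"
    for n s
  have dP: "(P (Suc n) has_vector_derivative w * P n s) (at s)" for n s
  proof -
    have 1: "((\<lambda>s. (w * s) ^ Suc k / fact (Suc k)) has_real_derivative w * ((w * s) ^ k / fact k)) (at s)" for k
    proof -
      have "((\<lambda>s. (w * s) ^ Suc k / fact (Suc k)) has_real_derivative
          (real (Suc k) * w * (w * s) ^ k) / fact (Suc k)) (at s)"
        by (rule derivative_eq_intros refl | simp add: mult_ac del: of_nat_Suc)+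
      then show ?thesis by (simp add: field_simps del: of_nat_Suc)
    qed
    have 2: "P (Suc n) = (\<lambda>s. norm (u 0) * (1 + (\<Sum>k<n. (w * s) ^ Suc k / fact (Suc k)))
              + N * ((w * s) ^ Suc n / fact (Suc n)))"
      unfolding P_def by (rule ext, subst sum.lessThan_Suc_shift) simp
    have "(P (Suc n) has_real_derivative w * P n s) (at s)"
      unfolding 2 by (rule derivative_eq_intros 1 refl)+ (simp add: P_def sum_distrib_left algebra_simps)
    then show ?thesis
      by (simp add: has_real_derivative_iff_has_vector_derivative)
  qed
  have step: "norm (u s - u 0) \<le> P (Suc n) s - norm (u 0)"
    if IH: "\<And>s. 0 \<le> s \<Longrightarrow> s \<le> b \<Longrightarrow> norm (u s) \<le> P n s" and s: "0 \<le> s" "s \<le> b" for n s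
  proof (cases "s = 0")
    case True
    then show ?thesis unfolding P_def by (subst sum.lessThan_Suc_shift) simp
  next
    case False
    have "norm (u s - u 0) \<le> P (Suc n) s - P (Suc n) 0"
    proof (rule differentiable_bound_general)
      show "0 < s" using False s by simp
      show "continuous_on {0..s} u" by (rule cont)
      show "continuous_on {0..s} (P (Suc n))"
        using dP by (meson continuous_at_imp_continuous_on has_vector_derivative_continuous)
      show "(u has_vector_derivative u' x) (at x)" for x by (rule deriv)
      show "(P (Suc n) has_vector_derivative w * P n x) (at x)" for x by (rule dP)
      show "norm (u' x) \<le> w * P n x" if "0 < x" "x < s" for x
        using bound[of x] IH[of x] that s \<open>w \<ge> 0\<close>
        by (meson less_eq_real_def mult_left_mono order_trans)
    qed
    moreover have "P (Suc n) 0 = norm (u 0)"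
      unfolding P_def by (subst sum.lessThan_Suc_shift) simp
    ultimately show ?thesis by simp
  qed
  have bnd: "\<forall>s. 0 \<le> s \<longrightarrow> s \<le> b \<longrightarrow> norm (u s) \<le> P n s" for n
  proof (induction n)
    case 0
    then show ?case using N by (simp add: P_def)
  next
    case (Suc n)
    show ?case
    proof (intro allI impI)
      fix s assume s: "0 \<le> s" "s \<le> b"
      have "norm (u s) \<le> norm (u s - u 0) + norm (u 0)"
        by (metis norm_triangle_sub add.commute)
      then show "norm (u s) \<le> P (Suc n) s"
        using step[of n s] Suc s by fastforce
    qed
  qed
  have lim: "(\<lambda>n. P (Suc n) b - norm (u 0)) \<longlonglongrightarrow> norm (u 0) * exp (w * b) + N * 0 - norm (u 0)"
  proof -
    have "(\<lambda>k. (w * b) ^ k / fact k) sums exp (w * b)"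
      using exp_converges[of "w * b"] by (simp add: divide_inverse mult.commute)
    then have "(\<lambda>n. \<Sum>k<Suc n. (w * b) ^ k / fact k) \<longlonglongrightarrow> exp (w * b)"
      unfolding sums_def by (rule LIMSEQ_Suc)
    moreover have "(\<lambda>n. (w * b) ^ Suc n / fact (Suc n)) \<longlonglongrightarrow> 0"
      using LIMSEQ_Suc[OF summable_LIMSEQ_zero[OF summable_exp[of "w * b"]]]
      by (simp add: divide_inverse mult.commute)
    ultimately show ?thesis
      unfolding P_def by (intro tendsto_intros)
  qed
  have "norm (u b - u 0) \<le> norm (u 0) * exp (w * b) + N * 0 - norm (u 0)"
    by (rule LIMSEQ_le_const[OF lim]) (use step bnd \<open>b \<ge> 0\<close> in blast)
  then show ?thesis by (simp add: algebra_simps)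
qed

section \<open>Iterated commutators and imaginary-time evolution\<close>

primrec adpow :: "'a::ring \<Rightarrow> nat \<Rightarrow> 'a \<Rightarrow> 'a" where
  "adpow Z 0 W = W"
| "adpow Z (Suc n) W = Z * adpow Z n W - adpow Z n W * Z"

text \<open>The recursion adds the outermost commutator. Peeling off the innermost one lets an
  induction apply its hypothesis to a new operator of larger support.\<close>

lemma adpow_Suc_right: "adpow Z (Suc n) W = adpow Z n (Z * W - W * Z)"
  by (induction n) simp_all

lemma adpow_sum: "adpow Z n (\<Sum>i\<in>I. W i) = (\<Sum>i\<in>I. adpow Z n (W i))"
  by (induction n) (simp_all add: sum_distrib_left sum_distrib_right sum_subtractf)

text \<open>Hadamard's formula. The Cauchy product of the series for \<open>exp Z * W\<close> and
  \<open>exp (- Z)\<close> has the iterated commutator divided by \<open>fact n\<close> as its n-th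
  term.\<close>

lemma exp_conjugation_sums_adpow:
  fixes Z W :: "'a::{real_normed_algebra_1,banach}"
  shows "(\<lambda>n. adpow Z n W /\<^sub>R fact n) sums (exp Z * W * exp (- Z))"
proof -
  define S where "S = (\<lambda>(x::'a) n. x ^ n /\<^sub>R fact n)"
  have S_Suc: "x * S x n = real (Suc n) *\<^sub>R S x (Suc n)" for x n
    unfolding S_def by (simp del: mult_Suc of_nat_Suc)
  have S_Suc': "S x n * x = real (Suc n) *\<^sub>R S x (Suc n)" for x n
    using S_Suc[of x n] by (simp add: S_def power_commutes)
  have eq: "(\<Sum>i\<le>n. (S Z i * W) * S (- Z) (n - i)) = adpow Z n W /\<^sub>R fact n" for n
  proof (induction n)
    case 0
    then show ?case by (simp add: S_def)
  next
    case (Suc n)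
    define T where "T = (\<Sum>i\<le>n. (S Z i * W) * S (- Z) (n - i))"
    \<comment> \<open>Multiplying by \<open>Z\<close> raises one index, with the new index as
      weight. In degree \<open>Suc n\<close> the two contributions carry the weights
      \<open>i\<close> and \<open>Suc n - i\<close>, which add up to \<open>Suc n\<close> whatever
      \<open>i\<close> is.\<close>
    have "Z * T - T * Z = (\<Sum>i\<le>n. (Z * S Z i) * W * S (- Z) (n - i))
        + (\<Sum>i\<le>n. S Z i * W * (S (- Z) (n - i) * (- Z)))"
      unfolding T_def by (simp add: sum_distrib_left sum_distrib_right mult.assoc sum_negf)
    also have "\<dots> = (\<Sum>i\<le>n. real (Suc i) *\<^sub>R (S Z (Suc i) * W * S (- Z) (n - i)))
        + (\<Sum>i\<le>n. real (Suc n - i) *\<^sub>R (S Z i * W * S (- Z) (Suc n - i)))"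
      by (simp only: S_Suc S_Suc') (simp add: Suc_diff_le)
    also have "(\<Sum>i\<le>n. real (Suc i) *\<^sub>R (S Z (Suc i) * W * S (- Z) (n - i)))
        = (\<Sum>i\<le>Suc n. real i *\<^sub>R (S Z i * W * S (- Z) (Suc n - i)))"
      by (subst sum.atMost_Suc_shift) simp
    also have "(\<Sum>i\<le>n. real (Suc n - i) *\<^sub>R (S Z i * W * S (- Z) (Suc n - i)))
        = (\<Sum>i\<le>Suc n. real (Suc n - i) *\<^sub>R (S Z i * W * S (- Z) (Suc n - i)))"
      by simp
    also have "(\<Sum>i\<le>Suc n. real i *\<^sub>R (S Z i * W * S (- Z) (Suc n - i)))
        + (\<Sum>i\<le>Suc n. real (Suc n - i) *\<^sub>R (S Z i * W * S (- Z) (Suc n - i)))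
        = (\<Sum>i\<le>Suc n. real (Suc n) *\<^sub>R (S Z i * W * S (- Z) (Suc n - i)))"
      by (simp flip: sum.distrib scaleR_add_left of_nat_add)
    also have "\<dots> = real (Suc n) *\<^sub>R (\<Sum>i\<le>Suc n. S Z i * W * S (- Z) (Suc n - i))"
      by (simp only: scaleR_right.sum)
    finally have 1: "(\<Sum>i\<le>Suc n. S Z i * W * S (- Z) (Suc n - i)) = (Z * T - T * Z) /\<^sub>R real (Suc n)"
      by (simp del: sum.cl_ivl_Suc of_nat_Suc)
    have 2: "T = adpow Z n W /\<^sub>R fact n" using Suc T_def by simp
    show ?case unfolding 1 2
      by (simp add: algebra_simps scaleR_diff_right del: of_nat_Suc)
  qed
  have "(\<lambda>n. \<Sum>i\<le>n. (S Z i * W) * S (- Z) (n - i)) sums ((\<Sum>k. S Z k * W) * (\<Sum>k. S (- Z) k))"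
  proof (rule Cauchy_product_sums)
    show "summable (\<lambda>k. norm (S (- Z) k))" unfolding S_def by (rule summable_norm_exp)
    show "summable (\<lambda>k. norm (S Z k * W))"
    proof (rule summable_comparison_test')
      show "summable (\<lambda>k. norm (S Z k) * norm W)"
        unfolding S_def by (intro summable_mult2 summable_norm_exp)
      show "norm (norm (S Z n * W)) \<le> norm (S Z n) * norm W" for n
        by (simp add: norm_mult_ineq)
    qed
  qed
  moreover have "(\<Sum>k. S Z k * W) = exp Z * W"
    unfolding S_def exp_def by (rule suminf_mult2[symmetric]) (rule summable_exp_generic)
  ultimately show ?thesis unfolding eq by (simp add: S_def exp_def)
qed

text \<open>A single term of the series of \<open>exp (real n)\<close> is at most its sum. This
  replaces Stirling's formula in the commutator bounds.\<close>

lemma power_self_le_fact_exp: "real n ^ n \<le> fact n * exp (real n)"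
proof -
  have "real n ^ n / fact n \<le> exp (real n)"
    using sum_le_suminf[OF summable_exp[of "real n"], of "{n}"]
    by (simp add: exp_def divide_inverse mult.commute)
  then show ?thesis by (simp add: field_simps)
qed

text \<open>Union bound: a set meeting \<open>S\<close> is counted once for each common site. It
  reduces sums over sets meeting a region to the sums at one site that the decay conditions
  control.\<close>

lemma sum_meeting_le:
  fixes F :: "'v set \<Rightarrow> real"
  assumes "finite I" "finite S" "\<And>Y. F Y \<ge> 0"
  shows "(\<Sum>Y\<in>{Y\<in>I. Y \<inter> S \<noteq> {}}. F Y) \<le> (\<Sum>x\<in>S. \<Sum>Y\<in>{Y\<in>I. x \<in> Y}. F Y)"
proof -
  have "(\<Sum>Y\<in>{Y\<in>I. Y \<inter> S \<noteq> {}}. F Y) \<le> (\<Sum>Y\<in>{Y\<in>I. Y \<inter> S \<noteq> {}}. \<Sum>x\<in>{x\<in>S. x \<in> Y}. F Y)"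
  proof (rule sum_mono)
    fix Y assume "Y \<in> {Y\<in>I. Y \<inter> S \<noteq> {}}"
    then obtain x where "x \<in> {x\<in>S. x \<in> Y}" by auto
    then show "F Y \<le> (\<Sum>x\<in>{x\<in>S. x \<in> Y}. F Y)"
      using assms by (intro member_le_sum[of x]) auto
  qed
  also have "\<dots> \<le> (\<Sum>Y\<in>I. \<Sum>x\<in>{x\<in>S. x \<in> Y}. F Y)"
    using assms by (intro sum_mono2) (auto intro: sum_nonneg)
  also have "\<dots> = (\<Sum>x\<in>S. \<Sum>Y\<in>{Y\<in>I. x \<in> Y}. F Y)"
    using assms by (intro sum.swap_restrict)
  finally show ?thesis .
qed

locale local_hamiltonian =
  fixes I :: "'v set set" and h :: "'v set \<Rightarrow> 'a::{real_normed_algebra_1,banach}"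
    and lam Delta :: real
  assumes fin_I: "finite I" and fin_mem: "\<And>Y. Y \<in> I \<Longrightarrow> finite Y"
    and commute: "\<And>X Y. X \<in> I \<Longrightarrow> Y \<in> I \<Longrightarrow> X \<inter> Y = {} \<Longrightarrow> h X * h Y = h Y * h X"
    and lam_pos: "lam > 0" and Delta_pos: "Delta > 0"
    and decay: "\<And>x. (\<Sum>Y\<in>{Y\<in>I. x \<in> Y}. norm (h Y) * exp (lam * card Y)) \<le> Delta"
begin

text \<open>Support is encoded by commutation alone: an abstract algebra has no tensor factors, and
  the expansion only has to know which terms of the Hamiltonian drop out of a commutator.\<close>

definition loc :: "'v set \<Rightarrow> 'a \<Rightarrow> bool" where
  "loc S W \<longleftrightarrow> (\<forall>Y\<in>I. Y \<inter> S = {} \<longrightarrow> h Y * W = W * h Y)"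

lemma loc_commutator:
  assumes "loc S W" "Y \<in> I"
  shows "loc (S \<union> Y) (h Y * W - W * h Y)"
  unfolding loc_def
proof (intro ballI impI)
  fix X assume X: "X \<in> I" "X \<inter> (S \<union> Y) = {}"
  then have 1: "h X * W = W * h X" using assms by (auto simp: loc_def)
  have 2: "h X * h Y = h Y * h X" using commute[of X Y] X assms by blast
  have "h X * (h Y * W) = h Y * (h X * W)" by (metis 2 mult.assoc)
  also have "\<dots> = h Y * W * h X" by (simp add: 1 mult.assoc)
  finally have 3: "h X * (h Y * W) = h Y * W * h X" .
  have "h X * (W * h Y) = W * (h X * h Y)" by (metis 1 mult.assoc)
  also have "\<dots> = W * h Y * h X" by (simp add: 2 mult.assoc)
  finally show "h X * (h Y * W - W * h Y) = (h Y * W - W * h Y) * h X"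
    using 3 by (simp add: algebra_simps)
qed

text \<open>Each commutator enlarges the support by some \<open>Y\<close> and costs a factor \<open>2 |S| Delta\<close>; trading
  \<open>|S|\<close> for \<open>exp (d |S|) / (e d)\<close> with \<open>n d = lam\<close> makes the recursion close.\<close>

lemma norm_adpow_le_aux:
  assumes "d > 0" "real n * d \<le> lam" "finite S" "loc S W"
  shows "norm (adpow (\<Sum>Y\<in>I. h Y) n W)
    \<le> norm W * (2 * Delta / (exp 1 * d)) ^ n * exp (real n * d * card S)"
  using assms(2-)
proof (induction n arbitrary: S W)
  case 0
  then show ?case by simp
next
  case (Suc n)
  define J where "J = {Y\<in>I. Y \<inter> S \<noteq> {}}"
  define q where "q = 2 * Delta / (exp 1 * d)"
  have q: "q \<ge> 0" using Delta_pos assms(1) by (simp add: q_def)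
  have nd: "real n * d \<le> lam"
    using Suc.prems(1) assms(1) by (simp add: algebra_simps)
  \<comment> \<open>Terms disjoint from \<open>S\<close> commute with \<open>W\<close>. This removes
    the volume from the estimate: only \<open>J\<close>, controlled by \<open>card S\<close>,
    remains.\<close>
  have comm: "(\<Sum>Y\<in>I. h Y) * W - W * (\<Sum>Y\<in>I. h Y) = (\<Sum>Y\<in>J. h Y * W - W * h Y)"
  proof -
    have "(\<Sum>Y\<in>I. h Y) * W - W * (\<Sum>Y\<in>I. h Y) = (\<Sum>Y\<in>I. h Y * W - W * h Y)"
      by (simp add: sum_distrib_left sum_distrib_right sum_subtractf)
    also have "\<dots> = (\<Sum>Y\<in>J. h Y * W - W * h Y)"
      by (rule sum.mono_neutral_right) (use fin_I Suc.prems(3) in \<open>auto simp: J_def loc_def\<close>)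
    finally show ?thesis .
  qed
  have summand: "norm (adpow (\<Sum>Y\<in>I. h Y) n (h Y * W - W * h Y))
      \<le> 2 * norm W * q ^ n * exp (real n * d * card S) * (norm (h Y) * exp (lam * card Y))"
    if Y: "Y \<in> J" for Y
  proof -
    have YI: "Y \<in> I" using Y by (simp add: J_def)
    have nY: "norm (h Y * W - W * h Y) \<le> 2 * norm W * norm (h Y)"
      using norm_triangle_ineq4[of "h Y * W" "W * h Y"] norm_mult_ineq[of "h Y" W]
        norm_mult_ineq[of W "h Y"] by (simp add: mult.commute[of "norm (h Y)"])
    have cd: "real (card (S \<union> Y)) \<le> real (card S) + real (card Y)"
      using card_Un_le[of S Y] by linarith
    have "real n * d * card (S \<union> Y) \<le> real n * d * card S + real n * d * card Y"
      using mult_left_mono[OF cd, of "real n * d"] assms(1) by (simp add: distrib_left)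
    \<comment> \<open>The growth of the support by \<open>Y\<close> is paid for by the weight
      \<open>exp (lam * card Y)\<close> in \<open>decay\<close>; hence the constraint
      \<open>real n * d \<le> lam\<close>.\<close>
    also have "real n * d * card Y \<le> lam * card Y"
      using nd by (rule mult_right_mono) simp
    finally have e: "exp (real n * d * card (S \<union> Y)) \<le> exp (real n * d * card S) * exp (lam * card Y)"
      by (simp flip: exp_add)
    have "norm (adpow (\<Sum>Y\<in>I. h Y) n (h Y * W - W * h Y))
      \<le> norm (h Y * W - W * h Y) * q ^ n * exp (real n * d * card (S \<union> Y))"
      unfolding q_def using Suc.prems fin_mem[OF YI] YI nd
      by (intro Suc.IH loc_commutator) auto
    also have "\<dots> \<le> (2 * norm W * norm (h Y)) * q ^ n * (exp (real n * d * card S) * exp (lam * card Y))"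
      using nY e q by (intro mult_mono) auto
    finally show ?thesis by (simp add: mult_ac)
  qed
  have "adpow (\<Sum>Y\<in>I. h Y) (Suc n) W = (\<Sum>Y\<in>J. adpow (\<Sum>Y\<in>I. h Y) n (h Y * W - W * h Y))"
    by (simp only: adpow_Suc_right comm adpow_sum)
  then have "norm (adpow (\<Sum>Y\<in>I. h Y) (Suc n) W)
      \<le> (\<Sum>Y\<in>J. 2 * norm W * q ^ n * exp (real n * d * card S) * (norm (h Y) * exp (lam * card Y)))"
    using summand by (simp add: sum_norm_le)
  also have "\<dots> = 2 * norm W * q ^ n * exp (real n * d * card S) * (\<Sum>Y\<in>J. norm (h Y) * exp (lam * card Y))"
    by (simp add: sum_distrib_left)
  also have "\<dots> \<le> 2 * norm W * q ^ n * exp (real n * d * card S) * (real (card S) * Delta)"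
  proof (rule mult_left_mono)
    have "(\<Sum>Y\<in>J. norm (h Y) * exp (lam * card Y))
        \<le> (\<Sum>x\<in>S. \<Sum>Y\<in>{Y\<in>I. x \<in> Y}. norm (h Y) * exp (lam * card Y))"
      unfolding J_def using fin_I Suc.prems by (intro sum_meeting_le) auto
    also have "\<dots> \<le> real (card S) * Delta" using decay by (rule sum_bounded_above)
    finally show "(\<Sum>Y\<in>J. norm (h Y) * exp (lam * card Y)) \<le> real (card S) * Delta" .
  qed (use q in auto)
  also have "\<dots> \<le> 2 * norm W * q ^ n * exp (real n * d * card S) * (exp (d * card S) / (exp 1 * d) * Delta)"
  proof -
    have "d * card S \<le> exp (d * card S - 1)"
      using exp_ge_add_one_self[of "d * card S - 1"] by simp
    then have "real (card S) \<le> exp (d * card S) / (exp 1 * d)"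
      using assms(1) by (simp add: exp_diff field_simps)
    then show ?thesis using q Delta_pos by (intro mult_left_mono mult_right_mono) auto
  qed
  also have "\<dots> = norm W * q ^ Suc n * exp (real (Suc n) * d * card S)"
  proof -
    have "exp (real (Suc n) * d * card S) = exp (real n * d * card S) * exp (d * card S)"
      by (simp add: algebra_simps flip: exp_add)
    then show ?thesis by (simp add: q_def)
  qed
  finally show ?case by (simp add: q_def)
qed

text \<open>The free parameter is taken as \<open>d = lam / n\<close>, the largest value allowed for
  \<open>n\<close> commutators. The factor \<open>(exp 1 * d) ^ n\<close> in the denominator then
  produces \<open>real n ^ n / exp (real n)\<close>, which is at most \<open>fact n\<close>. The
  case \<open>n = 0\<close> is separate because \<open>d\<close> would divide by 0.\<close>

lemma norm_adpow_le:
  assumes "finite S" "loc S W"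
  shows "norm (adpow (\<Sum>Y\<in>I. h Y) n W) \<le> norm W * exp (lam * card S) * (fact n * (2 * Delta / lam) ^ n)"
proof (cases "n = 0")
  case True
  then show ?thesis using lam_pos by (simp add: mult_le_cancel_left1)
next
  case False
  define d where "d = lam / n"
  have d: "d > 0" "real n * d = lam" using False lam_pos by (auto simp: d_def)
  have "norm (adpow (\<Sum>Y\<in>I. h Y) n W) \<le> norm W * (2 * Delta / (exp 1 * d)) ^ n * exp (lam * card S)"
    using norm_adpow_le_aux[OF d(1) _ assms, of n] d by simp
  also have "(2 * Delta / (exp 1 * d)) ^ n = real n ^ n / exp (real n) * (2 * Delta / lam) ^ n"
    using False lam_pos
    by (simp add: d_def power_divide power_mult_distrib exp_of_nat_mult[of n 1, simplified] field_simps)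
  also have "norm W * (real n ^ n / exp (real n) * (2 * Delta / lam) ^ n) * exp (lam * card S)
    \<le> norm W * (fact n * (2 * Delta / lam) ^ n) * exp (lam * card S)"
    using power_self_le_fact_exp[of n] Delta_pos lam_pos
    by (intro mult_right_mono mult_left_mono) (auto simp: field_simps)
  finally show ?thesis by (simp add: mult_ac)
qed

text \<open>The \<open>fact n\<close> in the bound on commutators cancels the one in Hadamard's
  series. What remains is a geometric series of ratio \<open>2 * Delta * b / lam\<close>, convergent
  exactly under the stated smallness of \<open>b\<close>.\<close>

lemma norm_exp_conjugation_le:
  assumes "finite S" "loc S W" "\<bar>s\<bar> \<le> b" "2 * Delta * b < lam"
  shows "norm (exp (s *\<^sub>R (\<Sum>Y\<in>I. h Y)) * W * exp (- (s *\<^sub>R (\<Sum>Y\<in>I. h Y))))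
    \<le> norm W * exp (lam * card S) / (1 - 2 * Delta * b / lam)"
proof -
  define Z where "Z = (\<Sum>Y\<in>I. h Y)"
  define c where "c = norm W * exp (lam * card S)"
  define r where "r = 2 * Delta * b / lam"
  have r: "0 \<le> r" "r < 1"
    using assms Delta_pos lam_pos by (auto simp: r_def)
  have ad: "adpow (s *\<^sub>R Z) n W = s ^ n *\<^sub>R adpow Z n W" for n
    by (induction n) (simp_all add: scaleR_diff_right)
  have le: "norm (adpow (s *\<^sub>R Z) n W /\<^sub>R fact n) \<le> c * r ^ n" for n
  proof -
    have "norm (adpow (s *\<^sub>R Z) n W /\<^sub>R fact n) = \<bar>s\<bar> ^ n * norm (adpow Z n W) / fact n"
      by (simp add: ad power_abs field_simps)
    also have "\<dots> \<le> b ^ n * (c * (fact n * (2 * Delta / lam) ^ n)) / fact n"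
      using norm_adpow_le[OF assms(1,2), of n] assms(3) lam_pos Delta_pos
      by (intro divide_right_mono mult_mono power_mono) (auto simp: Z_def c_def)
    also have "\<dots> = c * r ^ n"
      by (simp add: r_def power_divide power_mult_distrib)
    finally show ?thesis .
  qed
  have gs: "(\<lambda>n. c * r ^ n) sums (c * (1 / (1 - r)))"
    using r by (intro sums_mult geometric_sums) auto
  have s: "(\<lambda>n. adpow (s *\<^sub>R Z) n W /\<^sub>R fact n) sums (exp (s *\<^sub>R Z) * W * exp (- (s *\<^sub>R Z)))"
    by (rule exp_conjugation_sums_adpow)
  have "norm (suminf (\<lambda>n. adpow (s *\<^sub>R Z) n W /\<^sub>R fact n)) \<le> suminf (\<lambda>n. c * r ^ n)"
    by (rule norm_suminf_le[OF le]) (use gs in \<open>simp add: sums_iff\<close>)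
  then show ?thesis
    using s gs by (simp add: sums_iff Z_def c_def r_def)
qed

text \<open>Both \<open>exp (-s Z) exp (s (Z - W))\<close> and its inverse solve linear equations whose coefficient is
  \<open>exp (-s Z) W exp (s Z)\<close>.\<close>

lemma norm_exp_perturbation:
  assumes fin: "finite J" "\<And>X. X \<in> J \<Longrightarrow> finite X" and loc: "\<And>X. X \<in> J \<Longrightarrow> loc X (w X)"
    and b: "0 \<le> b" "2 * Delta * b < lam"
    and omega: "(\<Sum>X\<in>J. norm (w X) * exp (lam * card X)) / (1 - 2 * Delta * b / lam) \<le> \<omega>"
  defines "Z \<equiv> (\<Sum>Y\<in>I. h Y)" and "W \<equiv> (\<Sum>X\<in>J. w X)"
  shows "norm (exp (- (b *\<^sub>R Z)) * exp (b *\<^sub>R (Z - W)) - 1) \<le> exp (\<omega> * b) - 1" (is ?th1)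
    and "norm (exp (- (b *\<^sub>R (Z - W))) * exp (b *\<^sub>R Z) - 1) \<le> exp (\<omega> * b) - 1" (is ?th2)
proof -
  define a where "a s = exp (s *\<^sub>R (- Z)) * W * exp (s *\<^sub>R Z)" for s
  have r: "1 - 2 * Delta * b / lam > 0" using b lam_pos by simp
  have om0: "\<omega> \<ge> 0"
    using omega r by (smt (verit) divide_nonneg_pos exp_ge_zero mult_nonneg_nonneg norm_ge_zero sum_nonneg)
  have a: "norm (a s) \<le> \<omega>" if "0 \<le> s" "s \<le> b" for s
  proof -
    \<comment> \<open>The support of the whole of \<open>W\<close> may be large. Evolving it term by
      term charges each \<open>w X\<close> only for its own support \<open>X\<close>.\<close>
    have "a s = (\<Sum>X\<in>J. exp ((- s) *\<^sub>R Z) * w X * exp (- ((- s) *\<^sub>R Z)))"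
      by (simp add: a_def W_def sum_distrib_left sum_distrib_right)
    also have "norm \<dots> \<le> (\<Sum>X\<in>J. norm (w X) * exp (lam * card X) / (1 - 2 * Delta * b / lam))"
      unfolding Z_def using that fin loc b by (intro sum_norm_le norm_exp_conjugation_le) auto
    also have "\<dots> \<le> \<omega>" using omega by (simp add: sum_divide_distrib)
    finally show ?thesis .
  qed
  have ee: "exp (s *\<^sub>R Z) * exp (s *\<^sub>R (- Z)) = 1" for s
    by (simp flip: exp_add_commuting)
  define u where "u s = exp (s *\<^sub>R (- Z)) * exp (s *\<^sub>R (Z - W))" for s
  have du: "(u has_vector_derivative - (a s * u s)) (at s)" for s
  proof -
    have "(u has_vector_derivative exp (s *\<^sub>R (- Z)) * ((Z - W) * exp (s *\<^sub>R (Z - W)))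
         + exp (s *\<^sub>R (- Z)) * (- Z) * exp (s *\<^sub>R (Z - W))) (at s)"
      unfolding u_def
      by (intro has_vector_derivative_mult exp_scaleR_has_vector_derivative_left
          exp_scaleR_has_vector_derivative_right)
    moreover have "a s * u s = exp (s *\<^sub>R (- Z)) * W * exp (s *\<^sub>R (Z - W))"
      unfolding a_def u_def by (metis ee mult.assoc mult_1)
    ultimately show ?thesis by (simp add: algebra_simps)
  qed
  define v where "v s = exp (s *\<^sub>R (- (Z - W))) * exp (s *\<^sub>R Z)" for s
  have dv: "(v has_vector_derivative (v s * a s)) (at s)" for s
  proof -
    have "(v has_vector_derivative exp (s *\<^sub>R (- (Z - W))) * (Z * exp (s *\<^sub>R Z))
         + exp (s *\<^sub>R (- (Z - W))) * (- (Z - W)) * exp (s *\<^sub>R Z)) (at s)"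
      unfolding v_def
      by (intro has_vector_derivative_mult exp_scaleR_has_vector_derivative_left
          exp_scaleR_has_vector_derivative_right)
    moreover have "v s * a s = exp (s *\<^sub>R (- (Z - W))) * W * exp (s *\<^sub>R Z)"
      unfolding a_def v_def by (metis ee mult.assoc mult_1)
    ultimately show ?thesis by (simp add: algebra_simps)
  qed
  have "norm (u b - u 0) \<le> norm (u 0) * (exp (\<omega> * b) - 1)"
  proof (rule norm_diff_le_exp_if_norm_deriv_le[OF b(1) om0 du])
    fix s assume "0 \<le> s" "s \<le> b"
    then show "norm (- (a s * u s)) \<le> \<omega> * norm (u s)"
      using norm_mult_ineq[of "a s" "u s"] mult_right_mono[OF a[of s], of "norm (u s)"] by simp
  qed
  then show ?th1 by (simp add: u_def)
  have "norm (v b - v 0) \<le> norm (v 0) * (exp (\<omega> * b) - 1)"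
  proof (rule norm_diff_le_exp_if_norm_deriv_le[OF b(1) om0 dv])
    fix s assume "0 \<le> s" "s \<le> b"
    then show "norm (v s * a s) \<le> \<omega> * norm (v s)"
      using norm_mult_ineq[of "v s" "a s"] mult_left_mono[OF a[of s], of "norm (v s)"]
      by (simp add: mult.commute)
  qed
  then show ?th2 by (simp add: v_def flip: scaleR_minus_right)
qed

end

section \<open>Derivative of the exponential and the logarithm series in a Banach algebra\<close>

lemma norm_exp_minus_id_le:
  fixes x :: "'a::{real_normed_algebra_1,banach}"
  shows "norm (exp x - 1 - x) \<le> (norm x)\<^sup>2 * exp (norm x)"
proof -
  define T where "T = (\<lambda>n. x ^ n /\<^sub>R fact n)"
  have s: "T sums exp x" unfolding T_def by (rule exp_converges)
  have s2: "(\<lambda>n. T (n + 2)) sums (exp x - (\<Sum>n<2. T n))"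
    using s by (rule sums_split_initial_segment)
  have "(\<Sum>n<2. T n) = 1 + x" by (simp add: T_def numeral_2_eq_2)
  then have s3: "(\<lambda>n. T (n + 2)) sums (exp x - 1 - x)" using s2 by (simp add: algebra_simps)
  have le: "norm (T (n + 2)) \<le> (norm x)\<^sup>2 * (norm x ^ n /\<^sub>R fact n)" for n
  proof -
    have "norm (T (n + 2)) \<le> norm x ^ (n + 2) / fact (n + 2)"
      unfolding T_def using norm_power_ineq[of x "n+2"]
      by (simp add: divide_inverse mult.commute mult_left_mono)
    also have "\<dots> \<le> norm x ^ (n + 2) / fact n"
      by (intro divide_left_mono fact_mono) auto
    finally show ?thesis by (simp add: power2_eq_square divide_inverse mult_ac)
  qed
  have e: "(\<lambda>n. (norm x)\<^sup>2 * (norm x ^ n /\<^sub>R fact n)) sums ((norm x)\<^sup>2 * exp (norm x))"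
    by (intro sums_mult exp_converges)
  have "norm (\<Sum>n. T (n + 2)) \<le> (\<Sum>n. (norm x)\<^sup>2 * (norm x ^ n /\<^sub>R fact n))"
    by (rule norm_suminf_le[OF le]) (use e in \<open>simp add: sums_iff\<close>)
  then show ?thesis using s3 e by (simp add: sums_iff)
qed

lemma exp_has_derivative_at_0:
  "((exp :: 'a::{real_normed_algebra_1,banach} \<Rightarrow> 'a) has_derivative (\<lambda>x. x)) (at 0)"
proof (rule has_derivativeI_sandwich[of 1])
  fix y :: 'a assume y: "y \<noteq> 0" "dist y 0 < 1"
  then show "norm ((exp y - exp 0) - (y - 0)) / norm (y - 0) \<le> norm y * exp 1"
  proof -
    have "norm (exp y - 1 - y) \<le> (norm y)\<^sup>2 * exp (norm y)" by (rule norm_exp_minus_id_le)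
    also have "\<dots> \<le> (norm y)\<^sup>2 * exp 1" using y by (intro mult_left_mono) auto
    finally show ?thesis using y by (simp add: power2_eq_square field_simps)
  qed
next
  have "((\<lambda>y::'a. norm y * exp 1) \<longlongrightarrow> norm (0::'a) * exp 1) (at 0)"
    by (intro tendsto_intros)
  then show "((\<lambda>y::'a. norm y * exp 1) \<longlongrightarrow> 0) (at 0)" by simp
qed auto

text \<open>Commuting values give \<open>exp (l t) = exp (l s) * exp (l t - l s)\<close>, so only
  the derivative of \<open>exp\<close> at 0 enters.\<close>

lemma has_vector_derivative_exp_commuting:
  fixes l :: "real \<Rightarrow> 'a::{real_normed_algebra_1,banach}"
  assumes "\<And>t. t \<in> S \<Longrightarrow> l t * l s = l s * l t" and "(l has_vector_derivative l') (at s within S)"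
    and "s \<in> S"
  shows "((\<lambda>t. exp (l t)) has_vector_derivative exp (l s) * l') (at s within S)"
proof -
  have 1: "((\<lambda>t. l t - l s) has_derivative (\<lambda>t. t *\<^sub>R l')) (at s within S)"
    using assms(2) by (auto simp: has_vector_derivative_def intro!: derivative_eq_intros)
  have "((\<lambda>t. exp (l t - l s)) has_derivative (\<lambda>t. t *\<^sub>R l')) (at s within S)"
    using has_derivative_compose[OF 1, of exp "\<lambda>x. x"] exp_has_derivative_at_0 by simp
  then have "((\<lambda>t. exp (l s) * exp (l t - l s)) has_vector_derivative exp (l s) * l') (at s within S)"
    by (intro has_vector_derivative_mult_right) (simp add: has_vector_derivative_def)
  moreover have "exp (l t) = exp (l s) * exp (l t - l s)" if "t \<in> S" for t
    using assms(1)[OF that]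
    by (subst exp_add_commuting[symmetric]) (auto simp: algebra_simps)
  ultimately show ?thesis
    by (rule has_vector_derivative_transform[OF assms(3), rotated])
qed

text \<open>Let \<open>l s\<close> be the sum of the \<open>f n s\<close> and \<open>g' s\<close>
  its derivative. Since \<open>g' s * (1 - s *\<^sub>R R) = R\<close>, the function
  \<open>exp (l s) * (1 - s *\<^sub>R R)\<close> has derivative 0 on the unit interval. It equals 1
  at 0, and its value at 1 gives the claim.\<close>

lemma exp_log_series:
  fixes R :: "'a::{real_normed_algebra_1,banach}"
  assumes R: "norm R < 1"
  shows "summable (\<lambda>n. R ^ Suc n /\<^sub>R real (Suc n))"
    and "exp (- (\<Sum>n. R ^ Suc n /\<^sub>R real (Suc n))) = 1 - R"
proof -
  define S where "S = {0..1::real}"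
  define f where "f n s = (s ^ Suc n / real (Suc n)) *\<^sub>R R ^ Suc n" for n s
  define f' where "f' n s = s ^ n *\<^sub>R R ^ Suc n" for n s
  define g' where "g' s = (\<Sum>n. f' n s)" for s
  have geo: "summable (\<lambda>n. norm R ^ n)" using R by (intro summable_geometric) simp
  \<comment> \<open>Giving away one factor \<open>norm R\<close> leaves a plain geometric majorant,
    uniform in \<open>s\<close> up to and including 1.\<close>
  have f'le: "norm (f' n s) \<le> norm R ^ n" if "s \<in> S" for n s
  proof -
    have "norm (R ^ Suc n) \<le> norm R ^ n"
      using norm_power_ineq[of R "Suc n"] R
      by (smt (verit, best) mult_left_le_one_le norm_ge_zero power_Suc zero_le_power)
    moreover have "\<bar>s ^ n\<bar> \<le> 1" using that by (auto simp: S_def power_abs power_le_one)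
    ultimately have "\<bar>s ^ n\<bar> * norm (R ^ Suc n) \<le> 1 * norm R ^ n"
      by (intro mult_mono) auto
    then show ?thesis by (simp add: f'_def)
  qed
  have f'sum: "summable (\<lambda>n. f' n s)" if "s \<in> S" for s
    using f'le[OF that] geo by (rule summable_comparison_test'[rotated])
  have unif: "uniform_limit S (\<lambda>n s. \<Sum>i<n. f' i s) g' sequentially"
    unfolding g'_def by (rule Weierstrass_m_test[OF _ geo]) (rule f'le)
  have "\<exists>g. \<forall>s\<in>S. (\<lambda>n. f n s) sums g s \<and> (g has_derivative (\<lambda>h. h *\<^sub>R g' s)) (at s within S)"
  proof (rule has_derivative_series)
    show "convex S" by (simp add: S_def)
    show "(f n has_derivative (\<lambda>h. h *\<^sub>R f' n s)) (at s within S)" for n s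
      unfolding f_def f'_def
      by (rule derivative_eq_intros refl | simp add: field_simps del: of_nat_Suc power_Suc)+
    show "\<forall>\<^sub>F n in sequentially. \<forall>s\<in>S. \<forall>h. norm ((\<Sum>i<n. h *\<^sub>R f' i s) - h *\<^sub>R g' s) \<le> e * norm h"
      if "e > 0" for e
    proof -
      have "\<forall>\<^sub>F n in sequentially. \<forall>s\<in>S. dist (\<Sum>i<n. f' i s) (g' s) < e"
        using uniform_limitD[OF unif that] .
      then show ?thesis
      proof (rule eventually_mono, intro ballI allI)
        fix n s and h :: real
        assume a: "\<forall>s\<in>S. dist (\<Sum>i<n. f' i s) (g' s) < e" and "s \<in> S"
        then have "norm ((\<Sum>i<n. f' i s) - g' s) \<le> e" by (auto simp: dist_norm less_imp_le)
        then show "norm ((\<Sum>i<n. h *\<^sub>R f' i s) - h *\<^sub>R g' s) \<le> e * norm h"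
          by (simp flip: scaleR_right.sum scaleR_diff_right) (simp add: mult.commute[of e] mult_left_mono)
      qed
    qed
    show "0 \<in> S" "(\<lambda>n. f n 0) sums 0" by (auto simp: S_def f_def)
  qed
  then obtain l where l: "\<And>s. s \<in> S \<Longrightarrow> (\<lambda>n. f n s) sums l s"
    and dl: "\<And>s. s \<in> S \<Longrightarrow> (l has_vector_derivative g' s) (at s within S)"
    by (auto simp: has_vector_derivative_def)
  have comm_gen: "l s * X = X * l s" if "s \<in> S" "R * X = X * R" for s X
  proof -
    have "f n s * X = X * f n s" for n
      unfolding f_def using power_commuting_commutes[OF that(2), of "Suc n"]
      by (simp del: power_Suc)
    then have "(\<lambda>n. f n s * X) sums (X * l s)" using sums_mult[OF l[OF that(1)], of X] by simp
    then show ?thesis using sums_mult2[OF l[OF that(1)], of X] sums_unique2 by blast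
  qed
  have comm: "l s * l t = l t * l s" if "s \<in> S" "t \<in> S" for s t
    using that comm_gen[of t R] by (intro comm_gen) auto
  have g'R: "g' s * (1 - s *\<^sub>R R) = R" if "s \<in> S" for s
  proof -
    have 1: "(\<lambda>n. f' n s) sums g' s" using f'sum[OF that] by (simp add: g'_def summable_sums)
    have "(\<lambda>n. f' (Suc n) s) sums (g' s * (s *\<^sub>R R))"
      using sums_mult2[OF 1, of "s *\<^sub>R R"] by (simp add: f'_def power_commutes mult.assoc)
    moreover have "(\<lambda>n. f' (Suc n) s) sums (g' s - f' 0 s)"
      using 1 sums_Suc_iff[of "\<lambda>n. f' n s" "g' s - f' 0 s"] by simp
    ultimately have "g' s * (s *\<^sub>R R) = g' s - R" using sums_unique2 by (fastforce simp: f'_def)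
    then show ?thesis by (simp add: algebra_simps)
  qed
  have "((\<lambda>s. exp (l s) * (1 - s *\<^sub>R R)) has_vector_derivative 0) (at s within S)" if "s \<in> S" for s
  proof -
    have 1: "((\<lambda>t. exp (l t)) has_vector_derivative exp (l s) * g' s) (at s within S)"
      by (rule has_vector_derivative_exp_commuting) (use that comm dl in auto)
    have 2: "((\<lambda>s. 1 - s *\<^sub>R R) has_vector_derivative - R) (at s within S)"
      by (auto intro!: derivative_eq_intros simp: has_vector_derivative_def)
    have "exp (l s) * (- R) + exp (l s) * g' s * (1 - s *\<^sub>R R) = 0"
      using g'R[OF that] by (simp add: mult.assoc)
    then show ?thesis using has_vector_derivative_mult[OF 1 2] by simp
  qed
  then obtain c where c: "\<And>s. s \<in> S \<Longrightarrow> exp (l s) * (1 - s *\<^sub>R R) = c"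
    by (rule has_vector_derivative_zero_constant[rotated]) (auto simp: S_def)
  have "l 0 = 0" using l[of 0] sums_unique2[of "\<lambda>n. f n 0" "l 0" 0] by (simp add: S_def f_def)
  then have "c = 1" using c[of 0] by (simp add: S_def)
  then have 1: "exp (l 1) * (1 - R) = 1" using c[of 1] by (simp add: S_def)
  have s1: "(\<lambda>n. R ^ Suc n /\<^sub>R real (Suc n)) sums l 1"
    using l[of 1] by (simp add: S_def f_def divide_inverse)
  then show "summable (\<lambda>n. R ^ Suc n /\<^sub>R real (Suc n))" by (rule sums_summable)
  have "exp (- l 1) = exp (- l 1) * (exp (l 1) * (1 - R))" by (simp only: 1 mult_1_right)
  also have "\<dots> = (exp (- l 1) * exp (l 1)) * (1 - R)" by (simp only: mult.assoc)
  also have "exp (- l 1) * exp (l 1) = 1" by (subst exp_add_commuting[symmetric]) simp_all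
  finally show "exp (- (\<Sum>n. R ^ Suc n /\<^sub>R real (Suc n))) = 1 - R"
    using sums_unique[OF s1] by simp
qed

text \<open>In the uniqueness of logarithms, \<open>X\<close> is a competing logarithm; commutation
  makes the exponential of the difference of the two factorise.\<close>

lemma log_series_commutes:
  fixes R X :: "'a::{real_normed_algebra_1,banach}"
  assumes "norm R < 1" "R * X = X * R"
  shows "(\<Sum>n. R ^ Suc n /\<^sub>R real (Suc n)) * X = X * (\<Sum>n. R ^ Suc n /\<^sub>R real (Suc n))"
proof -
  have 1: "R ^ Suc n /\<^sub>R real (Suc n) * X = X * (R ^ Suc n /\<^sub>R real (Suc n))" for n
    using power_commuting_commutes[OF assms(2), of "Suc n"] by (simp del: power_Suc of_nat_Suc)
  show ?thesis
    unfolding suminf_mult2[OF exp_log_series(1)[OF assms(1)]]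
      suminf_mult[OF exp_log_series(1)[OF assms(1)], symmetric] 1 ..
qed

section \<open>The operator norm on a finite region\<close>

lemma finite_conf: "finite X \<Longrightarrow> finite (conf D X)"
proof -
  assume X: "finite X"
  have "conf D X \<subseteq> (\<lambda>f v. if v \<in> X then f v else 0) ` (X \<rightarrow>\<^sub>E {..<D})"
  proof
    fix \<sigma> assume s: "\<sigma> \<in> conf D X"
    then have "\<sigma> = (\<lambda>v. if v \<in> X then restrict \<sigma> X v else 0)" by (auto simp: conf_def)
    moreover have "restrict \<sigma> X \<in> X \<rightarrow>\<^sub>E {..<D}" using s by (auto simp: conf_def)
    ultimately show "\<sigma> \<in> (\<lambda>f v. if v \<in> X then f v else 0) ` (X \<rightarrow>\<^sub>E {..<D})" by blast
  qed
  then show ?thesis using X by (meson finite_PiE finite_imageI finite_lessThan finite_subset)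
qed

lemma zero_in_conf: "D > 0 \<Longrightarrow> (\<lambda>_. 0) \<in> conf D X"
  by (auto simp: conf_def)

lemma vnorm_eq_L2_set: "vnorm D X v = L2_set (\<lambda>\<sigma>. cmod (v \<sigma>)) (conf D X)"
  by (simp add: vnorm_def L2_set_def)

lemma vnorm_nonneg [simp]: "vnorm D X v \<ge> 0"
  by (simp add: vnorm_def sum_nonneg)

lemma vnorm_cong: "(\<And>\<sigma>. \<sigma> \<in> conf D X \<Longrightarrow> v \<sigma> = w \<sigma>) \<Longrightarrow> vnorm D X v = vnorm D X w"
  by (simp add: vnorm_def)

lemma opapply_cong:
  "(\<And>\<sigma> \<tau>. \<sigma> \<in> conf D X \<Longrightarrow> \<tau> \<in> conf D X \<Longrightarrow> A \<sigma> \<tau> = B \<sigma> \<tau>) \<Longrightarrow> \<sigma> \<in> conf D X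
    \<Longrightarrow> opapply D X A v \<sigma> = opapply D X B v \<sigma>"
  by (simp add: opapply_def)

lemma opnorm_cong:
  assumes "\<And>\<sigma> \<tau>. \<sigma> \<in> conf D X \<Longrightarrow> \<tau> \<in> conf D X \<Longrightarrow> A \<sigma> \<tau> = B \<sigma> \<tau>"
  shows "opnorm D X A = opnorm D X B"
proof -
  have "vnorm D X (opapply D X A v) = vnorm D X (opapply D X B v)" for v
    by (rule vnorm_cong, rule opapply_cong) (use assms in auto)
  then show ?thesis by (simp add: opnorm_def)
qed

lemma vnorm_zero [simp]: "vnorm D X (\<lambda>_. 0) = 0"
  by (simp add: vnorm_def)

lemma vnorm_add_le: "vnorm D X (\<lambda>\<sigma>. v \<sigma> + w \<sigma>) \<le> vnorm D X v + vnorm D X w"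
proof -
  have "vnorm D X (\<lambda>\<sigma>. v \<sigma> + w \<sigma>) \<le> L2_set (\<lambda>\<sigma>. cmod (v \<sigma>) + cmod (w \<sigma>)) (conf D X)"
    unfolding vnorm_eq_L2_set by (intro L2_set_mono norm_triangle_ineq) auto
  also have "\<dots> \<le> vnorm D X v + vnorm D X w"
    unfolding vnorm_eq_L2_set by (rule L2_set_triangle_ineq)
  finally show ?thesis .
qed

lemma vnorm_scale: "vnorm D X (\<lambda>\<sigma>. c * v \<sigma>) = cmod c * vnorm D X v"
proof -
  have "(\<Sum>\<sigma>\<in>conf D X. (cmod (c * v \<sigma>))\<^sup>2) = (cmod c)\<^sup>2 * (\<Sum>\<sigma>\<in>conf D X. (cmod (v \<sigma>))\<^sup>2)"
    by (simp add: norm_mult power_mult_distrib sum_distrib_left)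
  then show ?thesis by (simp add: vnorm_def real_sqrt_mult)
qed

lemma cmod_le_vnorm: "finite X \<Longrightarrow> \<sigma> \<in> conf D X \<Longrightarrow> cmod (v \<sigma>) \<le> vnorm D X v"
  unfolding vnorm_eq_L2_set by (rule member_le_L2_set) (auto simp: finite_conf)

text \<open>A crude bound whose purpose is to show that the supremum in \<open>opnorm\<close> is
  taken over a bounded set.\<close>

lemma vnorm_opapply_le_sum:
  assumes "finite X"
  shows "vnorm D X (opapply D X A v) \<le> (\<Sum>\<sigma>\<in>conf D X. \<Sum>\<tau>\<in>conf D X. cmod (A \<sigma> \<tau>)) * vnorm D X v"
proof -
  have "vnorm D X (opapply D X A v) \<le> (\<Sum>\<sigma>\<in>conf D X. cmod (opapply D X A v \<sigma>))"
    unfolding vnorm_eq_L2_set by (rule L2_set_le_sum) auto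
  also have "\<dots> \<le> (\<Sum>\<sigma>\<in>conf D X. (\<Sum>\<tau>\<in>conf D X. cmod (A \<sigma> \<tau>)) * vnorm D X v)"
  proof (rule sum_mono)
    fix \<sigma> assume "\<sigma> \<in> conf D X"
    show "cmod (opapply D X A v \<sigma>) \<le> (\<Sum>\<tau>\<in>conf D X. cmod (A \<sigma> \<tau>)) * vnorm D X v"
      unfolding opapply_def sum_distrib_right
      by (intro sum_norm_le) (auto simp: norm_mult intro!: mult_left_mono cmod_le_vnorm assms)
  qed
  finally show ?thesis by (simp add: sum_distrib_right)
qed

lemma opapply_scale: "opapply D X A (\<lambda>\<sigma>. c * v \<sigma>) = (\<lambda>\<sigma>. c * opapply D X A v \<sigma>)"
  by (simp add: opapply_def sum_distrib_left mult_ac)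

lemma bdd_above_opnorm:
  assumes "finite X"
  shows "bdd_above {vnorm D X (opapply D X A v) | v. vnorm D X v \<le> 1}"
proof (rule bdd_aboveI, clarify)
  fix v assume "vnorm D X v \<le> 1"
  then have "(\<Sum>\<sigma>\<in>conf D X. \<Sum>\<tau>\<in>conf D X. cmod (A \<sigma> \<tau>)) * vnorm D X v
      \<le> (\<Sum>\<sigma>\<in>conf D X. \<Sum>\<tau>\<in>conf D X. cmod (A \<sigma> \<tau>)) * 1"
    by (intro mult_left_mono) (auto intro!: sum_nonneg)
  then show "vnorm D X (opapply D X A v) \<le> (\<Sum>\<sigma>\<in>conf D X. \<Sum>\<tau>\<in>conf D X. cmod (A \<sigma> \<tau>))"
    using vnorm_opapply_le_sum[OF assms, of D A v] by simp
qed

lemma opnorm_nonneg: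
  assumes "finite X"
  shows "opnorm D X A \<ge> 0"
proof -
  have "vnorm D X (opapply D X A (\<lambda>_. 0)) \<le> opnorm D X A"
    unfolding opnorm_def by (rule cSup_upper[OF _ bdd_above_opnorm[OF assms]]) (auto intro!: exI[of _ "\<lambda>_. 0"])
  then show ?thesis using vnorm_nonneg order_trans by blast
qed

lemma vnorm_opapply_le:
  assumes "finite X"
  shows "vnorm D X (opapply D X A v) \<le> opnorm D X A * vnorm D X v"
proof (cases "vnorm D X v = 0")
  case True
  then show ?thesis using vnorm_opapply_le_sum[OF assms, of D A v] by simp
next
  case False
  define n where "n = vnorm D X v"
  have n: "n > 0" using False vnorm_nonneg[of D X v] unfolding n_def by linarith
  define w where "w = (\<lambda>\<sigma>. complex_of_real (1 / n) * v \<sigma>)"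
  have "vnorm D X w = 1" using n unfolding w_def vnorm_scale by (simp add: n_def norm_divide)
  then have "vnorm D X (opapply D X A w) \<le> opnorm D X A"
    unfolding opnorm_def by (intro cSup_upper[OF _ bdd_above_opnorm[OF assms]]) (auto intro!: exI[of _ w])
  moreover have "vnorm D X (opapply D X A w) = vnorm D X (opapply D X A v) / n"
    using n unfolding w_def opapply_scale vnorm_scale by (simp add: norm_divide)
  ultimately show ?thesis using n by (simp add: n_def field_simps)
qed

lemma opnorm_leI:
  assumes "c \<ge> 0" "\<And>v. vnorm D X (opapply D X A v) \<le> c * vnorm D X v"
  shows "opnorm D X A \<le> c"
  unfolding opnorm_def
proof (rule cSup_least)
  show "{vnorm D X (opapply D X A v) |v. vnorm D X v \<le> 1} \<noteq> {}"
    by (auto intro!: exI[of _ "\<lambda>_. 0"])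
  fix x assume "x \<in> {vnorm D X (opapply D X A v) |v. vnorm D X v \<le> 1}"
  then obtain v where v: "x = vnorm D X (opapply D X A v)" "vnorm D X v \<le> 1" by auto
  then show "x \<le> c" using assms(2)[of v] mult_left_mono[OF v(2) assms(1)] by simp
qed

text \<open>Stated for arbitrary \<open>X\<close>, because the degenerate components of a bounded
  family are zero operators on possibly infinite regions.\<close>

lemma opnorm_zero [simp]: "opnorm D X (\<lambda>_ _. 0) = 0"
proof -
  have 1: "opapply D X (\<lambda>_ _. 0) v = (\<lambda>_. 0)" for v by (simp add: opapply_def)
  have "{vnorm D X (opapply D X (\<lambda>_ _. 0) v) |v. vnorm D X v \<le> 1} = {0}"
    by (auto simp: 1 intro!: exI[of _ "\<lambda>_. 0"])
  then show ?thesis by (simp add: opnorm_def)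
qed

lemma opnorm_add_le:
  assumes "finite X"
  shows "opnorm D X (\<lambda>\<sigma> \<tau>. A \<sigma> \<tau> + B \<sigma> \<tau>) \<le> opnorm D X A + opnorm D X B"
proof (rule opnorm_leI)
  fix v
  have "opapply D X (\<lambda>\<sigma> \<tau>. A \<sigma> \<tau> + B \<sigma> \<tau>) v = (\<lambda>\<sigma>. opapply D X A v \<sigma> + opapply D X B v \<sigma>)"
    by (simp add: opapply_def distrib_right sum.distrib)
  then have "vnorm D X (opapply D X (\<lambda>\<sigma> \<tau>. A \<sigma> \<tau> + B \<sigma> \<tau>) v)
      \<le> vnorm D X (opapply D X A v) + vnorm D X (opapply D X B v)"
    by (simp add: vnorm_add_le)
  then show "vnorm D X (opapply D X (\<lambda>\<sigma> \<tau>. A \<sigma> \<tau> + B \<sigma> \<tau>) v)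
      \<le> (opnorm D X A + opnorm D X B) * vnorm D X v"
    using vnorm_opapply_le[OF assms, of D A v] vnorm_opapply_le[OF assms, of D B v]
    by (simp add: distrib_right)
qed (simp add: opnorm_nonneg assms)

lemma opnorm_scale_le:
  assumes "finite X"
  shows "opnorm D X (\<lambda>\<sigma> \<tau>. c * A \<sigma> \<tau>) \<le> cmod c * opnorm D X A"
proof (rule opnorm_leI)
  fix v
  have "opapply D X (\<lambda>\<sigma> \<tau>. c * A \<sigma> \<tau>) v = (\<lambda>\<sigma>. c * opapply D X A v \<sigma>)"
    by (simp add: opapply_def sum_distrib_left mult_ac)
  then show "vnorm D X (opapply D X (\<lambda>\<sigma> \<tau>. c * A \<sigma> \<tau>) v) \<le> cmod c * opnorm D X A * vnorm D X v"
    using mult_left_mono[OF vnorm_opapply_le[OF assms, of D A v], of "cmod c"]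
    by (simp add: vnorm_scale mult.assoc)
qed (simp add: opnorm_nonneg assms)

lemma opnorm_scale:
  assumes "finite X"
  shows "opnorm D X (\<lambda>\<sigma> \<tau>. c * A \<sigma> \<tau>) = cmod c * opnorm D X A"
proof (cases "c = 0")
  case False
  have "opnorm D X (\<lambda>\<sigma> \<tau>. (1 / c) * (c * A \<sigma> \<tau>)) \<le> cmod (1 / c) * opnorm D X (\<lambda>\<sigma> \<tau>. c * A \<sigma> \<tau>)"
    by (rule opnorm_scale_le[OF assms])
  then have "cmod c * opnorm D X A \<le> opnorm D X (\<lambda>\<sigma> \<tau>. c * A \<sigma> \<tau>)"
    using False by (simp add: norm_divide field_simps)
  then show ?thesis using opnorm_scale_le[OF assms, of D c A] by simp
qed simp

lemma opapply_opmult: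
  "\<sigma> \<in> conf D X \<Longrightarrow> opapply D X (opmult D X A B) v \<sigma> = opapply D X A (opapply D X B v) \<sigma>"
  unfolding opapply_def opmult_def
  by (simp add: sum_distrib_right sum_distrib_left mult.assoc) (rule sum.swap)

lemma opnorm_mult_le:
  assumes "finite X"
  shows "opnorm D X (opmult D X A B) \<le> opnorm D X A * opnorm D X B"
proof (rule opnorm_leI)
  fix v
  have "vnorm D X (opapply D X (opmult D X A B) v) = vnorm D X (opapply D X A (opapply D X B v))"
    by (rule vnorm_cong) (simp add: opapply_opmult)
  also have "\<dots> \<le> opnorm D X A * vnorm D X (opapply D X B v)"
    by (rule vnorm_opapply_le[OF assms])
  also have "\<dots> \<le> opnorm D X A * (opnorm D X B * vnorm D X v)"
    by (intro mult_left_mono vnorm_opapply_le opnorm_nonneg assms)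
  finally show "vnorm D X (opapply D X (opmult D X A B) v) \<le> opnorm D X A * opnorm D X B * vnorm D X v"
    by (simp add: mult.assoc)
qed (simp add: opnorm_nonneg assms)

lemma opapply_idop:
  assumes "finite X" "\<sigma> \<in> conf D X"
  shows "opapply D X (idop D X) v \<sigma> = v \<sigma>"
proof -
  have "opapply D X (idop D X) v \<sigma> = (\<Sum>\<tau>\<in>conf D X. if \<sigma> = \<tau> then v \<tau> else 0)"
    unfolding opapply_def idop_def using assms(2) by (intro sum.cong) auto
  then show ?thesis using assms by (simp add: finite_conf)
qed

text \<open>Apply the operator to the basis vector at \<open>\<tau>\<close>. Entries thus depend
  continuously on the operator, which gives definiteness of the norm and entrywise limits of Cauchy
  sequences.\<close>

lemma cmod_entry_le_opnorm:
  assumes "finite X" "\<sigma> \<in> conf D X" "\<tau> \<in> conf D X"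
  shows "cmod (A \<sigma> \<tau>) \<le> opnorm D X A"
proof -
  define v where "v = (\<lambda>\<rho>. if \<rho> = \<tau> then 1 else (0::complex))"
  have "(\<Sum>\<rho>\<in>conf D X. (cmod (v \<rho>))\<^sup>2) = (\<Sum>\<rho>\<in>conf D X. if \<rho> = \<tau> then 1 else 0)"
    by (intro sum.cong) (auto simp: v_def)
  then have 1: "vnorm D X v = 1" using assms by (simp add: vnorm_def finite_conf)
  have "opapply D X A v \<sigma> = (\<Sum>\<rho>\<in>conf D X. if \<rho> = \<tau> then A \<sigma> \<tau> else 0)"
    unfolding opapply_def by (intro sum.cong) (auto simp: v_def)
  then have "opapply D X A v \<sigma> = A \<sigma> \<tau>" using assms by (simp add: finite_conf)
  then show ?thesis
    using cmod_le_vnorm[OF assms(1,2), of "opapply D X A v"] vnorm_opapply_le[OF assms(1), of D A v]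
    by (simp add: 1)
qed

lemma opnorm_idop:
  assumes "finite X" "D > 0"
  shows "opnorm D X (idop D X) = 1"
proof (rule antisym)
  have "vnorm D X (opapply D X (idop D X) v) = vnorm D X v" for v
    by (rule vnorm_cong) (simp add: opapply_idop assms)
  then show "opnorm D X (idop D X) \<le> 1" by (intro opnorm_leI) auto
  show "1 \<le> opnorm D X (idop D X)"
    using cmod_entry_le_opnorm[OF assms(1) zero_in_conf[OF assms(2)] zero_in_conf[OF assms(2)], of "idop D X"]
      zero_in_conf[OF assms(2), of X] by (simp add: idop_def)
qed

text \<open>On a finite region the image of a fixed vector depends continuously on the entries, so a
  norm bound survives entrywise limits. This supplies both the boundedness of the limit and the
  convergence in the completeness proof.\<close>

lemma opnorm_le_if_entries_tendsto:
  assumes "finite X" "c \<ge> 0"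
    and lim: "\<And>\<sigma> \<tau>. \<sigma> \<in> conf D X \<Longrightarrow> \<tau> \<in> conf D X \<Longrightarrow> (\<lambda>n. A n \<sigma> \<tau>) \<longlonglongrightarrow> B \<sigma> \<tau>"
    and le: "\<forall>\<^sub>F n in sequentially. opnorm D X (A n) \<le> c"
  shows "opnorm D X B \<le> c"
proof (rule opnorm_leI[OF assms(2)])
  fix v
  have "(\<lambda>n. vnorm D X (opapply D X (A n) v)) \<longlonglongrightarrow> vnorm D X (opapply D X B v)"
    unfolding vnorm_def opapply_def by (intro tendsto_intros lim) auto
  moreover have "\<forall>\<^sub>F n in sequentially. vnorm D X (opapply D X (A n) v) \<le> c * vnorm D X v"
    using le by eventually_elim
      (meson assms(1) mult_right_mono order_trans vnorm_nonneg vnorm_opapply_le)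
  ultimately show "vnorm D X (opapply D X B v) \<le> c * vnorm D X v"
    by (rule tendsto_upperbound) simp
qed

section \<open>A Banach algebra containing all local operator algebras\<close>

text \<open>The bounded families indexed by all local dimensions and all finite regions form one Banach
  algebra type, so that the exponential function of the library applies to every region at once.\<close>

definition bounded_family :: "(nat \<Rightarrow> 'g::finite site set \<Rightarrow> 'g op) \<Rightarrow> bool" where
  "bounded_family F \<longleftrightarrow> (\<forall>D X. canon D X (F D X)) \<and>
     (\<forall>D X. \<not> (D > 0 \<and> finite X) \<longrightarrow> F D X = (\<lambda>_ _. 0)) \<and> (\<exists>c. \<forall>D X. opnorm D X (F D X) \<le> c)"

lemma bounded_familyI:
  assumes "\<And>D X. canon D X (F D X)" "\<And>D X. \<not> (D > 0 \<and> finite X) \<Longrightarrow> F D X = (\<lambda>_ _. 0)"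
    "\<And>D X. opnorm D X (F D X) \<le> c"
  shows "bounded_family F"
  unfolding bounded_family_def using assms by (intro conjI allI impI exI)

lemma bounded_familyD:
  assumes "bounded_family F"
  shows "canon D X (F D X)" "\<not> (D > 0 \<and> finite X) \<Longrightarrow> F D X = (\<lambda>_ _. 0)"
  using assms unfolding bounded_family_def by blast+

lemma bounded_family_bound:
  "bounded_family F \<Longrightarrow> \<exists>c. \<forall>D X. opnorm D X (F D X) \<le> c"
  unfolding bounded_family_def by (elim conjE)

lemma canon_zero: "canon D X (\<lambda>_ _. 0)"
  by (simp add: canon_def)

lemma canon_idop [simp]: "canon D X (idop D X)"
  by (auto simp: canon_def idop_def)

lemma bounded_family_zero: "bounded_family (\<lambda>_ _ _ _. 0)"
  by (rule bounded_familyI[of _ 0]) (auto simp: canon_def)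

text \<open>Zero components for \<open>D = 0\<close> or infinite \<open>X\<close> exclude every case
  in which \<open>opnorm\<close> is not definite or the identity lacks norm 1. Canonical entries
  make equality of families the same as equality of operators.\<close>

typedef 'g qalg = "{F :: nat \<Rightarrow> 'g::finite site set \<Rightarrow> 'g op. bounded_family F}"
  morphisms component Abs_qalg
  by (rule exI[of _ "\<lambda>_ _ _ _. 0"]) (simp add: bounded_family_zero)

setup_lifting type_definition_qalg

lemma bounded_family_component: "bounded_family (component F)"
  using component[of F] by simp

lemma component_canon: "canon D X (component F D X)"
  by (rule bounded_familyD[OF bounded_family_component])

lemma component_outside: "\<not> (\<sigma> \<in> conf D X \<and> \<tau> \<in> conf D X) \<Longrightarrow> component F D X \<sigma> \<tau> = 0"
  using component_canon[of D X F] unfolding canon_def by blast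

lemma component_degenerate: "\<not> (D > 0 \<and> finite X) \<Longrightarrow> component F D X = (\<lambda>_ _. 0)"
  by (rule bounded_familyD[OF bounded_family_component])

lemma qalg_eqI:
  assumes "\<And>D X \<sigma> \<tau>. D > 0 \<Longrightarrow> finite X \<Longrightarrow> \<sigma> \<in> conf D X \<Longrightarrow> \<tau> \<in> conf D X
    \<Longrightarrow> component F D X \<sigma> \<tau> = component G D X \<sigma> \<tau>"
  shows "F = G"
proof -
  have "component F D X \<sigma> \<tau> = component G D X \<sigma> \<tau>" for D X \<sigma> \<tau>
    by (metis assms component_degenerate component_outside)
  then have "component F = component G" by (intro ext)
  then show ?thesis by (simp add: component_inject)
qed

lemma opnorm_bound_add:
  assumes "\<And>D X. \<not> (D > 0 \<and> finite X) \<Longrightarrow> F D X = (\<lambda>_ _. 0)" "\<And>D X. opnorm D X (F D X) \<le> a"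
    "\<And>D X. \<not> (D > 0 \<and> finite X) \<Longrightarrow> G D X = (\<lambda>_ _. 0)" "\<And>D X. opnorm D X (G D X) \<le> b"
  shows "opnorm D X (\<lambda>\<sigma> \<tau>. F D X \<sigma> \<tau> + G D X \<sigma> \<tau>) \<le> a + b"
proof (cases "D > 0 \<and> finite X")
  case True
  then show ?thesis using opnorm_add_le[of X D "F D X" "G D X"] assms(2,4)[of D X] by linarith
next
  case False
  then have "opnorm D X (\<lambda>\<sigma> \<tau>. F D X \<sigma> \<tau> + G D X \<sigma> \<tau>) = opnorm D X (\<lambda>_ _. 0)"
    using assms by simp
  moreover have "opnorm D X (F D X) = 0" "opnorm D X (G D X) = 0" using False assms by simp_all
  ultimately show ?thesis using assms(2)[of D X] assms(4)[of D X] by simp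
qed

lemma opnorm_bound_scale:
  assumes "\<And>D X. \<not> (D > 0 \<and> finite X) \<Longrightarrow> F D X = (\<lambda>_ _. 0)" "\<And>D X. opnorm D X (F D X) \<le> a"
  shows "opnorm D X (\<lambda>\<sigma> \<tau>. c * F D X \<sigma> \<tau>) \<le> cmod c * a"
proof (cases "D > 0 \<and> finite X")
  case True
  then show ?thesis using opnorm_scale[of X D c "F D X"] assms(2)[of D X] by (simp add: mult_left_mono)
next
  case False
  moreover have "opnorm D X (F D X) = 0" using False assms by simp
  ultimately show ?thesis using assms(1,2)[of D X] by simp
qed

instantiation qalg :: (finite) real_vector
begin

lift_definition zero_qalg :: "'a qalg" is "\<lambda>_ _ _ _. 0"
  by (rule bounded_family_zero)

lift_definition plus_qalg :: "'a qalg \<Rightarrow> 'a qalg \<Rightarrow> 'a qalg" is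
  "\<lambda>F G D X \<sigma> \<tau>. F D X \<sigma> \<tau> + G D X \<sigma> \<tau>"
proof -
  fix F G :: "nat \<Rightarrow> 'a site set \<Rightarrow> 'a op"
  assume F: "bounded_family F" and G: "bounded_family G"
  obtain a where a: "\<forall>D X. opnorm D X (F D X) \<le> a"
    using bounded_family_bound[OF F] ..
  obtain b where b: "\<forall>D X. opnorm D X (G D X) \<le> b"
    using bounded_family_bound[OF G] ..
  show "bounded_family (\<lambda>D X \<sigma> \<tau>. F D X \<sigma> \<tau> + G D X \<sigma> \<tau>)"
  proof (rule bounded_familyI)
    show "opnorm D X (\<lambda>\<sigma> \<tau>. F D X \<sigma> \<tau> + G D X \<sigma> \<tau>) \<le> a + b" for D X
      by (rule opnorm_bound_add[OF bounded_familyD(2)[OF F] a[rule_format] bounded_familyD(2)[OF G] b[rule_format]])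
    show "canon D X (\<lambda>\<sigma> \<tau>. F D X \<sigma> \<tau> + G D X \<sigma> \<tau>)" for D X
      using bounded_familyD(1)[OF F, of D X] bounded_familyD(1)[OF G, of D X] by (simp add: canon_def)
  qed (simp add: bounded_familyD(2)[OF F] bounded_familyD(2)[OF G])
qed

lift_definition scaleR_qalg :: "real \<Rightarrow> 'a qalg \<Rightarrow> 'a qalg" is
  "\<lambda>r F D X \<sigma> \<tau>. complex_of_real r * F D X \<sigma> \<tau>"
proof -
  fix r :: real and F :: "nat \<Rightarrow> 'a site set \<Rightarrow> 'a op"
  assume F: "bounded_family F"
  obtain a where a: "\<forall>D X. opnorm D X (F D X) \<le> a"
    using bounded_family_bound[OF F] ..
  show "bounded_family (\<lambda>D X \<sigma> \<tau>. complex_of_real r * F D X \<sigma> \<tau>)"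
  proof (rule bounded_familyI)
    show "opnorm D X (\<lambda>\<sigma> \<tau>. complex_of_real r * F D X \<sigma> \<tau>) \<le> cmod (complex_of_real r) * a" for D X
      by (rule opnorm_bound_scale[OF bounded_familyD(2)[OF F] a[rule_format]])
    show "canon D X (\<lambda>\<sigma> \<tau>. complex_of_real r * F D X \<sigma> \<tau>)" for D X
      using bounded_familyD(1)[OF F, of D X] by (simp add: canon_def)
  qed (simp add: bounded_familyD(2)[OF F])
qed

definition uminus_qalg :: "'a qalg \<Rightarrow> 'a qalg" where
  "uminus_qalg F = (- 1) *\<^sub>R F"

definition minus_qalg :: "'a qalg \<Rightarrow> 'a qalg \<Rightarrow> 'a qalg" where
  "minus_qalg F G = F + (- G)"

lemma component_uminus: "component (- F) D X \<sigma> \<tau> = - component F D X \<sigma> \<tau>"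
  unfolding uminus_qalg_def scaleR_qalg.rep_eq by simp

instance
proof
  fix F G H :: "'a qalg" and r t :: real
  show "F + G + H = F + (G + H)" by (rule qalg_eqI) (simp add: plus_qalg.rep_eq)
  show "F + G = G + F" by (rule qalg_eqI) (simp add: plus_qalg.rep_eq)
  show "0 + F = F" by (rule qalg_eqI) (simp add: plus_qalg.rep_eq zero_qalg.rep_eq)
  show "- F + F = 0" by (rule qalg_eqI) (simp add: plus_qalg.rep_eq zero_qalg.rep_eq component_uminus)
  show "F - G = F + - G" by (rule minus_qalg_def)
  show "r *\<^sub>R (F + G) = r *\<^sub>R F + r *\<^sub>R G"
    by (rule qalg_eqI) (simp add: plus_qalg.rep_eq scaleR_qalg.rep_eq distrib_left)
  show "(r + t) *\<^sub>R F = r *\<^sub>R F + t *\<^sub>R F"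
    by (rule qalg_eqI) (simp add: plus_qalg.rep_eq scaleR_qalg.rep_eq distrib_right)
  show "r *\<^sub>R t *\<^sub>R F = (r * t) *\<^sub>R F" by (rule qalg_eqI) (simp add: scaleR_qalg.rep_eq)
  show "1 *\<^sub>R F = F" by (rule qalg_eqI) (simp add: scaleR_qalg.rep_eq)
qed

end

lemma component_minus: "component (F - G) D X \<sigma> \<tau> = component F D X \<sigma> \<tau> - component G D X \<sigma> \<tau>"
  unfolding minus_qalg_def plus_qalg.rep_eq component_uminus by simp

lemma bdd_above_component: "bdd_above (range (\<lambda>(D, X). opnorm D X (component F D X)))"
proof -
  obtain a where a: "\<forall>D X. opnorm D X (component F D X) \<le> a"
    using bounded_family_bound[OF bounded_family_component] ..
  then show ?thesis by (intro bdd_aboveI[of _ a]) auto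
qed

instantiation qalg :: (finite) real_normed_vector
begin

definition norm_qalg :: "'a qalg \<Rightarrow> real" where
  "norm_qalg F = (SUP (D, X)\<in>UNIV. opnorm D X (component F D X))"

definition sgn_qalg :: "'a qalg \<Rightarrow> 'a qalg" where
  "sgn_qalg F = F /\<^sub>R norm F"

definition dist_qalg :: "'a qalg \<Rightarrow> 'a qalg \<Rightarrow> real" where
  "dist_qalg F G = norm (F - G)"

definition uniformity_qalg :: "('a qalg \<times> 'a qalg) filter" where
  "uniformity_qalg = (INF e\<in>{0<..}. principal {(x, y). dist x y < e})"

definition open_qalg :: "'a qalg set \<Rightarrow> bool" where
  "open_qalg U = (\<forall>x\<in>U. eventually (\<lambda>(x', y). x' = x \<longrightarrow> y \<in> U) uniformity)"

lemma opnorm_component_le_norm: "opnorm D X (component F D X) \<le> norm F"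
  unfolding norm_qalg_def using cSUP_upper[OF _ bdd_above_component[of F], of "(D, X)"] by simp

lemma norm_qalg_leI:
  assumes "c \<ge> 0" "\<And>D X. D > 0 \<Longrightarrow> finite X \<Longrightarrow> opnorm D X (component F D X) \<le> c"
  shows "norm F \<le> c"
  unfolding norm_qalg_def
proof (rule cSUP_least)
  fix p :: "nat \<times> 'a site set"
  obtain D X where p: "p = (D, X)" by (cases p)
  show "(case p of (D, X) \<Rightarrow> opnorm D X (component F D X)) \<le> c"
    using assms component_degenerate[of D X F] by (cases "D > 0 \<and> finite X") (auto simp: p)
qed simp

lemma norm_qalg_nonneg: "norm (F :: 'a qalg) \<ge> 0"
  using opnorm_component_le_norm[of 1 "{}" F] opnorm_nonneg[of "{}" 1 "component F 1 {}"] by simp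

instance
proof
  fix F G :: "'a qalg" and r :: real
  show "norm F = 0 \<longleftrightarrow> F = 0"
  proof
    assume n: "norm F = 0"
    show "F = 0"
    proof (rule qalg_eqI)
      fix D :: nat and X :: "'a site set" and \<sigma> \<tau>
      assume a: "D > 0" "finite X" "\<sigma> \<in> conf D X" "\<tau> \<in> conf D X"
      have "cmod (component F D X \<sigma> \<tau>) \<le> 0"
        using cmod_entry_le_opnorm[OF a(2-4), of "component F D X"] opnorm_component_le_norm[of D X F] n by linarith
      then show "component F D X \<sigma> \<tau> = component 0 D X \<sigma> \<tau>" by (simp add: zero_qalg.rep_eq)
    qed
  next
    assume "F = 0"
    then show "norm F = 0"
      by (intro antisym norm_qalg_nonneg norm_qalg_leI) (auto simp: zero_qalg.rep_eq)
  qed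
  show "norm (F + G) \<le> norm F + norm G"
  proof (rule norm_qalg_leI)
    fix D :: nat and X :: "'a site set" assume "finite X"
    then have "opnorm D X (component (F + G) D X) \<le> opnorm D X (component F D X) + opnorm D X (component G D X)"
      using opnorm_add_le[of X D "component F D X" "component G D X"] by (simp add: plus_qalg.rep_eq)
    then show "opnorm D X (component (F + G) D X) \<le> norm F + norm G"
      using opnorm_component_le_norm[of D X F] opnorm_component_le_norm[of D X G] by linarith
  qed (simp add: norm_qalg_nonneg)
  have le: "norm (s *\<^sub>R H) \<le> \<bar>s\<bar> * norm H" for s and H :: "'a qalg"
  proof (rule norm_qalg_leI)
    fix D :: nat and X :: "'a site set" assume "finite X"
    then have "opnorm D X (component (s *\<^sub>R H) D X) = \<bar>s\<bar> * opnorm D X (component H D X)"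
      using opnorm_scale[of X D "complex_of_real s" "component H D X"] by (simp add: scaleR_qalg.rep_eq)
    then show "opnorm D X (component (s *\<^sub>R H) D X) \<le> \<bar>s\<bar> * norm H"
      using opnorm_component_le_norm[of D X H] by (simp add: mult_left_mono)
  qed (simp add: norm_qalg_nonneg)
  show "norm (r *\<^sub>R F) = \<bar>r\<bar> * norm F"
  proof (cases "r = 0")
    case True
    then show ?thesis
      by (intro antisym le) (simp add: norm_qalg_nonneg)
  next
    case False
    then have "norm F \<le> \<bar>inverse r\<bar> * norm (r *\<^sub>R F)" using le[of "inverse r" "r *\<^sub>R F"] by simp
    then show ?thesis using False le[of r F] by (simp add: field_simps)
  qed
qed (simp_all add: sgn_qalg_def dist_qalg_def uniformity_qalg_def open_qalg_def)

end

text \<open>The entries of a Cauchy sequence converge. Their limits form a bounded family because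
  norms along the sequence are bounded, and letting one index of the Cauchy estimate tend to
  infinity gives convergence in norm.\<close>

instance qalg :: (finite) banach
proof
  fix F :: "nat \<Rightarrow> 'a qalg" assume C: "Cauchy F"
  define e where "e n D X \<sigma> \<tau> = component (F n) D X \<sigma> \<tau>" for n D X \<sigma> \<tau>
  have ediff: "opnorm D X (\<lambda>\<sigma> \<tau>. e m D X \<sigma> \<tau> - e n D X \<sigma> \<tau>) \<le> norm (F m - F n)" for m n D X
  proof -
    have "component (F m - F n) D X = (\<lambda>\<sigma> \<tau>. e m D X \<sigma> \<tau> - e n D X \<sigma> \<tau>)"
      by (intro ext) (simp add: component_minus e_def)
    then show ?thesis using opnorm_component_le_norm[of D X "F m - F n"] by simp
  qed
  have conv: "(\<lambda>n. e n D X \<sigma> \<tau>) \<longlonglongrightarrow> lim (\<lambda>n. e n D X \<sigma> \<tau>)" for D X \<sigma> \<tau>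
  proof (cases "D > 0 \<and> finite X \<and> \<sigma> \<in> conf D X \<and> \<tau> \<in> conf D X")
    case True
    have "cmod (e m D X \<sigma> \<tau> - e n D X \<sigma> \<tau>) \<le> norm (F m - F n)" for m n
      using cmod_entry_le_opnorm[of X \<sigma> D \<tau> "\<lambda>\<sigma> \<tau>. e m D X \<sigma> \<tau> - e n D X \<sigma> \<tau>"] True ediff[of D X m n]
      by linarith
    then have "Cauchy (\<lambda>n. e n D X \<sigma> \<tau>)"
      using C unfolding Cauchy_def dist_norm by (meson le_less_trans)
    then show ?thesis by (simp add: Cauchy_convergent_iff convergent_LIMSEQ_iff)
  next
    case False
    then have "e n D X \<sigma> \<tau> = 0" for n
      using component_degenerate[of D X "F n"] component_outside[of \<sigma> D X \<tau> "F n"] unfolding e_def by metis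
    then show ?thesis by simp
  qed
  define L where "L D X \<sigma> \<tau> = lim (\<lambda>n. e n D X \<sigma> \<tau>)" for D X \<sigma> \<tau>
  have L: "(\<lambda>n. e n D X \<sigma> \<tau>) \<longlonglongrightarrow> L D X \<sigma> \<tau>" for D X \<sigma> \<tau> using conv by (simp add: L_def)
  have L0: "L D X \<sigma> \<tau> = 0" if "\<And>n. e n D X \<sigma> \<tau> = 0" for D X \<sigma> \<tau>
    using L[of D X \<sigma> \<tau>] that LIMSEQ_unique[OF _ tendsto_const] by (simp add: LIMSEQ_const_iff)
  have Ldeg: "L D X = (\<lambda>_ _. 0)" if "\<not> (D > 0 \<and> finite X)" for D X
    using that by (intro ext L0) (simp add: e_def component_degenerate)
  obtain K where K: "\<And>n. norm (F n) \<le> K"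
    using Cauchy_Bseq[OF C] by (meson BseqE)
  have "K \<ge> 0" using K[of 0] norm_ge_zero order_trans by blast
  have Lin: "bounded_family L"
  proof (rule bounded_familyI)
    show "canon D X (L D X)" for D X
      unfolding canon_def
    proof (intro allI impI)
      fix \<sigma> \<tau> assume "\<sigma> \<notin> conf D X \<or> \<tau> \<notin> conf D X"
      then show "L D X \<sigma> \<tau> = 0" by (intro L0) (simp add: e_def component_outside)
    qed
    show "opnorm D X (L D X) \<le> K" for D X
    proof (cases "D > 0 \<and> finite X")
      case True
      show ?thesis
      proof (rule opnorm_le_if_entries_tendsto[OF _ \<open>K \<ge> 0\<close> L])
        show "\<forall>\<^sub>F n in sequentially. opnorm D X (e n D X) \<le> K"
        proof (intro always_eventually allI)
          fix n
          have "e n D X = component (F n) D X" by (intro ext) (simp add: e_def)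
          then show "opnorm D X (e n D X) \<le> K"
            using opnorm_component_le_norm[of D X "F n"] K[of n] by simp
        qed
      qed (use True in auto)
    qed (use Ldeg \<open>K \<ge> 0\<close> in simp)
  qed (use Ldeg in auto)
  have compL: "component (Abs_qalg L) = L" by (rule Abs_qalg_inverse) (simp add: Lin)
  have "F \<longlonglongrightarrow> Abs_qalg L"
  proof (rule LIMSEQ_I)
    fix r :: real assume r: "r > 0"
    then obtain N where N: "\<And>m n. m \<ge> N \<Longrightarrow> n \<ge> N \<Longrightarrow> norm (F m - F n) < r / 2"
      using C[unfolded Cauchy_iff, rule_format, of "r / 2"] by auto
    have "norm (F n - Abs_qalg L) \<le> r / 2" if n: "n \<ge> N" for n
    proof (rule norm_qalg_leI)
      fix D :: nat and X :: "'a site set" assume X: "D > 0" "finite X"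
      have "component (F n - Abs_qalg L) D X = (\<lambda>\<sigma> \<tau>. e n D X \<sigma> \<tau> - L D X \<sigma> \<tau>)"
        by (intro ext) (simp add: component_minus compL e_def)
      moreover have "opnorm D X (\<lambda>\<sigma> \<tau>. e n D X \<sigma> \<tau> - L D X \<sigma> \<tau>) \<le> r / 2"
      proof (rule opnorm_le_if_entries_tendsto)
        show "(\<lambda>m. e n D X \<sigma> \<tau> - e m D X \<sigma> \<tau>) \<longlonglongrightarrow> e n D X \<sigma> \<tau> - L D X \<sigma> \<tau>" for \<sigma> \<tau>
          by (intro tendsto_intros L)
        show "\<forall>\<^sub>F m in sequentially. opnorm D X (\<lambda>\<sigma> \<tau>. e n D X \<sigma> \<tau> - e m D X \<sigma> \<tau>) \<le> r / 2"
          using eventually_ge_at_top[of N]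
        proof eventually_elim
          case (elim m)
          then show ?case using ediff[of D X n m] N[OF n elim] by linarith
        qed
      qed (use X r in auto)
      ultimately show "opnorm D X (component (F n - Abs_qalg L) D X) \<le> r / 2" by simp
    qed (use r in simp)
    then show "\<exists>N. \<forall>n\<ge>N. norm (F n - Abs_qalg L) < r"
      using r by (intro exI[of _ N]) fastforce
  qed
  then show "convergent F" by (rule convergentI)
qed

lemma opmult_assoc: "opmult D X (opmult D X A B) C = opmult D X A (opmult D X B C)"
proof (intro ext)
  fix \<sigma> \<tau>
  have "(\<Sum>\<rho>\<in>conf D X. (\<Sum>\<omega>\<in>conf D X. A \<sigma> \<omega> * B \<omega> \<rho>) * C \<rho> \<tau>)
      = (\<Sum>\<omega>\<in>conf D X. \<Sum>\<rho>\<in>conf D X. A \<sigma> \<omega> * B \<omega> \<rho> * C \<rho> \<tau>)"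
    unfolding sum_distrib_right by (rule sum.swap)
  also have "\<dots> = (\<Sum>\<omega>\<in>conf D X. A \<sigma> \<omega> * (\<Sum>\<rho>\<in>conf D X. B \<omega> \<rho> * C \<rho> \<tau>))"
    by (simp add: sum_distrib_left mult.assoc)
  finally show "opmult D X (opmult D X A B) C \<sigma> \<tau> = opmult D X A (opmult D X B C) \<sigma> \<tau>"
    by (simp add: opmult_def)
qed

lemma opmult_idop_left:
  assumes "finite X" "canon D X A"
  shows "opmult D X (idop D X) A = A"
proof (intro ext)
  fix \<sigma> \<tau>
  show "opmult D X (idop D X) A \<sigma> \<tau> = A \<sigma> \<tau>"
  proof (cases "\<sigma> \<in> conf D X \<and> \<tau> \<in> conf D X")
    case True
    then have "opmult D X (idop D X) A \<sigma> \<tau> = (\<Sum>\<rho>\<in>conf D X. if \<sigma> = \<rho> then A \<rho> \<tau> else 0)"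
      unfolding opmult_def idop_def by (auto intro!: sum.cong)
    then show ?thesis using True assms by (simp add: finite_conf)
  qed (use assms in \<open>auto simp: canon_def opmult_def\<close>)
qed

lemma opmult_idop_right:
  assumes "finite X" "canon D X A"
  shows "opmult D X A (idop D X) = A"
proof (intro ext)
  fix \<sigma> \<tau>
  show "opmult D X A (idop D X) \<sigma> \<tau> = A \<sigma> \<tau>"
  proof (cases "\<sigma> \<in> conf D X \<and> \<tau> \<in> conf D X")
    case True
    then have "opmult D X A (idop D X) \<sigma> \<tau> = (\<Sum>\<rho>\<in>conf D X. if \<rho> = \<tau> then A \<sigma> \<rho> else 0)"
      unfolding opmult_def idop_def by (auto intro!: sum.cong)
    then show ?thesis using True assms by (simp add: finite_conf)
  qed (use assms in \<open>auto simp: canon_def opmult_def\<close>)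
qed

lemma canon_opmult [simp]: "canon D X (opmult D X A B)"
  by (auto simp: canon_def opmult_def)

instantiation qalg :: (finite) real_normed_algebra_1
begin

lift_definition one_qalg :: "'a qalg" is
  "\<lambda>D X. if D > 0 \<and> finite X then idop D X else (\<lambda>_ _. 0)"
  by (rule bounded_familyI[of _ 1]) (auto simp: opnorm_idop canon_zero)

lift_definition times_qalg :: "'a qalg \<Rightarrow> 'a qalg \<Rightarrow> 'a qalg" is
  "\<lambda>F G D X. opmult D X (F D X) (G D X)"
proof -
  fix F G :: "nat \<Rightarrow> 'a site set \<Rightarrow> 'a op"
  assume F: "bounded_family F" and G: "bounded_family G"
  obtain a where a: "\<forall>D X. opnorm D X (F D X) \<le> a"
    using bounded_family_bound[OF F] ..
  obtain b where b: "\<forall>D X. opnorm D X (G D X) \<le> b"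
    using bounded_family_bound[OF G] ..
  have ab: "a \<ge> 0" "b \<ge> 0"
    using a[rule_format, of 1 "{}"] b[rule_format, of 1 "{}"] opnorm_nonneg[of "{}" 1 "F 1 {}"] opnorm_nonneg[of "{}" 1 "G 1 {}"]
    by force+
  have 0: "opmult D X (F D X) (G D X) = (\<lambda>_ _. 0)" if "\<not> (D > 0 \<and> finite X)" for D X
    using bounded_familyD(2)[OF F that] by (simp add: opmult_def fun_eq_iff)
  show "bounded_family (\<lambda>D X. opmult D X (F D X) (G D X))"
  proof (rule bounded_familyI)
    show "opnorm D X (opmult D X (F D X) (G D X)) \<le> a * b" for D X
    proof (cases "D > 0 \<and> finite X")
      case True
      then have "opnorm D X (opmult D X (F D X) (G D X)) \<le> opnorm D X (F D X) * opnorm D X (G D X)"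
        by (simp add: opnorm_mult_le)
      also have "\<dots> \<le> a * b" using True a b ab by (intro mult_mono opnorm_nonneg) auto
      finally show ?thesis .
    qed (use 0 ab in simp)
  qed (use 0 in simp_all)
qed

instance
proof
  fix F G H :: "'a qalg" and r :: real
  show "F * G * H = F * (G * H)"
    by (rule qalg_eqI) (simp add: times_qalg.rep_eq opmult_assoc)
  show "(F + G) * H = F * H + G * H"
    by (rule qalg_eqI) (simp add: times_qalg.rep_eq plus_qalg.rep_eq opmult_def distrib_right sum.distrib)
  show "F * (G + H) = F * G + F * H"
    by (rule qalg_eqI) (simp add: times_qalg.rep_eq plus_qalg.rep_eq opmult_def distrib_left sum.distrib)
  show "1 * F = F" "F * 1 = F"
    by (rule qalg_eqI, simp add: times_qalg.rep_eq one_qalg.rep_eq opmult_idop_left opmult_idop_right component_canon)+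
  show "r *\<^sub>R F * G = r *\<^sub>R (F * G)" "F * r *\<^sub>R G = r *\<^sub>R (F * G)"
    by (rule qalg_eqI, simp add: times_qalg.rep_eq scaleR_qalg.rep_eq opmult_def sum_distrib_left mult_ac)+
  have n1: "norm (1 :: 'a qalg) = 1"
  proof (rule antisym)
    show "norm (1 :: 'a qalg) \<le> 1"
      by (rule norm_qalg_leI) (auto simp: one_qalg.rep_eq opnorm_idop)
    show "1 \<le> norm (1 :: 'a qalg)"
      using opnorm_component_le_norm[of 1 "{}" "1 :: 'a qalg"] by (simp add: one_qalg.rep_eq opnorm_idop)
  qed
  then show "norm (1 :: 'a qalg) = 1" .
  show "(0 :: 'a qalg) \<noteq> 1" using n1 by (metis norm_zero zero_neq_one)
  show "norm (F * G) \<le> norm F * norm G"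
  proof (rule norm_qalg_leI)
    fix D :: nat and X :: "'a site set" assume X: "D > 0" "finite X"
    have "opnorm D X (component (F * G) D X) \<le> opnorm D X (component F D X) * opnorm D X (component G D X)"
      unfolding times_qalg.rep_eq by (rule opnorm_mult_le[OF X(2)])
    also have "\<dots> \<le> norm F * norm G"
      by (intro mult_mono opnorm_component_le_norm norm_ge_zero opnorm_nonneg X)
    finally show "opnorm D X (component (F * G) D X) \<le> norm F * norm G" .
  qed simp
qed

end

text \<open>All other components are 0, so the map is multiplicative but not unital, and the
  exponential of an injected operator is the identity in the other nondegenerate components. Results
  are therefore read off at the component \<open>D\<close>, \<open>X\<close>.\<close>

lift_definition qinj :: "nat \<Rightarrow> 'g::finite site set \<Rightarrow> 'g op \<Rightarrow> 'g qalg" is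
  "\<lambda>D X A D' X' \<sigma> \<tau>. if D' = D \<and> X' = X \<and> D > 0 \<and> finite X \<and> \<sigma> \<in> conf D X \<and> \<tau> \<in> conf D X
     then A \<sigma> \<tau> else 0"
proof -
  fix D and X :: "'g site set" and A :: "'g op"
  define F where "F = (\<lambda>D' X' \<sigma> \<tau>. if D' = D \<and> X' = X \<and> D > 0 \<and> finite X \<and> \<sigma> \<in> conf D X \<and> \<tau> \<in> conf D X
     then A \<sigma> \<tau> else 0)"
  have 1: "canon D' X' (F D' X')" for D' X' unfolding canon_def F_def by auto
  have 2: "F D' X' = (\<lambda>_ _. 0)" if "\<not> (D' > 0 \<and> finite X')" for D' X'
    using that unfolding F_def by (intro ext) auto
  have 3: "opnorm D' X' (F D' X') \<le> max 0 (opnorm D X (F D X))" for D' X'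
  proof (cases "D' = D \<and> X' = X")
    case False
    then have "F D' X' = (\<lambda>_ _. 0)" unfolding F_def by (intro ext if_not_P) blast
    then show ?thesis by simp
  qed auto
  show "bounded_family F" using 1 2 3 by (rule bounded_familyI)
qed

lemma component_qinj:
  "D > 0 \<Longrightarrow> finite X \<Longrightarrow> component (qinj D X A) D X
     = (\<lambda>\<sigma> \<tau>. if \<sigma> \<in> conf D X \<and> \<tau> \<in> conf D X then A \<sigma> \<tau> else 0)"
  by (simp add: qinj.rep_eq fun_eq_iff)

lemma canon_eqI:
  assumes "canon D X A" "canon D X B"
    "\<And>\<sigma> \<tau>. \<sigma> \<in> conf D X \<Longrightarrow> \<tau> \<in> conf D X \<Longrightarrow> A \<sigma> \<tau> = B \<sigma> \<tau>"
  shows "A = B"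
  using assms unfolding canon_def by (intro ext) metis

lemma component_qinj_canon:
  "D > 0 \<Longrightarrow> finite X \<Longrightarrow> canon D X A \<Longrightarrow> component (qinj D X A) D X = A"
  by (rule canon_eqI[OF component_canon]) (auto simp: component_qinj)

lemma component_plus: "component (F + G) D X = (\<lambda>\<sigma> \<tau>. component F D X \<sigma> \<tau> + component G D X \<sigma> \<tau>)"
  by (simp add: plus_qalg.rep_eq)

lemma component_scaleR: "component (r *\<^sub>R F) D X = (\<lambda>\<sigma> \<tau>. complex_of_real r * component F D X \<sigma> \<tau>)"
  by (simp add: scaleR_qalg.rep_eq)

lemma component_times: "component (F * G) D X = opmult D X (component F D X) (component G D X)"
  by (simp add: times_qalg.rep_eq)

lemma component_one: "D > 0 \<Longrightarrow> finite X \<Longrightarrow> component 1 D X = idop D X"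
  by (simp add: one_qalg.rep_eq)

lemma component_power:
  "D > 0 \<Longrightarrow> finite X \<Longrightarrow> component (F ^ n) D X = oppow D X (component F D X) n"
  by (induction n) (simp_all add: component_one component_times)

lemma qinj_mult: "qinj D X A * qinj D X B = qinj D X (opmult D X A B)"
proof (rule qalg_eqI)
  fix D' and X' :: "'a site set" and \<sigma> \<tau>
  assume "D' > 0" "finite X'" "\<sigma> \<in> conf D' X'" "\<tau> \<in> conf D' X'"
  then show "component (qinj D X A * qinj D X B) D' X' \<sigma> \<tau> = component (qinj D X (opmult D X A B)) D' X' \<sigma> \<tau>"
    by (cases "D' = D"; cases "X' = X") (simp_all add: component_times qinj.rep_eq opmult_def)
qed

lemma qinj_cong:
  assumes "op_eq D X A B"
  shows "qinj D X A = qinj D X B"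
  by (rule qalg_eqI) (use assms in \<open>simp add: qinj.rep_eq op_eq_def\<close>)

lemma qinj_sum: "qinj D X (\<lambda>\<sigma> \<tau>. \<Sum>i\<in>I. A i \<sigma> \<tau>) = (\<Sum>i\<in>I. qinj D X (A i))"
proof (induction I rule: infinite_finite_induct)
  case (insert x I)
  have "qinj D X (\<lambda>\<sigma> \<tau>. \<Sum>i\<in>insert x I. A i \<sigma> \<tau>) = qinj D X (A x) + qinj D X (\<lambda>\<sigma> \<tau>. \<Sum>i\<in>I. A i \<sigma> \<tau>)"
    by (rule qalg_eqI) (use insert.hyps in \<open>simp add: qinj.rep_eq component_plus\<close>)
  then show ?case using insert by simp
qed (rule qalg_eqI, simp add: qinj.rep_eq zero_qalg.rep_eq)+

lemma norm_qinj_le: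
  assumes "finite X"
  shows "norm (qinj D X A) \<le> opnorm D X A"
proof (rule norm_qalg_leI)
  fix D' :: nat and X' :: "'a site set" assume a: "D' > 0" "finite X'"
  show "opnorm D' X' (component (qinj D X A) D' X') \<le> opnorm D X A"
  proof (cases "D' = D \<and> X' = X")
    case True
    then have "opnorm D' X' (component (qinj D X A) D' X') = opnorm D X A"
      using a by (auto intro!: opnorm_cong simp: component_qinj)
    then show ?thesis by simp
  next
    case False
    then have "component (qinj D X A) D' X' = (\<lambda>_ _. 0)"
      by (intro ext) (auto simp: qinj.rep_eq)
    then show ?thesis by (simp add: opnorm_nonneg assms)
  qed
qed (simp add: opnorm_nonneg assms)

section \<open>Transfer of the exponential from the Banach algebra to matrices\<close>

lemma bounded_linear_component:
  assumes "D > 0" "finite X"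
  shows "bounded_linear (\<lambda>F. component F D X \<sigma> \<tau>)"
proof (rule bounded_linear_intro[of _ 1])
  fix F
  show "cmod (component F D X \<sigma> \<tau>) \<le> norm F * 1"
  proof (cases "\<sigma> \<in> conf D X \<and> \<tau> \<in> conf D X")
    case True
    then show ?thesis
      using cmod_entry_le_opnorm[OF assms(2), of \<sigma> D \<tau> "component F D X"] opnorm_component_le_norm[of D X F]
      by simp
  qed (simp add: component_outside)
qed (simp_all add: component_plus component_scaleR scaleR_conv_of_real[where 'a = complex])

text \<open>Reading off an entry is linear and continuous, so it carries the exponential series of
  the Banach algebra to the entrywise series defining \<open>mexp\<close>.\<close>

lemma component_exp:
  fixes X :: "'g::finite site set"
  assumes "D > 0" "finite X"
  shows "component (exp F) D X = mexp D X (component F D X)"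
proof (intro ext)
  fix \<sigma> \<tau>
  have "(\<lambda>n. component (F ^ n /\<^sub>R fact n) D X \<sigma> \<tau>) sums component (exp F) D X \<sigma> \<tau>"
    by (rule bounded_linear.sums[OF bounded_linear_component[OF assms] exp_converges])
  moreover have "component (F ^ n /\<^sub>R fact n) D X \<sigma> \<tau> = oppow D X (component F D X) n \<sigma> \<tau> / of_nat (fact n)" for n
    by (simp add: component_scaleR component_power assms divide_inverse mult.commute)
  ultimately show "component (exp F) D X \<sigma> \<tau> = mexp D X (component F D X) \<sigma> \<tau>"
    by (simp add: mexp_def sums_iff)
qed

lemma oppow_cong: "op_eq D X A B \<Longrightarrow> oppow D X A n = oppow D X B n"
proof (induction n)
  case (Suc n)
  then have "oppow D X A n = oppow D X B n" by simp
  then show ?case using Suc.prems by (auto simp: opmult_def op_eq_def fun_eq_iff)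
qed simp

lemma mexp_cong: "op_eq D X A B \<Longrightarrow> mexp D X A = mexp D X B"
  by (simp add: mexp_def oppow_cong)

lemma mexp_eq_component:
  fixes X :: "'g::finite site set"
  assumes "D > 0" "finite X"
  shows "mexp D X A = component (exp (qinj D X A)) D X"
  unfolding component_exp[OF assms]
  by (rule mexp_cong) (simp add: op_eq_def component_qinj assms)

lemma mexp_sums:
  fixes X :: "'g::finite site set"
  assumes "D > 0" "finite X"
  shows "(\<lambda>n. oppow D X A n \<sigma> \<tau> / of_nat (fact n)) sums mexp D X A \<sigma> \<tau>"
proof -
  have "oppow D X (component (qinj D X A) D X) n = oppow D X A n" for n
    by (rule oppow_cong) (simp add: op_eq_def component_qinj assms)
  then have "component ((qinj D X A) ^ n /\<^sub>R fact n) D X \<sigma> \<tau> = oppow D X A n \<sigma> \<tau> / of_nat (fact n)" for n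
    by (simp add: component_scaleR component_power assms divide_inverse mult.commute)
  then show ?thesis
    using bounded_linear.sums[OF bounded_linear_component[OF assms] exp_converges, of "qinj D X A" \<sigma> \<tau>]
    by (simp add: mexp_eq_component[OF assms])
qed

lemma canon_mexp: "D > 0 \<Longrightarrow> finite X \<Longrightarrow> canon D X (mexp D X (A :: 'g::finite op))"
  by (simp add: mexp_eq_component component_canon)

lemma mexp_add_commuting:
  fixes X :: "'g::finite site set"
  assumes "D > 0" "finite X" "opmult D X A B = opmult D X B A"
    and C: "\<And>\<sigma> \<tau>. \<sigma> \<in> conf D X \<Longrightarrow> \<tau> \<in> conf D X \<Longrightarrow> C \<sigma> \<tau> = A \<sigma> \<tau> + B \<sigma> \<tau>"
  shows "mexp D X C = opmult D X (mexp D X A) (mexp D X B)"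
proof -
  have "qinj D X A * qinj D X B = qinj D X B * qinj D X A" by (simp add: qinj_mult assms(3))
  then have "exp (qinj D X A + qinj D X B) = exp (qinj D X A) * exp (qinj D X B)"
    by (rule exp_add_commuting)
  moreover have "qinj D X A + qinj D X B = qinj D X C"
    by (rule qalg_eqI) (simp add: component_plus qinj.rep_eq C)
  ultimately show ?thesis by (simp add: mexp_eq_component assms component_times)
qed

text \<open>A multiple of the identity commutes with everything. The lemma serves to rescale an
  operator before taking its logarithm and to absorb the partition function in the effective
  Hamiltonian.\<close>

lemma mexp_add_scalar:
  fixes X :: "'g::finite site set"
  assumes "D > 0" "finite X"
    and C: "\<And>\<sigma> \<tau>. \<sigma> \<in> conf D X \<Longrightarrow> \<tau> \<in> conf D X \<Longrightarrow> C \<sigma> \<tau> = A \<sigma> \<tau> + complex_of_real c * idop D X \<sigma> \<tau>"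
  shows "mexp D X C = (\<lambda>\<sigma> \<tau>. complex_of_real (exp c) * mexp D X A \<sigma> \<tau>)"
proof -
  have "exp (qinj D X A + c *\<^sub>R 1) = exp (qinj D X A) * exp (c *\<^sub>R 1)"
    by (rule exp_add_commuting) simp
  also have "exp (c *\<^sub>R (1 :: 'g qalg)) = exp c *\<^sub>R 1"
    using exp_of_real[of c, where 'a = "'g qalg"] by (simp add: of_real_def)
  finally have 1: "exp (qinj D X A + c *\<^sub>R 1) = exp c *\<^sub>R exp (qinj D X A)" by simp
  have "mexp D X C = component (exp (qinj D X A + c *\<^sub>R 1)) D X"
    unfolding component_exp[OF assms(1,2)]
    by (rule mexp_cong)
       (simp add: op_eq_def C component_plus component_scaleR component_one component_qinj assms)
  then show ?thesis unfolding 1 by (simp add: component_scaleR mexp_eq_component assms)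
qed

lemma mexp_inverse:
  fixes X :: "'g::finite site set"
  assumes "D > 0" "finite X"
    and B: "\<And>\<sigma> \<tau>. \<sigma> \<in> conf D X \<Longrightarrow> \<tau> \<in> conf D X \<Longrightarrow> B \<sigma> \<tau> = - A \<sigma> \<tau>"
  shows "opmult D X (mexp D X A) (mexp D X B) = idop D X"
    and "opmult D X (mexp D X B) (mexp D X A) = idop D X"
proof -
  have q: "qinj D X B = - qinj D X A"
    by (rule qalg_eqI) (simp add: qinj.rep_eq component_uminus B)
  have "exp (qinj D X A) * exp (- qinj D X A) = 1" "exp (- qinj D X A) * exp (qinj D X A) = 1"
    by (subst exp_add_commuting[symmetric]; simp)+
  then show "opmult D X (mexp D X A) (mexp D X B) = idop D X"
    and "opmult D X (mexp D X B) (mexp D X A) = idop D X"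
    using assms(1,2) by (simp_all add: mexp_eq_component q flip: component_times component_one)
qed

text \<open>Powers are built by multiplication from the left, while taking adjoints moves the factor
  to the right; self-adjointness of powers needs both forms to agree.\<close>

lemma oppow_commutes:
  fixes X :: "'g::finite site set"
  assumes "D > 0" "finite X"
  shows "opmult D X A (oppow D X A n) = opmult D X (oppow D X A n) A"
proof -
  define F where "F = qinj D X A"
  have e: "op_eq D X (component F D X) A" by (simp add: F_def op_eq_def component_qinj assms)
  have 1: "oppow D X (component F D X) n = oppow D X A n" by (rule oppow_cong[OF e])
  have "component (F * F ^ n) D X = component (F ^ n * F) D X" by (simp add: power_commutes)
  then have "opmult D X (component F D X) (oppow D X A n) = opmult D X (oppow D X A n) (component F D X)"
    by (simp add: component_times component_power assms 1)
  moreover have "opmult D X (component F D X) (oppow D X A n) = opmult D X A (oppow D X A n)"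
    and "opmult D X (oppow D X A n) (component F D X) = opmult D X (oppow D X A n) A"
    using e by (auto simp: opmult_def op_eq_def fun_eq_iff)
  ultimately show ?thesis by simp
qed

lemma selfadjD: "selfadj D X A \<Longrightarrow> \<sigma> \<in> conf D X \<Longrightarrow> \<tau> \<in> conf D X \<Longrightarrow> A \<sigma> \<tau> = cnj (A \<tau> \<sigma>)"
  unfolding selfadj_def by blast

lemma selfadj_oppow:
  fixes X :: "'g::finite site set"
  assumes "D > 0" "finite X" "selfadj D X A"
  shows "selfadj D X (oppow D X A n)"
proof (induction n)
  case 0
  then show ?case by (simp add: selfadj_def idop_def)
next
  case (Suc n)
  show ?case
    unfolding selfadj_def
  proof (intro ballI)
    fix \<sigma> \<tau> assume s: "\<sigma> \<in> conf D X" "\<tau> \<in> conf D X"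
    have "oppow D X A (Suc n) \<sigma> \<tau> = (\<Sum>\<rho>\<in>conf D X. A \<sigma> \<rho> * oppow D X A n \<rho> \<tau>)"
      using s by (simp add: opmult_def)
    also have "\<dots> = (\<Sum>\<rho>\<in>conf D X. cnj (oppow D X A n \<tau> \<rho> * A \<rho> \<sigma>))"
    proof (rule sum.cong[OF refl])
      fix \<rho> assume "\<rho> \<in> conf D X"
      then have "A \<sigma> \<rho> = cnj (A \<rho> \<sigma>)" "oppow D X A n \<rho> \<tau> = cnj (oppow D X A n \<tau> \<rho>)"
        using s by (auto intro: selfadjD[OF assms(3)] selfadjD[OF Suc])
      then show "A \<sigma> \<rho> * oppow D X A n \<rho> \<tau> = cnj (oppow D X A n \<tau> \<rho> * A \<rho> \<sigma>)" by simp
    qed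
    also have "\<dots> = cnj (opmult D X (oppow D X A n) A \<tau> \<sigma>)" using s by (simp add: opmult_def)
    also have "\<dots> = cnj (oppow D X A (Suc n) \<tau> \<sigma>)" by (simp add: oppow_commutes assms)
    finally show "oppow D X A (Suc n) \<sigma> \<tau> = cnj (oppow D X A (Suc n) \<tau> \<sigma>)" .
  qed
qed

lemma selfadj_mexp:
  fixes X :: "'g::finite site set"
  assumes "D > 0" "finite X" "selfadj D X A"
  shows "selfadj D X (mexp D X A)"
  unfolding selfadj_def
proof (intro ballI)
  fix \<sigma> \<tau> assume s: "\<sigma> \<in> conf D X" "\<tau> \<in> conf D X"
  have "(\<lambda>n. cnj (oppow D X A n \<tau> \<sigma> / of_nat (fact n))) sums cnj (mexp D X A \<tau> \<sigma>)"
    using mexp_sums[OF assms(1,2)] by (simp only: sums_cnj)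
  moreover have "cnj (oppow D X A n \<tau> \<sigma> / of_nat (fact n)) = oppow D X A n \<sigma> \<tau> / of_nat (fact n)" for n
  proof -
    have "oppow D X A n \<sigma> \<tau> = cnj (oppow D X A n \<tau> \<sigma>)"
      by (rule selfadjD[OF selfadj_oppow[OF assms] s])
    then show ?thesis by simp
  qed
  ultimately show "mexp D X A \<sigma> \<tau> = cnj (mexp D X A \<tau> \<sigma>)"
    using mexp_sums[OF assms(1,2), of A \<sigma> \<tau>] sums_unique2 by fastforce
qed

section \<open>Embeddings of local algebras\<close>

text \<open>The bijection from pairs of configurations of \<open>X\<close> and \<open>Y - X\<close>
  to configurations of \<open>Y\<close>, that is, the tensor factorisation in coordinates. The same
  gluing occurs in the body of \<open>ptrace\<close>.\<close>

definition join :: "'g site set \<Rightarrow> 'g cfg \<Rightarrow> 'g cfg \<Rightarrow> 'g cfg" where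
  "join X \<sigma> \<rho> = (\<lambda>v. if v \<in> X then \<sigma> v else \<rho> v)"

lemma join_in_conf: "X \<subseteq> Y \<Longrightarrow> \<sigma> \<in> conf D X \<Longrightarrow> \<rho> \<in> conf D (Y - X) \<Longrightarrow> join X \<sigma> \<rho> \<in> conf D Y"
  by (auto simp: join_def conf_def)

lemma restr_join: "\<sigma> \<in> conf D X \<Longrightarrow> restr X (join X \<sigma> \<rho>) = \<sigma>"
  by (auto simp: join_def restr_def conf_def)

lemma restr_join_compl: "\<rho> \<in> conf D (Y - X) \<Longrightarrow> restr (Y - X) (join X \<sigma> \<rho>) = \<rho>"
  by (auto simp: join_def restr_def conf_def)

lemma join_restr: "X \<subseteq> Y \<Longrightarrow> \<sigma> \<in> conf D Y \<Longrightarrow> join X (restr X \<sigma>) (restr (Y - X) \<sigma>) = \<sigma>"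
  by (auto simp: join_def restr_def conf_def)

lemma restr_in_conf: "X \<subseteq> Y \<Longrightarrow> \<sigma> \<in> conf D Y \<Longrightarrow> restr X \<sigma> \<in> conf D X"
  by (auto simp: restr_def conf_def)

lemma restr_eq_iff: "restr S \<sigma> = restr S \<tau> \<longleftrightarrow> (\<forall>v\<in>S. \<sigma> v = \<tau> v)"
  unfolding restr_def fun_eq_iff by meson

lemma conf_splitE:
  assumes "X \<subseteq> Y" "\<sigma> \<in> conf D Y"
  obtains s r where "s \<in> conf D X" "r \<in> conf D (Y - X)" "\<sigma> = join X s r"
  using that[of "restr X \<sigma>" "restr (Y - X) \<sigma>"] assms
  by (metis Diff_subset join_restr restr_in_conf)

lemma sum_conf_split:
  assumes "X \<subseteq> Y"
  shows "(\<Sum>\<tau>\<in>conf D Y. F \<tau>) = (\<Sum>\<sigma>\<in>conf D X. \<Sum>\<rho>\<in>conf D (Y - X). F (join X \<sigma> \<rho>))"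
proof -
  have "(\<Sum>\<tau>\<in>conf D Y. F \<tau>) = (\<Sum>(\<sigma>, \<rho>)\<in>conf D X \<times> conf D (Y - X). F (join X \<sigma> \<rho>))"
    using assms
    by (intro sum.reindex_bij_witness[of _ "\<lambda>(\<sigma>, \<rho>). join X \<sigma> \<rho>" "\<lambda>\<sigma>. (restr X \<sigma>, restr (Y - X) \<sigma>)"])
       (auto simp: join_restr restr_join restr_join_compl join_in_conf intro: restr_in_conf)
  then show ?thesis by (simp add: sum.cartesian_product)
qed

lemma canon_emb [simp]: "canon D Y (emb D X Y A)"
  by (auto simp: canon_def emb_def)

lemma emb_join:
  assumes "X \<subseteq> Y" "\<sigma> \<in> conf D X" "\<sigma>' \<in> conf D X" "\<rho> \<in> conf D (Y - X)" "\<rho>' \<in> conf D (Y - X)"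
  shows "emb D X Y A (join X \<sigma> \<rho>) (join X \<sigma>' \<rho>') = (if \<rho> = \<rho>' then A \<sigma> \<sigma>' else 0)"
  unfolding emb_def using assms by (simp add: restr_join restr_join_compl join_in_conf)

text \<open>In split coordinates an operator tensored with the identity has the entries of
  \<open>A\<close> times a Kronecker delta. This reduces identities between embeddings to a
  computation on each factor.\<close>

lemma emb_eqI:
  assumes "X \<subseteq> Y" "canon D Y B"
    "\<And>\<sigma> \<sigma>' \<rho> \<rho>'. \<sigma> \<in> conf D X \<Longrightarrow> \<sigma>' \<in> conf D X \<Longrightarrow> \<rho> \<in> conf D (Y - X) \<Longrightarrow> \<rho>' \<in> conf D (Y - X) \<Longrightarrow>
       B (join X \<sigma> \<rho>) (join X \<sigma>' \<rho>') = (if \<rho> = \<rho>' then A \<sigma> \<sigma>' else 0)"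
  shows "emb D X Y A = B"
proof (rule canon_eqI[OF canon_emb assms(2)])
  fix \<sigma> \<tau> assume "\<sigma> \<in> conf D Y" "\<tau> \<in> conf D Y"
  then obtain s r s' r' where "s \<in> conf D X" "r \<in> conf D (Y - X)" "\<sigma> = join X s r"
    "s' \<in> conf D X" "r' \<in> conf D (Y - X)" "\<tau> = join X s' r'"
    by (metis conf_splitE[OF assms(1)])
  then show "emb D X Y A \<sigma> \<tau> = B \<sigma> \<tau>" using assms by (simp add: emb_join)
qed

lemma emb_cong: "X \<subseteq> Y \<Longrightarrow> op_eq D X A B \<Longrightarrow> emb D X Y A = emb D X Y B"
  by (rule emb_eqI) (auto simp: emb_join op_eq_def)

lemma emb_opmult:
  assumes "X \<subseteq> Y" "finite Y"
  shows "emb D X Y (opmult D X A B) = opmult D Y (emb D X Y A) (emb D X Y B)"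
proof (rule emb_eqI[OF assms(1)])
  fix \<sigma> \<sigma>' \<rho> \<rho>'
  assume s: "\<sigma> \<in> conf D X" "\<sigma>' \<in> conf D X" "\<rho> \<in> conf D (Y - X)" "\<rho>' \<in> conf D (Y - X)"
  have "opmult D Y (emb D X Y A) (emb D X Y B) (join X \<sigma> \<rho>) (join X \<sigma>' \<rho>')
     = (\<Sum>t\<in>conf D X. \<Sum>r\<in>conf D (Y - X). emb D X Y A (join X \<sigma> \<rho>) (join X t r) * emb D X Y B (join X t r) (join X \<sigma>' \<rho>'))"
    unfolding opmult_def using s assms(1) by (simp add: join_in_conf sum_conf_split[OF assms(1)])
  also have "\<dots> = (\<Sum>t\<in>conf D X. \<Sum>r\<in>conf D (Y - X). if r = \<rho> then (if \<rho> = \<rho>' then A \<sigma> t * B t \<sigma>' else 0) else 0)"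
    using s assms(1) by (intro sum.cong refl) (auto simp: emb_join)
  also have "\<dots> = (if \<rho> = \<rho>' then opmult D X A B \<sigma> \<sigma>' else 0)"
    using s assms(2) by (simp add: finite_conf opmult_def)
  finally show "opmult D Y (emb D X Y A) (emb D X Y B) (join X \<sigma> \<rho>) (join X \<sigma>' \<rho>')
    = (if \<rho> = \<rho>' then opmult D X A B \<sigma> \<sigma>' else 0)" .
qed simp

lemma join_inject:
  assumes "\<sigma> \<in> conf D X" "\<sigma>' \<in> conf D X" "\<rho> \<in> conf D (Y - X)" "\<rho>' \<in> conf D (Y - X)"
  shows "join X \<sigma> \<rho> = join X \<sigma>' \<rho>' \<longleftrightarrow> \<sigma> = \<sigma>' \<and> \<rho> = \<rho>'"
  using assms by (metis restr_join restr_join_compl)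

lemma emb_idop:
  assumes "X \<subseteq> Y"
  shows "emb D X Y (idop D X) = idop D Y"
proof (rule emb_eqI[OF assms canon_idop])
  fix \<sigma> \<sigma>' \<rho> \<rho>'
  assume "\<sigma> \<in> conf D X" "\<sigma>' \<in> conf D X" "\<rho> \<in> conf D (Y - X)" "\<rho>' \<in> conf D (Y - X)"
  then show "idop D Y (join X \<sigma> \<rho>) (join X \<sigma>' \<rho>') = (if \<rho> = \<rho>' then idop D X \<sigma> \<sigma>' else 0)"
    using assms by (simp add: idop_def join_in_conf join_inject)
qed

lemma emb_oppow:
  assumes "X \<subseteq> Y" "finite Y"
  shows "emb D X Y (oppow D X A n) = oppow D Y (emb D X Y A) n"
  by (induction n) (simp_all add: emb_idop emb_opmult assms)

lemma emb_mexp: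
  assumes "X \<subseteq> Y" "finite Y"
  shows "emb D X Y (mexp D X A) = mexp D Y (emb D X Y A)"
proof (intro ext)
  fix \<sigma> \<tau>
  show "emb D X Y (mexp D X A) \<sigma> \<tau> = mexp D Y (emb D X Y A) \<sigma> \<tau>"
    unfolding mexp_def emb_oppow[OF assms, symmetric]
    unfolding emb_def by (cases "\<sigma> \<in> conf D Y \<and> \<tau> \<in> conf D Y \<and> restr (Y - X) \<sigma> = restr (Y - X) \<tau>")
       (simp_all only: if_True if_False simp_thms, simp)
qed

lemma emb_emb:
  assumes "X \<subseteq> Y" "Y \<subseteq> Z"
  shows "emb D Y Z (emb D X Y A) = emb D X Z A"
proof (intro ext)
  fix \<sigma> \<tau>
  have 1: "restr W (restr Y \<sigma>) = restr W \<sigma>" if "W \<subseteq> Y" for W and \<sigma> :: "'a cfg"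
    using that unfolding restr_def by (intro ext) auto
  have 2: "restr (Z - X) \<sigma> = restr (Z - X) \<tau> \<longleftrightarrow>
      restr (Z - Y) \<sigma> = restr (Z - Y) \<tau> \<and> restr (Y - X) \<sigma> = restr (Y - X) \<tau>"
    using assms unfolding restr_eq_iff by blast
  show "emb D Y Z (emb D X Y A) \<sigma> \<tau> = emb D X Z A \<sigma> \<tau>"
    using assms restr_in_conf[of Y Z _ D] by (auto simp: emb_def 1 2)
qed

text \<open>The first factor forces the intermediate configuration to equal \<open>\<sigma>\<close>
  off \<open>X\<close>, the second to equal \<open>\<tau>\<close> off \<open>Y\<close>, in
  particular on \<open>X\<close>. So only \<open>join X \<tau> \<sigma>\<close> can contribute to
  the sum.\<close>

lemma opmult_emb_disjoint:
  assumes "X \<subseteq> Z" "Y \<subseteq> Z" "X \<inter> Y = {}" "finite Z" "\<sigma> \<in> conf D Z" "\<tau> \<in> conf D Z"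
  shows "opmult D Z (emb D X Z A) (emb D Y Z B) \<sigma> \<tau>
    = (if restr (Z - (X \<union> Y)) \<sigma> = restr (Z - (X \<union> Y)) \<tau>
       then A (restr X \<sigma>) (restr X \<tau>) * B (restr Y \<sigma>) (restr Y \<tau>) else 0)"
proof -
  define \<omega>' where "\<omega>' = join X \<tau> \<sigma>"
  have w: "\<omega>' \<in> conf D Z" using assms unfolding \<omega>'_def join_def conf_def by auto
  have t: "emb D X Z A \<sigma> \<omega> * emb D Y Z B \<omega> \<tau> = (if \<omega> = \<omega>' then
      (if restr (Z - (X \<union> Y)) \<sigma> = restr (Z - (X \<union> Y)) \<tau>
       then A (restr X \<sigma>) (restr X \<tau>) * B (restr Y \<sigma>) (restr Y \<tau>) else 0) else 0)"
    if om: "\<omega> \<in> conf D Z" for \<omega>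
  proof (cases "restr (Z - X) \<sigma> = restr (Z - X) \<omega> \<and> restr (Z - Y) \<omega> = restr (Z - Y) \<tau>")
    case True
    then have a: "\<And>v. v \<in> Z - X \<Longrightarrow> \<sigma> v = \<omega> v" and b: "\<And>v. v \<in> Z - Y \<Longrightarrow> \<omega> v = \<tau> v"
      unfolding restr_eq_iff by blast+
    have "\<omega> v = \<omega>' v" for v
      using a[of v] b[of v] om assms unfolding \<omega>'_def join_def conf_def
      by (cases "v \<in> Z") (auto)
    then have e: "\<omega> = \<omega>'" by blast
    have "restr (Z - (X \<union> Y)) \<sigma> = restr (Z - (X \<union> Y)) \<tau>"
      unfolding restr_eq_iff using a b by simp
    moreover have "restr X \<omega> = restr X \<tau>" using assms b unfolding restr_eq_iff by blast
    moreover have "restr Y \<omega> = restr Y \<sigma>" using assms a unfolding restr_eq_iff by (metis DiffI disjoint_iff subsetD)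
    ultimately show ?thesis using True e om assms by (simp add: emb_def)
  next
    case False
    have "\<not> (\<omega> = \<omega>' \<and> restr (Z - (X \<union> Y)) \<sigma> = restr (Z - (X \<union> Y)) \<tau>)"
    proof
      assume e: "\<omega> = \<omega>' \<and> restr (Z - (X \<union> Y)) \<sigma> = restr (Z - (X \<union> Y)) \<tau>"
      then have c: "\<And>v. v \<in> Z - (X \<union> Y) \<Longrightarrow> \<sigma> v = \<tau> v" unfolding restr_eq_iff by blast
      have "restr (Z - X) \<sigma> = restr (Z - X) \<omega> \<and> restr (Z - Y) \<omega> = restr (Z - Y) \<tau>"
        unfolding restr_eq_iff using e c by (auto simp: \<omega>'_def join_def)
      then show False using False by blast
    qed
    then show ?thesis using False by (auto simp: emb_def)
  qed
  have "opmult D Z (emb D X Z A) (emb D Y Z B) \<sigma> \<tau> = (\<Sum>\<omega>\<in>conf D Z. emb D X Z A \<sigma> \<omega> * emb D Y Z B \<omega> \<tau>)"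
    using assms by (simp add: opmult_def)
  also have "\<dots> = (\<Sum>\<omega>\<in>conf D Z. if \<omega> = \<omega>' then
      (if restr (Z - (X \<union> Y)) \<sigma> = restr (Z - (X \<union> Y)) \<tau>
       then A (restr X \<sigma>) (restr X \<tau>) * B (restr Y \<sigma>) (restr Y \<tau>) else 0) else 0)"
    by (rule sum.cong[OF refl t])
  finally show ?thesis using w assms by (simp add: finite_conf)
qed

lemma emb_commute_disjoint:
  assumes "X \<subseteq> Z" "Y \<subseteq> Z" "X \<inter> Y = {}" "finite Z"
  shows "opmult D Z (emb D X Z A) (emb D Y Z B) = opmult D Z (emb D Y Z B) (emb D X Z A)"
proof (rule canon_eqI)
  fix \<sigma> \<tau> assume "\<sigma> \<in> conf D Z" "\<tau> \<in> conf D Z"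
  moreover have "Y \<inter> X = {}" using assms by blast
  ultimately show "opmult D Z (emb D X Z A) (emb D Y Z B) \<sigma> \<tau> = opmult D Z (emb D Y Z B) (emb D X Z A) \<sigma> \<tau>"
    using assms by (simp add: opmult_emb_disjoint Un_commute mult.commute)
qed simp_all

lemma optrace_emb_disjoint:
  assumes "X \<inter> Y = {}" "finite X" "finite Y"
  shows "optrace D (X \<union> Y) (opmult D (X \<union> Y) (emb D X (X \<union> Y) A) (emb D Y (X \<union> Y) B))
    = optrace D X A * optrace D Y B"
proof -
  have d: "X \<union> Y - X = Y" using assms by blast
  have "optrace D (X \<union> Y) (opmult D (X \<union> Y) (emb D X (X \<union> Y) A) (emb D Y (X \<union> Y) B))
      = (\<Sum>\<sigma>\<in>conf D (X \<union> Y). A (restr X \<sigma>) (restr X \<sigma>) * B (restr Y \<sigma>) (restr Y \<sigma>))"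
    unfolding optrace_def using assms by (intro sum.cong refl) (simp add: opmult_emb_disjoint)
  also have "\<dots> = (\<Sum>\<sigma>\<in>conf D X. \<Sum>\<rho>\<in>conf D Y. A \<sigma> \<sigma> * B \<rho> \<rho>)"
    using restr_join[of _ D X] restr_join_compl[of _ D "X \<union> Y" X]
    by (subst sum_conf_split[of X]) (auto simp: d intro!: sum.cong)
  finally show ?thesis by (simp add: optrace_def sum_product)
qed

lemma vnorm_split:
  assumes "X \<subseteq> Y"
  shows "(vnorm D Y v)\<^sup>2 = (\<Sum>\<rho>\<in>conf D (Y - X). (vnorm D X (\<lambda>\<sigma>. v (join X \<sigma> \<rho>)))\<^sup>2)"
proof -
  have "(vnorm D Y v)\<^sup>2 = (\<Sum>\<tau>\<in>conf D Y. (cmod (v \<tau>))\<^sup>2)"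
    by (simp add: vnorm_def sum_nonneg)
  also have "\<dots> = (\<Sum>\<rho>\<in>conf D (Y - X). \<Sum>\<sigma>\<in>conf D X. (cmod (v (join X \<sigma> \<rho>)))\<^sup>2)"
    unfolding sum_conf_split[OF assms] by (rule sum.swap)
  finally show ?thesis by (simp add: vnorm_def sum_nonneg)
qed

lemma opapply_emb_join:
  assumes "X \<subseteq> Y" "finite Y" "\<sigma> \<in> conf D X" "\<rho> \<in> conf D (Y - X)"
  shows "opapply D Y (emb D X Y A) v (join X \<sigma> \<rho>) = opapply D X A (\<lambda>\<tau>. v (join X \<tau> \<rho>)) \<sigma>"
proof -
  have "opapply D Y (emb D X Y A) v (join X \<sigma> \<rho>)
      = (\<Sum>\<tau>\<in>conf D X. \<Sum>r\<in>conf D (Y - X). if r = \<rho> then A \<sigma> \<tau> * v (join X \<tau> \<rho>) else 0)"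
    unfolding opapply_def sum_conf_split[OF assms(1)] using assms
    by (intro sum.cong refl) (auto simp: emb_join)
  then show ?thesis using assms by (simp add: finite_conf opapply_def)
qed

lemma vnorm_emb_split:
  assumes "X \<subseteq> Y" "finite Y"
  shows "(vnorm D Y (opapply D Y (emb D X Y A) v))\<^sup>2
    = (\<Sum>\<rho>\<in>conf D (Y - X). (vnorm D X (opapply D X A (\<lambda>\<tau>. v (join X \<tau> \<rho>))))\<^sup>2)"
  unfolding vnorm_split[OF assms(1)]
  by (intro sum.cong refl arg_cong[of _ _ "\<lambda>x. x\<^sup>2"] vnorm_cong opapply_emb_join assms)

text \<open>The embedded operator acts as a copy of \<open>A\<close> on each block with fixed
  configuration outside \<open>X\<close>, and squared norms add over blocks.\<close>

lemma opnorm_emb_le: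
  assumes "X \<subseteq> Y" "finite Y"
  shows "opnorm D Y (emb D X Y A) \<le> opnorm D X A"
proof (rule opnorm_leI)
  have fX: "finite X" using assms finite_subset by blast
  then show "0 \<le> opnorm D X A" by (rule opnorm_nonneg)
  fix v
  have "(vnorm D Y (opapply D Y (emb D X Y A) v))\<^sup>2
      \<le> (\<Sum>\<rho>\<in>conf D (Y - X). (opnorm D X A * vnorm D X (\<lambda>\<tau>. v (join X \<tau> \<rho>)))\<^sup>2)"
    unfolding vnorm_emb_split[OF assms] by (intro sum_mono power_mono vnorm_opapply_le fX) simp
  also have "\<dots> = (opnorm D X A * vnorm D Y v)\<^sup>2"
    unfolding power_mult_distrib vnorm_split[OF assms(1), of D v] sum_distrib_left ..
  finally show "vnorm D Y (opapply D Y (emb D X Y A) v) \<le> opnorm D X A * vnorm D Y v"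
    by (rule power2_le_imp_le) (simp add: opnorm_nonneg[OF fX])
qed

text \<open>The vector \<open>v\<close> tensored with the basis vector of the zero configuration on
  \<open>Y - X\<close>, a norm-preserving extension.\<close>

definition vext :: "'g site set \<Rightarrow> 'g site set \<Rightarrow> 'g vect \<Rightarrow> 'g vect" where
  "vext X Y v = (\<lambda>\<tau>. if restr (Y - X) \<tau> = (\<lambda>_. 0) then v (restr X \<tau>) else 0)"

lemma vext_join:
  assumes "\<sigma> \<in> conf D X" "\<rho> \<in> conf D (Y - X)"
  shows "vext X Y v (join X \<sigma> \<rho>) = (if \<rho> = (\<lambda>_. 0) then v \<sigma> else 0)"
  using assms by (simp add: vext_def restr_join restr_join_compl)

lemma vnorm_vext:
  assumes "X \<subseteq> Y" "finite Y" "D > 0"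
  shows "vnorm D Y (vext X Y v) = vnorm D X v"
proof -
  have z: "(\<lambda>_. 0) \<in> conf D (Y - X)" by (rule zero_in_conf[OF assms(3)])
  have V: "vnorm D X (\<lambda>\<sigma>. vext X Y v (join X \<sigma> \<rho>)) = (if \<rho> = (\<lambda>_. 0) then vnorm D X v else 0)"
    if "\<rho> \<in> conf D (Y - X)" for \<rho>
  proof -
    have "vnorm D X (\<lambda>\<sigma>. vext X Y v (join X \<sigma> \<rho>)) = vnorm D X (\<lambda>\<sigma>. if \<rho> = (\<lambda>_. 0) then v \<sigma> else 0)"
      by (rule vnorm_cong) (use that in \<open>simp add: vext_join\<close>)
    then show ?thesis by simp
  qed
  have "(vnorm D Y (vext X Y v))\<^sup>2 = (\<Sum>\<rho>\<in>conf D (Y - X). if \<rho> = (\<lambda>_. 0) then (vnorm D X v)\<^sup>2 else 0)"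
    unfolding vnorm_split[OF assms(1)] by (rule sum.cong) (auto simp: V)
  then have "(vnorm D Y (vext X Y v))\<^sup>2 = (vnorm D X v)\<^sup>2"
    using z assms by (simp add: finite_conf)
  then show ?thesis using power2_eq_iff_nonneg vnorm_nonneg by blast
qed

lemma opapply_vext:
  assumes "X \<subseteq> Y" "finite Y" "D > 0"
  shows "opapply D Y A (vext X Y v) \<omega> = (\<Sum>\<sigma>\<in>conf D X. A \<omega> (join X \<sigma> (\<lambda>_. 0)) * v \<sigma>)"
proof -
  have "opapply D Y A (vext X Y v) \<omega>
      = (\<Sum>\<sigma>\<in>conf D X. \<Sum>\<rho>\<in>conf D (Y - X). if \<rho> = (\<lambda>_. 0) then A \<omega> (join X \<sigma> \<rho>) * v \<sigma> else 0)"
    unfolding opapply_def sum_conf_split[OF assms(1)]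
    by (intro sum.cong refl) (simp add: vext_join)
  then show ?thesis using assms zero_in_conf[OF assms(3), of "Y - X"] by (simp add: finite_conf)
qed

text \<open>On extended vectors \<open>vext X Y v\<close> the block of the zero configuration
  already reproduces the action of \<open>A\<close>. With the reverse bound, estimates on a large
  region descend to a smaller one.\<close>

lemma opnorm_le_emb:
  assumes "X \<subseteq> Y" "finite Y" "D > 0"
  shows "opnorm D X A \<le> opnorm D Y (emb D X Y A)"
proof (rule opnorm_leI)
  show N: "0 \<le> opnorm D Y (emb D X Y A)" by (rule opnorm_nonneg[OF assms(2)])
  fix v
  define z :: "'a cfg" where "z = (\<lambda>_. 0)"
  have z: "z \<in> conf D (Y - X)" unfolding z_def by (rule zero_in_conf[OF assms(3)])
  define V where "V = vext X Y v"
  have "vnorm D X (opapply D X A v) = vnorm D X (opapply D X A (\<lambda>\<tau>. V (join X \<tau> z)))"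
    by (intro vnorm_cong) (simp add: opapply_def V_def vext_join[OF _ z[unfolded z_def]] z_def)
  then have "(vnorm D X (opapply D X A v))\<^sup>2 \<le> (vnorm D Y (opapply D Y (emb D X Y A) V))\<^sup>2"
    unfolding vnorm_emb_split[OF assms(1,2)]
    using member_le_sum[OF z, of "\<lambda>\<rho>. (vnorm D X (opapply D X A (\<lambda>\<tau>. V (join X \<tau> \<rho>))))\<^sup>2"] assms
    by (simp add: finite_conf)
  then have "vnorm D X (opapply D X A v) \<le> vnorm D Y (opapply D Y (emb D X Y A) V)"
    by (rule power2_le_imp_le) simp
  also have "\<dots> \<le> opnorm D Y (emb D X Y A) * vnorm D X v"
    using vnorm_opapply_le[OF assms(2), of D "emb D X Y A" V] by (simp add: V_def vnorm_vext[OF assms])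
  finally show "vnorm D X (opapply D X A v) \<le> opnorm D Y (emb D X Y A) * vnorm D X v" .
qed

section \<open>Logarithms of positive operators\<close>

lemma canon_oppow: "canon D X (oppow D X A n)"
  by (cases n) simp_all

lemma oppow_add:
  assumes "finite X"
  shows "oppow D X A (m + n) = opmult D X (oppow D X A m) (oppow D X A n)"
  by (induction m) (simp_all add: opmult_idop_left assms canon_oppow opmult_assoc)

lemma selfadj_opmult_self_diag:
  assumes "selfadj D X A" "\<sigma> \<in> conf D X"
  shows "opmult D X A A \<sigma> \<sigma> = complex_of_real (\<Sum>\<tau>\<in>conf D X. (cmod (A \<sigma> \<tau>))\<^sup>2)"
proof -
  have "opmult D X A A \<sigma> \<sigma> = (\<Sum>\<tau>\<in>conf D X. A \<sigma> \<tau> * cnj (A \<sigma> \<tau>))"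
    unfolding opmult_def using assms
    by (auto intro!: sum.cong simp: selfadjD[OF assms(1) _ assms(2)])
  then show ?thesis unfolding complex_norm_square[symmetric] by simp
qed

text \<open>The diagonal entries of \<open>exp S + exp (- S)\<close> are series with nonnegative terms, the second of which is
  the squared norm of a row of \<open>S\<close>.\<close>

lemma selfadj_mexp_eq_idop:
  fixes X :: "'g::finite site set"
  assumes D: "D > 0" "finite X" and S: "selfadj D X S" and e: "mexp D X S = idop D X"
    and st: "\<sigma> \<in> conf D X" "\<tau> \<in> conf D X"
  shows "S \<sigma> \<tau> = 0"
proof -
  define N where "N = (\<lambda>\<sigma> \<tau>. - S \<sigma> \<tau>)"
  have "opmult D X (mexp D X S) (mexp D X N) = idop D X"
    by (rule mexp_inverse(1)[OF D]) (simp add: N_def)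
  then have eN: "mexp D X N = idop D X"
    by (simp add: e opmult_idop_left D canon_mexp)
  have pw: "oppow D X N n \<sigma> \<tau> = (- 1) ^ n * oppow D X S n \<sigma> \<tau>" for n \<sigma> \<tau>
    by (induction n arbitrary: \<sigma> \<tau>) (simp_all add: opmult_def N_def sum_distrib_left mult_ac sum_negf)
  define a where "a n = oppow D X S n \<sigma> \<sigma> / of_nat (fact n)" for n
  have "a sums 1"
    using mexp_sums[OF D, of S \<sigma> \<sigma>] e st(1) by (simp add: a_def[abs_def] idop_def)
  moreover have "(\<lambda>n. (- 1) ^ n * a n) sums 1"
    using mexp_sums[OF D, of N \<sigma> \<sigma>] eN st(1) by (simp add: a_def[abs_def] idop_def pw)
  ultimately have "(\<lambda>n. a n + (- 1) ^ n * a n) sums (1 + 1)" by (rule sums_add)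
  then have s: "(\<lambda>n. Re (a n + (- 1) ^ n * a n)) sums 2"
    by (auto dest: sums_Re)
  have diag: "oppow D X S (k + k) \<sigma> \<sigma> = complex_of_real (\<Sum>\<tau>\<in>conf D X. (cmod (oppow D X S k \<sigma> \<tau>))\<^sup>2)" for k
    unfolding oppow_add[OF D(2)] by (rule selfadj_opmult_self_diag[OF selfadj_oppow[OF D S] st(1)])
  have pos: "Re (a n + (- 1) ^ n * a n) \<ge> 0" for n
  proof (cases "even n")
    case True
    then obtain k where "n = k + k" by (metis evenE mult_2)
    then have "a n = complex_of_real ((\<Sum>\<tau>\<in>conf D X. (cmod (oppow D X S k \<sigma> \<tau>))\<^sup>2) / fact n)"
      by (simp only: a_def diag) simp
    then have "Re (a n) = (\<Sum>\<tau>\<in>conf D X. (cmod (oppow D X S k \<sigma> \<tau>))\<^sup>2) / fact n"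
      by (simp only: Re_complex_of_real)
    then show ?thesis using True by (simp add: sum_nonneg)
  qed simp
  \<comment> \<open>The term \<open>n = 0\<close> alone contributes 2, the value of the whole
    series. The nonnegative term \<open>n = 2\<close> is thereby forced to vanish.\<close>
  have "(\<Sum>n\<in>{0, 2}. Re (a n + (- 1) ^ n * a n)) \<le> 2"
    using sum_le_suminf[OF sums_summable[OF s], of "{0, 2}"] pos s by (simp add: sums_iff)
  moreover have "a 0 = 1" using st by (simp add: a_def idop_def)
  ultimately have "Re (a 2) \<le> 0" by simp
  moreover have "oppow D X S 2 \<sigma> \<sigma> = complex_of_real (\<Sum>\<tau>\<in>conf D X. (cmod (oppow D X S 1 \<sigma> \<tau>))\<^sup>2)"
    using diag[of 1] by (simp add: numeral_2_eq_2)
  then have "Re (a 2) = (\<Sum>\<tau>\<in>conf D X. (cmod (oppow D X S 1 \<sigma> \<tau>))\<^sup>2) / 2"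
    by (simp add: a_def)
  ultimately have "(\<Sum>\<tau>\<in>conf D X. (cmod (oppow D X S 1 \<sigma> \<tau>))\<^sup>2) \<le> 0" by simp
  then have "(\<Sum>\<tau>\<in>conf D X. (cmod (oppow D X S 1 \<sigma> \<tau>))\<^sup>2) = 0"
    by (intro antisym sum_nonneg) auto
  then have 0: "oppow D X S 1 \<sigma> \<tau> = 0"
    using st D by (subst (asm) sum_nonneg_eq_0_iff) (auto simp: finite_conf)
  have "oppow D X S 1 \<sigma> \<tau> = (\<Sum>\<rho>\<in>conf D X. if \<rho> = \<tau> then S \<sigma> \<tau> else 0)"
    using st by (auto simp: opmult_def idop_def intro!: sum.cong)
  then show ?thesis using 0 st D by (simp add: finite_conf)
qed

definition qform :: "nat \<Rightarrow> 'g site set \<Rightarrow> 'g op \<Rightarrow> 'g vect \<Rightarrow> complex" where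
  "qform D X M v = (\<Sum>\<sigma>\<in>conf D X. cnj (v \<sigma>) * opapply D X M v \<sigma>)"

text \<open>For small \<open>t\<close> the operator \<open>1 - t M\<close> has norm less than 1, so the logarithm series converges. Any
  other self-adjoint logarithm commutes with its sum, so their difference has exponential 1.\<close>

lemma ex1_log:
  fixes X :: "'g::finite site set"
  assumes D: "D > 0" "finite X" and M: "canon D X M" "selfadj D X M"
    and \<delta>: "\<delta> > 0" "\<And>v. \<delta> * (vnorm D X v)\<^sup>2 \<le> Re (qform D X M v)"
  shows "\<exists>!K. canon D X K \<and> selfadj D X K \<and> op_eq D X (mexp D X K) M"
proof -
  define m where "m = opnorm D X M + 1"
  have m: "m > 0" "opnorm D X M \<le> m" using opnorm_nonneg[OF D(2), of D M] by (auto simp: m_def)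
  \<comment> \<open>This value minimises
    \<open>1 - 2 * t * \<delta> + t\<^sup>2 * m\<^sup>2\<close>, the bound on the squared norm of
    \<open>R\<close>; the minimum is \<open>1 - \<delta>\<^sup>2 / m\<^sup>2\<close>.\<close>
  define t where "t = \<delta> / m\<^sup>2"
  have t: "t > 0" using \<delta> m by (simp add: t_def)
  define R where "R = (\<lambda>\<sigma> \<tau>. idop D X \<sigma> \<tau> - complex_of_real t * M \<sigma> \<tau>)"
  have Rc: "canon D X R" using M(1) canon_idop[of D X] unfolding R_def canon_def by simp
  have Rs: "selfadj D X R"
    unfolding selfadj_def
  proof (intro ballI)
    fix \<sigma> \<tau> assume st: "\<sigma> \<in> conf D X" "\<tau> \<in> conf D X"
    show "R \<sigma> \<tau> = cnj (R \<tau> \<sigma>)"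
      unfolding R_def by (subst selfadjD[OF M(2) st]) (simp add: idop_def st)
  qed
  \<comment> \<open>The maximum with 0 makes \<open>q\<close> nonnegative without first comparing
    \<open>\<delta>\<close> and \<open>m\<close>.\<close>
  define q where "q = sqrt (max 0 (1 - \<delta>\<^sup>2 / m\<^sup>2))"
  have q: "q \<ge> 0" "q < 1" using \<delta> m by (auto simp: q_def)
  have "opnorm D X R \<le> q"
  proof (rule opnorm_leI[OF q(1)])
    fix v
    define w where "w = opapply D X M v"
    have Rv: "opapply D X R v \<sigma> = v \<sigma> - complex_of_real t * w \<sigma>" if "\<sigma> \<in> conf D X" for \<sigma>
    proof -
      have "opapply D X R v \<sigma> = opapply D X (idop D X) v \<sigma> - complex_of_real t * w \<sigma>"
        by (simp add: R_def w_def opapply_def left_diff_distrib sum_subtractf sum_distrib_left mult.assoc)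
      then show ?thesis by (simp add: opapply_idop D that)
    qed
    have pt: "(cmod (x - complex_of_real t * y))\<^sup>2 = (cmod x)\<^sup>2 - 2 * t * Re (cnj x * y) + t\<^sup>2 * (cmod y)\<^sup>2"
      for x y :: complex
      by (simp only: cmod_power2) (simp add: power2_eq_square algebra_simps)
    have "(vnorm D X (opapply D X R v))\<^sup>2 = (\<Sum>\<sigma>\<in>conf D X. (cmod (v \<sigma> - complex_of_real t * w \<sigma>))\<^sup>2)"
      by (simp add: vnorm_def sum_nonneg Rv)
    also have "\<dots> = (vnorm D X v)\<^sup>2 - 2 * t * Re (qform D X M v) + t\<^sup>2 * (vnorm D X w)\<^sup>2"
    proof -
      have "Re (qform D X M v) = (\<Sum>\<sigma>\<in>conf D X. Re (cnj (v \<sigma>) * w \<sigma>))"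
        by (simp only: qform_def w_def Re_sum)
      moreover have "(vnorm D X u)\<^sup>2 = (\<Sum>\<sigma>\<in>conf D X. (cmod (u \<sigma>))\<^sup>2)" for u
        by (simp add: vnorm_def sum_nonneg)
      ultimately show ?thesis
        unfolding pt by (simp only: sum.distrib sum_subtractf sum_distrib_left)
    qed
    also have "\<dots> \<le> (vnorm D X v)\<^sup>2 - 2 * t * (\<delta> * (vnorm D X v)\<^sup>2) + t\<^sup>2 * (m * vnorm D X v)\<^sup>2"
    proof -
      have "vnorm D X w \<le> m * vnorm D X v"
        using vnorm_opapply_le[OF D(2), of D M v] m(2)
        by (smt (verit, best) mult_right_mono vnorm_nonneg w_def)
      then have "t\<^sup>2 * (vnorm D X w)\<^sup>2 \<le> t\<^sup>2 * (m * vnorm D X v)\<^sup>2"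
        by (intro mult_left_mono power_mono) auto
      moreover have "2 * t * (\<delta> * (vnorm D X v)\<^sup>2) \<le> 2 * t * Re (qform D X M v)"
        using \<delta>(2)[of v] t by (intro mult_left_mono) auto
      ultimately show ?thesis by linarith
    qed
    also have "\<dots> = (1 - \<delta>\<^sup>2 / m\<^sup>2) * (vnorm D X v)\<^sup>2"
      using m by (simp add: t_def power2_eq_square field_simps)
    also have "\<dots> \<le> max 0 (1 - \<delta>\<^sup>2 / m\<^sup>2) * (vnorm D X v)\<^sup>2"
      by (intro mult_right_mono) auto
    also have "\<dots> = (q * vnorm D X v)\<^sup>2" by (simp add: q_def power_mult_distrib)
    finally show "vnorm D X (opapply D X R v) \<le> q * vnorm D X v"
      by (rule power2_le_imp_le) (use q in simp)
  qed
  define F where "F = qinj D X R"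
  have F1: "norm F < 1" using norm_qinj_le[OF D(2), of D R] \<open>opnorm D X R \<le> q\<close> q by (simp add: F_def)
  have cF: "component F D X = R" unfolding F_def by (rule component_qinj_canon[OF D Rc])
  define l where "l = (\<Sum>n. F ^ Suc n /\<^sub>R real (Suc n))"
  have el: "exp (- l) = 1 - F" unfolding l_def by (rule exp_log_series(2)[OF F1])
  have cl: "(\<lambda>n. oppow D X R (Suc n) \<sigma> \<tau> / of_nat (Suc n)) sums component l D X \<sigma> \<tau>" for \<sigma> \<tau>
  proof -
    have "component (F ^ Suc n /\<^sub>R real (Suc n)) D X \<sigma> \<tau> = oppow D X R (Suc n) \<sigma> \<tau> / of_nat (Suc n)" for n
      by (simp add: component_scaleR component_power D cF divide_inverse mult.commute del: of_nat_Suc oppow.simps power_Suc)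
    then show ?thesis
      using bounded_linear.sums[OF bounded_linear_component[OF D] summable_sums[OF exp_log_series(1)[OF F1]], of \<sigma> \<tau>]
      by (simp add: l_def del: of_nat_Suc oppow.simps power_Suc)
  qed
  \<comment> \<open>From \<open>1 - R = t M\<close> and \<open>exp (- l) = 1 - F\<close>, a
    logarithm of \<open>M\<close> is \<open>- l\<close> shifted by \<open>- ln t\<close>.\<close>
  define Lq where "Lq = - l + (- ln t) *\<^sub>R 1"
  define K where "K = component Lq D X"
  have K: "K \<sigma> \<tau> = - component l D X \<sigma> \<tau> + complex_of_real (- ln t) * idop D X \<sigma> \<tau>" for \<sigma> \<tau>
    unfolding K_def Lq_def component_plus component_uminus component_scaleR component_one[OF D] ..
  have Ks: "selfadj D X K"
    unfolding selfadj_def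
  proof (intro ballI)
    fix \<sigma> \<tau> assume st: "\<sigma> \<in> conf D X" "\<tau> \<in> conf D X"
    have "(\<lambda>n. cnj (oppow D X R (Suc n) \<tau> \<sigma> / of_nat (Suc n))) sums cnj (component l D X \<tau> \<sigma>)"
      using cl by (simp only: sums_cnj)
    moreover have "cnj (oppow D X R (Suc n) \<tau> \<sigma> / of_nat (Suc n)) = oppow D X R (Suc n) \<sigma> \<tau> / of_nat (Suc n)" for n
      using selfadjD[OF selfadj_oppow[OF D Rs] st, of "Suc n"] by (simp del: of_nat_Suc oppow.simps)
    ultimately have "(\<lambda>n. oppow D X R (Suc n) \<sigma> \<tau> / of_nat (Suc n)) sums cnj (component l D X \<tau> \<sigma>)"
      by (simp only:)
    with cl[of \<sigma> \<tau>] have "component l D X \<sigma> \<tau> = cnj (component l D X \<tau> \<sigma>)"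
      by (rule sums_unique2)
    then show "K \<sigma> \<tau> = cnj (K \<tau> \<sigma>)" unfolding K using st by (simp add: idop_def)
  qed
  have Kc: "canon D X K" unfolding K_def by (rule component_canon)
  have Ke: "mexp D X K = M"
  proof -
    have "mexp D X K = (\<lambda>\<sigma> \<tau>. complex_of_real (exp (- ln t)) * mexp D X (component (- l) D X) \<sigma> \<tau>)"
      by (rule mexp_add_scalar[OF D]) (simp add: K component_uminus)
    also have "mexp D X (component (- l) D X) = component (1 - F) D X"
      by (simp add: el flip: component_exp[OF D])
    also have "\<dots> = (\<lambda>\<sigma> \<tau>. complex_of_real t * M \<sigma> \<tau>)"
      by (intro ext) (simp add: component_minus component_one D cF R_def)
    finally show ?thesis using t by (simp add: exp_minus fun_eq_iff)
  qed
  have cLq: "component (exp Lq) D X = M" using Ke by (simp add: component_exp D K_def)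
  show ?thesis
  proof (rule ex1I[of _ K])
    show "canon D X K \<and> selfadj D X K \<and> op_eq D X (mexp D X K) M"
      using Kc Ks Ke by (simp add: op_eq_def)
  next
    fix K' assume K': "canon D X K' \<and> selfadj D X K' \<and> op_eq D X (mexp D X K') M"
    define G where "G = qinj D X K'"
    have cG: "component G D X = K'" unfolding G_def by (rule component_qinj_canon) (use D K' in auto)
    have eK': "mexp D X K' = M"
      by (rule canon_eqI[OF canon_mexp[OF D] M(1)]) (use K' in \<open>auto simp: op_eq_def\<close>)
    have cexpG: "component (exp G) D X = M" by (simp add: component_exp D cG eK')
    have "component (exp G * G) D X = component (G * exp G) D X" by (simp add: exp_times_arg_commute)
    then have MK: "opmult D X M K' = opmult D X K' M" by (simp add: component_times cexpG cG)
    have "opmult D X R K' = opmult D X K' R"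
    proof (rule canon_eqI)
      fix \<sigma> \<tau> assume st: "\<sigma> \<in> conf D X" "\<tau> \<in> conf D X"
      have "opmult D X R K' \<sigma> \<tau> = opmult D X (idop D X) K' \<sigma> \<tau> - complex_of_real t * opmult D X M K' \<sigma> \<tau>"
        using st by (simp add: opmult_def R_def left_diff_distrib sum_subtractf sum_distrib_left mult.assoc)
      moreover have "opmult D X K' R \<sigma> \<tau> = opmult D X K' (idop D X) \<sigma> \<tau> - complex_of_real t * opmult D X K' M \<sigma> \<tau>"
        using st by (simp add: opmult_def R_def right_diff_distrib sum_subtractf sum_distrib_left mult_ac)
      ultimately show "opmult D X R K' \<sigma> \<tau> = opmult D X K' R \<sigma> \<tau>"
        using K' by (simp add: opmult_idop_left opmult_idop_right D MK)
    qed simp_all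
    then have "F * G = G * F" by (simp add: F_def G_def qinj_mult)
    then have "l * G = G * l" unfolding l_def by (rule log_series_commutes[OF F1])
    then have comm: "G * (- Lq) = (- Lq) * G" by (simp add: Lq_def algebra_simps)
    have "exp (G + (- Lq)) = exp G * exp (- Lq)" by (rule exp_add_commuting[OF comm])
    then have "component (exp (G + (- Lq))) D X = component (exp Lq * exp (- Lq)) D X"
      by (simp add: component_times cexpG cLq)
    also have "exp Lq * exp (- Lq) = 1" by (subst exp_add_commuting[symmetric]) simp_all
    finally have 1: "mexp D X (component (G - Lq) D X) = idop D X" by (simp add: component_exp component_one D)
    have GL: "component (G - Lq) D X \<sigma> \<tau> = K' \<sigma> \<tau> - K \<sigma> \<tau>" for \<sigma> \<tau>
      by (simp add: component_minus cG K_def)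
    have "selfadj D X (component (G - Lq) D X)"
      unfolding selfadj_def GL
    proof (intro ballI)
      fix \<sigma> \<tau> assume st: "\<sigma> \<in> conf D X" "\<tau> \<in> conf D X"
      show "K' \<sigma> \<tau> - K \<sigma> \<tau> = cnj (K' \<tau> \<sigma> - K \<tau> \<sigma>)"
        using selfadjD[OF Ks st] selfadjD[OF _ st, of K'] K' by simp
    qed
    then have "component (G - Lq) D X \<sigma> \<tau> = 0" if "\<sigma> \<in> conf D X" "\<tau> \<in> conf D X" for \<sigma> \<tau>
      using selfadj_mexp_eq_idop[OF D _ 1 that] by simp
    then show "K' = K"
      by (intro canon_eqI[of D X]) (use K' Kc in \<open>auto simp: GL\<close>)
  qed
qed

lemma oplog_props:
  fixes X :: "'g::finite site set"
  assumes "D > 0" "finite X" "canon D X M" "selfadj D X M"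
    and "\<delta> > 0" "\<And>v. \<delta> * (vnorm D X v)\<^sup>2 \<le> Re (qform D X M v)"
  shows "canon D X (oplog D X M)" "selfadj D X (oplog D X M)" "mexp D X (oplog D X M) = M"
proof -
  have *: "canon D X (oplog D X M) \<and> selfadj D X (oplog D X M) \<and> op_eq D X (mexp D X (oplog D X M)) M"
    unfolding oplog_def by (rule theI'[OF ex1_log[OF assms]])
  then show "canon D X (oplog D X M)" "selfadj D X (oplog D X M)" by auto
  show "mexp D X (oplog D X M) = M"
    by (rule canon_eqI[OF canon_mexp[OF assms(1,2)] assms(3)]) (use * in \<open>auto simp: op_eq_def\<close>)
qed

section \<open>Operators in Gram form\<close>

lemma qform_gram:
  assumes "\<And>\<sigma> \<tau>. \<sigma> \<in> conf D X \<Longrightarrow> \<tau> \<in> conf D X \<Longrightarrow> P \<sigma> \<tau> = (\<Sum>k\<in>I. x k \<sigma> * cnj (x k \<tau>))"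
  shows "qform D X P v = complex_of_real (\<Sum>k\<in>I. (cmod (\<Sum>\<sigma>\<in>conf D X. cnj (x k \<sigma>) * v \<sigma>))\<^sup>2)"
proof -
  have "qform D X P v = (\<Sum>\<sigma>\<in>conf D X. \<Sum>\<tau>\<in>conf D X. \<Sum>k\<in>I. (cnj (v \<sigma>) * x k \<sigma>) * (cnj (x k \<tau>) * v \<tau>))"
    unfolding qform_def opapply_def sum_distrib_left
    by (intro sum.cong refl) (simp add: assms sum_distrib_left sum_distrib_right mult_ac)
  also have "\<dots> = (\<Sum>\<sigma>\<in>conf D X. \<Sum>k\<in>I. \<Sum>\<tau>\<in>conf D X. (cnj (v \<sigma>) * x k \<sigma>) * (cnj (x k \<tau>) * v \<tau>))"
    by (intro sum.cong refl sum.swap)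
  also have "\<dots> = (\<Sum>k\<in>I. \<Sum>\<sigma>\<in>conf D X. \<Sum>\<tau>\<in>conf D X. (cnj (v \<sigma>) * x k \<sigma>) * (cnj (x k \<tau>) * v \<tau>))"
    by (rule sum.swap)
  also have "\<dots> = (\<Sum>k\<in>I. complex_of_real ((cmod (\<Sum>\<sigma>\<in>conf D X. cnj (x k \<sigma>) * v \<sigma>))\<^sup>2))"
  proof (rule sum.cong[OF refl])
    fix k
    have "(\<Sum>\<sigma>\<in>conf D X. \<Sum>\<tau>\<in>conf D X. (cnj (v \<sigma>) * x k \<sigma>) * (cnj (x k \<tau>) * v \<tau>))
        = cnj (\<Sum>\<sigma>\<in>conf D X. cnj (x k \<sigma>) * v \<sigma>) * (\<Sum>\<sigma>\<in>conf D X. cnj (x k \<sigma>) * v \<sigma>)"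
      unfolding cnj_sum sum_product by (intro sum.cong refl) (simp add: mult_ac)
    then show "(\<Sum>\<sigma>\<in>conf D X. \<Sum>\<tau>\<in>conf D X. (cnj (v \<sigma>) * x k \<sigma>) * (cnj (x k \<tau>) * v \<tau>))
        = complex_of_real ((cmod (\<Sum>\<sigma>\<in>conf D X. cnj (x k \<sigma>) * v \<sigma>))\<^sup>2)"
      by (simp only: complex_norm_square mult.commute)
  qed
  finally show ?thesis by simp
qed

lemma optrace_gram:
  assumes "\<And>\<sigma> \<tau>. \<sigma> \<in> conf D X \<Longrightarrow> \<tau> \<in> conf D X \<Longrightarrow> P \<sigma> \<tau> = (\<Sum>k\<in>I. x k \<sigma> * cnj (x k \<tau>))"
  shows "optrace D X P = complex_of_real (\<Sum>k\<in>I. (vnorm D X (x k))\<^sup>2)"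
proof -
  have "optrace D X P = (\<Sum>\<sigma>\<in>conf D X. \<Sum>k\<in>I. complex_of_real ((cmod (x k \<sigma>))\<^sup>2))"
    unfolding optrace_def by (intro sum.cong refl) (simp only: assms complex_norm_square)
  also have "\<dots> = (\<Sum>k\<in>I. \<Sum>\<sigma>\<in>conf D X. complex_of_real ((cmod (x k \<sigma>))\<^sup>2))"
    by (rule sum.swap)
  finally show ?thesis by (simp add: vnorm_def sum_nonneg)
qed

text \<open>A trace-norm bound without spectral theory: for \<open>P\<close> in Gram form the trace
  is a sum of expectations of \<open>V\<close> in the vectors \<open>x k\<close>, each controlled by
  Cauchy-Schwarz, and the squared norms of the \<open>x k\<close> sum to the trace of
  \<open>P\<close>.\<close>

lemma cmod_optrace_mult_gram_le:
  assumes "finite X"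
    and P: "\<And>\<sigma> \<tau>. \<sigma> \<in> conf D X \<Longrightarrow> \<tau> \<in> conf D X \<Longrightarrow> P \<sigma> \<tau> = (\<Sum>k\<in>I. x k \<sigma> * cnj (x k \<tau>))"
  shows "cmod (optrace D X (opmult D X V P)) \<le> opnorm D X V * Re (optrace D X P)"
proof -
  have "optrace D X (opmult D X V P)
      = (\<Sum>\<sigma>\<in>conf D X. \<Sum>\<rho>\<in>conf D X. \<Sum>k\<in>I. cnj (x k \<sigma>) * (V \<sigma> \<rho> * x k \<rho>))"
    unfolding optrace_def opmult_def
    by (auto intro!: sum.cong simp: P sum_distrib_left mult_ac)
  also have "\<dots> = (\<Sum>\<sigma>\<in>conf D X. \<Sum>k\<in>I. \<Sum>\<rho>\<in>conf D X. cnj (x k \<sigma>) * (V \<sigma> \<rho> * x k \<rho>))"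
    by (intro sum.cong refl sum.swap)
  also have "\<dots> = (\<Sum>k\<in>I. \<Sum>\<sigma>\<in>conf D X. cnj (x k \<sigma>) * opapply D X V (x k) \<sigma>)"
    unfolding opapply_def sum_distrib_left by (rule sum.swap)
  finally have "cmod (optrace D X (opmult D X V P))
      \<le> (\<Sum>k\<in>I. cmod (\<Sum>\<sigma>\<in>conf D X. cnj (x k \<sigma>) * opapply D X V (x k) \<sigma>))"
    by (simp add: norm_sum)
  also have "\<dots> \<le> (\<Sum>k\<in>I. opnorm D X V * (vnorm D X (x k))\<^sup>2)"
  proof (rule sum_mono)
    fix k
    have "cmod (\<Sum>\<sigma>\<in>conf D X. cnj (x k \<sigma>) * opapply D X V (x k) \<sigma>)
        \<le> (\<Sum>\<sigma>\<in>conf D X. \<bar>cmod (x k \<sigma>)\<bar> * \<bar>cmod (opapply D X V (x k) \<sigma>)\<bar>)"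
      by (rule order_trans[OF norm_sum]) (simp add: norm_mult)
    also have "\<dots> \<le> vnorm D X (x k) * vnorm D X (opapply D X V (x k))"
      unfolding vnorm_eq_L2_set by (rule L2_set_mult_ineq)
    also have "\<dots> \<le> vnorm D X (x k) * (opnorm D X V * vnorm D X (x k))"
      by (intro mult_left_mono vnorm_opapply_le assms) simp
    finally show "cmod (\<Sum>\<sigma>\<in>conf D X. cnj (x k \<sigma>) * opapply D X V (x k) \<sigma>) \<le> opnorm D X V * (vnorm D X (x k))\<^sup>2"
      by (simp add: power2_eq_square mult_ac)
  qed
  also have "\<dots> = opnorm D X V * Re (optrace D X P)"
    by (simp add: optrace_gram[OF P] sum_distrib_left)
  finally show ?thesis .
qed

section \<open>Decay of interactions across the boundary\<close>

text \<open>Walk from \<open>x\<close> towards \<open>c\<close> by unit steps in a single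
  coordinate, by induction on the l1 distance. The last site before the walk leaves \<open>A\<close>
  is a boundary site, and the walk never leaves the coordinate box spanned by \<open>x\<close> and
  \<open>c\<close>.\<close>

lemma boundary_in_box:
  fixes x c :: "'g::finite site"
  assumes "x \<in> A" "c \<notin> A"
  shows "\<exists>y\<in>bdry A. \<forall>i. min (x $ i) (c $ i) \<le> y $ i \<and> y $ i \<le> max (x $ i) (c $ i)"
  using assms
proof (induction "nat (\<Sum>i\<in>UNIV. \<bar>c $ i - x $ i\<bar>)" arbitrary: x rule: less_induct)
  case less
  from less.prems have "x \<noteq> c" by auto
  then obtain j where j: "x $ j \<noteq> c $ j" by (auto simp: vec_eq_iff)
  define x' where "x' = (\<chi> i. if i = j then x $ j + sgn (c $ j - x $ j) else x $ i)"
  have x'i: "x' $ i = (if i = j then x $ j + sgn (c $ j - x $ j) else x $ i)" for i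
    by (simp add: x'_def)
  have box: "min (x $ i) (c $ i) \<le> x' $ i \<and> x' $ i \<le> max (x $ i) (c $ i)" for i
    using j by (auto simp: x'i sgn_if)
  show ?case
  proof (cases "x' \<in> A")
    case True
    have "(\<Sum>i\<in>UNIV. \<bar>c $ i - x' $ i\<bar>) < (\<Sum>i\<in>UNIV. \<bar>c $ i - x $ i\<bar>)"
    proof (rule sum_strict_mono_ex1)
      show "\<forall>i\<in>UNIV. \<bar>c $ i - x' $ i\<bar> \<le> \<bar>c $ i - x $ i\<bar>" using j by (auto simp: x'i sgn_if)
      show "\<exists>i\<in>UNIV. \<bar>c $ i - x' $ i\<bar> < \<bar>c $ i - x $ i\<bar>"
        using j by (intro bexI[of _ j]) (auto simp: x'i sgn_if)
    qed simp
    moreover have "(\<Sum>i\<in>UNIV. \<bar>c $ i - x' $ i\<bar>) \<ge> 0" by (simp add: sum_nonneg)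
    ultimately have "nat (\<Sum>i\<in>UNIV. \<bar>c $ i - x' $ i\<bar>) < nat (\<Sum>i\<in>UNIV. \<bar>c $ i - x $ i\<bar>)" by linarith
    from less.hyps[OF this True less.prems(2)] obtain y where y: "y \<in> bdry A"
      "\<And>i. min (x' $ i) (c $ i) \<le> y $ i \<and> y $ i \<le> max (x' $ i) (c $ i)" by blast
    have "min (x $ i) (c $ i) \<le> y $ i \<and> y $ i \<le> max (x $ i) (c $ i)" for i
      using y(2)[of i] box[of i] by linarith
    then show ?thesis using y(1) by blast
  next
    case False
    have "rv x' - rv x = real_of_int (sgn (c $ j - x $ j)) *\<^sub>R axis j 1"
      by (auto simp: rv_def vec_eq_iff x'i axis_def)
    then have "dist (rv x) (rv x') \<le> 1"
      using j by (simp add: dist_norm norm_minus_commute[of "rv x"] norm_axis_1 sgn_if)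
    then have "x \<in> bdry A" using False less.prems by (auto simp: bdry_def)
    then show ?thesis by (intro bexI[of _ x]) auto
  qed
qed

text \<open>A site of the box is in every coordinate at most as far from \<open>x\<close> as
  \<open>c\<close> is, which passes to the Euclidean norm.\<close>

lemma ex_boundary_closer:
  fixes x c :: "'g::finite site"
  assumes "x \<in> A" "c \<notin> A"
  obtains y where "y \<in> bdry A" "dist (rv x) (rv y) \<le> dist (rv x) (rv c)"
proof -
  obtain y where y: "y \<in> bdry A" "\<And>i. min (x $ i) (c $ i) \<le> y $ i \<and> y $ i \<le> max (x $ i) (c $ i)"
    using boundary_in_box[OF assms] by blast
  have "norm (rv x - rv y) \<le> norm (rv x - rv c)"
  proof (rule norm_le_componentwise_cart)
    fix i
    have "\<bar>x $ i - y $ i\<bar> \<le> \<bar>x $ i - c $ i\<bar>" using y(2)[of i] by linarith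
    then have "real_of_int \<bar>x $ i - y $ i\<bar> \<le> real_of_int \<bar>x $ i - c $ i\<bar>" by (simp only: of_int_le_iff)
    then show "norm ((rv x - rv y) $ i) \<le> norm ((rv x - rv c) $ i)" by (simp add: rv_def)
  qed
  then show ?thesis using that[OF y(1)] by (simp add: dist_norm)
qed

text \<open>The nonnegative and the nonpositive integers each give a geometric series; counting 0
  twice is harmless for an upper bound.\<close>

lemma sum_exp_int_le:
  fixes a :: real
  assumes "a > 0"
  shows "(\<Sum>k\<in>{- int N..int N}. exp (- a * \<bar>real_of_int k\<bar>)) \<le> 2 / (1 - exp (- a))"
proof -
  have e1: "exp (- a) < 1" using assms by simp
  have geo: "(\<Sum>k\<le>N. exp (- a) ^ k) \<le> 1 / (1 - exp (- a))"
    using sum_le_suminf[OF summable_geometric[of "exp (- a)"], of "{..N}"] e1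
    by (simp add: suminf_geometric)
  have "(\<Sum>k\<in>{- int N..int N}. exp (- a * \<bar>real_of_int k\<bar>))
      \<le> (\<Sum>k\<in>int ` {..N} \<union> (\<lambda>k. - int k) ` {..N}. exp (- a * \<bar>real_of_int k\<bar>))"
  proof (rule sum_mono2)
    show "{- int N..int N} \<subseteq> int ` {..N} \<union> (\<lambda>k. - int k) ` {..N}"
    proof
      fix k assume k: "k \<in> {- int N..int N}"
      show "k \<in> int ` {..N} \<union> (\<lambda>k. - int k) ` {..N}"
      proof (cases "k \<ge> 0")
        case True
        then show ?thesis using k by (intro UnI1 image_eqI[of _ _ "nat k"]) auto
      next
        case False
        then show ?thesis using k by (intro UnI2 image_eqI[of _ _ "nat (- k)"]) auto
      qed
    qed
  qed auto
  also have "\<dots> \<le> (\<Sum>k\<in>int ` {..N}. exp (- a * \<bar>real_of_int k\<bar>)) + (\<Sum>k\<in>(\<lambda>k. - int k) ` {..N}. exp (- a * \<bar>real_of_int k\<bar>))"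
    using sum.union_inter[of "int ` {..N}" "(\<lambda>k. - int k) ` {..N}" "\<lambda>k. exp (- a * \<bar>real_of_int k\<bar>)"]
      sum_nonneg[of "int ` {..N} \<inter> (\<lambda>k. - int k) ` {..N}" "\<lambda>k. exp (- a * \<bar>real_of_int k\<bar>)"]
    by simp
  also have "\<dots> = (\<Sum>k\<le>N. exp (- a) ^ k) + (\<Sum>k\<le>N. exp (- a) ^ k)"
    by (subst (1 2) sum.reindex) (auto simp: inj_on_def exp_of_nat_mult[symmetric] mult.commute)
  also have "\<dots> \<le> 2 / (1 - exp (- a))" using geo by simp
  finally show ?thesis .
qed

text \<open>A bound for the sum of \<open>exp (- a * norm x)\<close> over the lattice: the Euclidean
  norm is at least the average of the coordinate moduli, so the sum is dominated by a product of
  one-dimensional sums of rate \<open>a / CARD('g)\<close>.\<close>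

definition lattice_const :: "'g::finite itself \<Rightarrow> real \<Rightarrow> real" where
  "lattice_const _ a = (2 / (1 - exp (- (a / CARD('g))))) ^ CARD('g)"

lemma lattice_const_pos: "a > 0 \<Longrightarrow> lattice_const TYPE('g::finite) a > 0"
  by (simp add: lattice_const_def)

lemma sum_exp_dist_le:
  fixes y :: "'g::finite site"
  assumes "a > 0" "finite S"
  shows "(\<Sum>x\<in>S. exp (- a * dist (rv x) (rv y))) \<le> lattice_const TYPE('g) a"
proof -
  define a' where "a' = a / CARD('g)"
  have a': "a' > 0" using assms(1) by (simp add: a'_def)
  \<comment> \<open>A half-width large enough for the cube around \<open>y\<close> to contain
    \<open>S\<close>; the final bound does not depend on it.\<close>
  define N where "N = nat (\<Sum>x\<in>S. \<Sum>i\<in>UNIV. \<bar>x $ i - y $ i\<bar>)"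
  define T where "T = {- int N..int N}"
  define \<phi> where "\<phi> x = (\<lambda>i. x $ i - y $ i)" for x :: "'g site"
  have inj: "inj_on \<phi> S" by (auto simp: inj_on_def \<phi>_def fun_eq_iff vec_eq_iff)
  have le: "exp (- a * dist (rv x) (rv y)) \<le> (\<Prod>i\<in>UNIV. exp (- a' * \<bar>real_of_int (\<phi> x i)\<bar>))" for x
  proof -
    have c: "\<bar>real_of_int (\<phi> x i)\<bar> \<le> dist (rv x) (rv y)" for i
      using component_le_norm_cart[of "rv x - rv y" i] by (simp add: dist_norm rv_def \<phi>_def)
    have "(\<Sum>i\<in>(UNIV::'g set). \<bar>real_of_int (\<phi> x i)\<bar>) \<le> CARD('g) * dist (rv x) (rv y)"
      using sum_bounded_above[of UNIV "\<lambda>i. \<bar>real_of_int (\<phi> x i)\<bar>"] c by simp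
    then have "a' * (\<Sum>i\<in>(UNIV::'g set). \<bar>real_of_int (\<phi> x i)\<bar>) \<le> a' * (CARD('g) * dist (rv x) (rv y))"
      using a' by (intro mult_left_mono) auto
    also have "\<dots> = a * dist (rv x) (rv y)" by (simp add: a'_def)
    finally have "- a * dist (rv x) (rv y) \<le> (\<Sum>i\<in>UNIV. - a' * \<bar>real_of_int (\<phi> x i)\<bar>)"
      by (simp add: sum_distrib_left sum_negf)
    then show ?thesis by (simp flip: exp_sum)
  qed
  have sub: "\<phi> ` S \<subseteq> (\<Pi>\<^sub>E i\<in>UNIV. T)"
  proof -
    have "\<phi> x i \<in> T" if "x \<in> S" for x i
    proof -
      have "\<bar>\<phi> x i\<bar> \<le> (\<Sum>i\<in>UNIV. \<bar>x $ i - y $ i\<bar>)"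
        unfolding \<phi>_def by (rule member_le_sum) auto
      also have "\<dots> \<le> (\<Sum>x\<in>S. \<Sum>i\<in>UNIV. \<bar>x $ i - y $ i\<bar>)"
        using that assms by (intro member_le_sum[of x S]) (auto intro: sum_nonneg)
      finally show ?thesis by (auto simp: T_def N_def)
    qed
    then show ?thesis by auto
  qed
  have "(\<Sum>x\<in>S. exp (- a * dist (rv x) (rv y))) \<le> (\<Sum>x\<in>S. \<Prod>i\<in>UNIV. exp (- a' * \<bar>real_of_int (\<phi> x i)\<bar>))"
    by (rule sum_mono[OF le])
  also have "\<dots> = (\<Sum>z\<in>\<phi> ` S. \<Prod>i\<in>UNIV. exp (- a' * \<bar>real_of_int (z i)\<bar>))"
    by (simp add: sum.reindex[OF inj])
  also have "\<dots> \<le> (\<Sum>z\<in>(\<Pi>\<^sub>E i\<in>(UNIV::'g set). T). \<Prod>i\<in>UNIV. exp (- a' * \<bar>real_of_int (z i)\<bar>))"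
  proof (rule sum_mono2)
    show "finite (\<Pi>\<^sub>E i\<in>(UNIV::'g set). T)" by (rule finite_PiE) (auto simp: T_def)
  qed (use sub in \<open>auto intro!: prod_nonneg\<close>)
  also have "\<dots> = (\<Prod>i\<in>(UNIV::'g set). \<Sum>k\<in>T. exp (- a' * \<bar>real_of_int k\<bar>))"
    by (rule prod_sum_PiE[symmetric]) (auto simp: T_def)
  also have "\<dots> \<le> (\<Prod>i\<in>(UNIV::'g set). 2 / (1 - exp (- a')))"
    unfolding T_def by (intro prod_mono conjI sum_exp_int_le a' sum_nonneg) auto
  finally show ?thesis by (simp add: lattice_const_def a'_def)
qed

text \<open>If \<open>X\<close> meets \<open>A\<close> at \<open>x\<close> and also meets
  \<open>C\<close>, its diameter is at least the distance of \<open>A\<close> and \<open>C\<close>,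
  and at least the distance from \<open>x\<close> to some boundary site. Each bound receives half of
  \<open>mu\<close>. Exchanging the sums over \<open>A\<close> and its boundary then leaves one
  \<open>lattice_const\<close> per boundary site.\<close>

lemma decay_across_boundary:
  fixes Psi :: "'g::finite site set \<Rightarrow> 'g op"
  assumes decay: "decay_bound D Psi lam mu Delta" and "mu > 0"
    and Lam: "finite Lam" "A \<subseteq> Lam" and AC: "A \<inter> C = {}"
  shows "(\<Sum>X\<in>{X. X \<subseteq> Lam \<and> X \<inter> A \<noteq> {} \<and> X \<inter> C \<noteq> {}}. opnorm D X (Psi X) * exp (lam * card X))
    \<le> Delta * lattice_const TYPE('g) (mu / 2) * card (bdry A) * exp (- (mu / 2) * sdist A C)"
proof -
  define F where "F X = opnorm D X (Psi X) * exp (lam * card X + mu * sdiam X)" for X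
  define I where "I = {X. X \<subseteq> Lam \<and> X \<inter> C \<noteq> {}}"
  define d where "d = sdist A C"
  have finA: "finite A" using Lam finite_subset by blast
  have finB: "finite (bdry A)" using finA by (auto simp: bdry_def)
  have finI: "finite I" using Lam by (auto simp: I_def)
  have fin: "finite X" if "X \<in> I" for X using that Lam finite_subset by (auto simp: I_def)
  define E where "E x = (\<Sum>y\<in>bdry A. exp (- (mu / 2) * dist (rv x) (rv y)))" for x
  have E0: "E x \<ge> 0" for x by (simp add: E_def sum_nonneg)
  have Fx: "(\<Sum>X\<in>{X\<in>I. x \<in> X}. F X) \<le> Delta" for x
  proof -
    have s: "F summable_on {X. finite X \<and> x \<in> X}" "infsum F {X. finite X \<and> x \<in> X} \<le> Delta"
      using decay unfolding decay_bound_def F_def by auto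
    have "(\<Sum>X\<in>{X\<in>I. x \<in> X}. F X) \<le> infsum F {X. finite X \<and> x \<in> X}"
      by (rule finite_sum_le_infsum[OF s(1)]) (use finI fin in \<open>auto simp: F_def opnorm_nonneg\<close>)
    then show ?thesis using s(2) by linarith
  qed
  have ptw: "opnorm D X (Psi X) * exp (lam * card X) \<le> F X * (exp (- (mu / 2) * d) * E x)"
    if X: "X \<in> I" and x: "x \<in> X" "x \<in> A" for X x
  proof -
    obtain c where c: "c \<in> X" "c \<in> C" using X by (auto simp: I_def)
    then have "c \<notin> A" using AC by blast
    then obtain y where y: "y \<in> bdry A" "dist (rv x) (rv y) \<le> dist (rv x) (rv c)"
      using ex_boundary_closer x by metis
    have "d \<le> dist (rv x) (rv c)"
      unfolding d_def sdist_def using x c by (intro setdist_le_dist) auto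
    moreover have "dist (rv x) (rv c) \<le> sdiam X"
      unfolding sdiam_def using x c fin[OF X]
      by (intro diameter_bounded_bound finite_imp_bounded) auto
    ultimately have "d + dist (rv x) (rv y) \<le> 2 * sdiam X" using y(2) by linarith
    then have "mu / 2 * (d + dist (rv x) (rv y)) \<le> mu / 2 * (2 * sdiam X)"
      using \<open>mu > 0\<close> by (intro mult_left_mono) auto
    then have "- (mu * sdiam X) \<le> - (mu / 2) * d + - (mu / 2) * dist (rv x) (rv y)"
      by (simp add: algebra_simps)
    then have "exp (- (mu * sdiam X)) \<le> exp (- (mu / 2) * d) * exp (- (mu / 2) * dist (rv x) (rv y))"
      by (simp flip: exp_add)
    also have "\<dots> \<le> exp (- (mu / 2) * d) * E x"
      unfolding E_def using y(1) finB
      by (intro mult_left_mono member_le_sum[of y "bdry A" "\<lambda>y. exp (- (mu / 2) * dist (rv x) (rv y))"]) auto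
    finally have "F X * exp (- (mu * sdiam X)) \<le> F X * (exp (- (mu / 2) * d) * E x)"
      using fin[OF X] by (intro mult_left_mono) (auto simp: F_def opnorm_nonneg)
    moreover have "F X * exp (- (mu * sdiam X)) = opnorm D X (Psi X) * exp (lam * card X)"
      by (simp add: F_def flip: exp_add)
    ultimately show ?thesis by simp
  qed
  have "{X. X \<subseteq> Lam \<and> X \<inter> A \<noteq> {} \<and> X \<inter> C \<noteq> {}} = {X\<in>I. X \<inter> A \<noteq> {}}" by (auto simp: I_def)
  \<comment> \<open>The truncation at 0 is there because \<open>sum_meeting_le\<close> asks for a
    function nonnegative on all sets, while \<open>opnorm_nonneg\<close> covers finite ones.\<close>
  then have "(\<Sum>X\<in>{X. X \<subseteq> Lam \<and> X \<inter> A \<noteq> {} \<and> X \<inter> C \<noteq> {}}. opnorm D X (Psi X) * exp (lam * card X))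
      = (\<Sum>X\<in>{X\<in>I. X \<inter> A \<noteq> {}}. max 0 (opnorm D X (Psi X) * exp (lam * card X)))"
    using fin by (auto intro!: sum.cong simp: max_def opnorm_nonneg)
  also have "\<dots> \<le> (\<Sum>x\<in>A. \<Sum>X\<in>{X\<in>I. x \<in> X}. max 0 (opnorm D X (Psi X) * exp (lam * card X)))"
    using finI finA by (intro sum_meeting_le) auto
  also have "\<dots> \<le> (\<Sum>x\<in>A. \<Sum>X\<in>{X\<in>I. x \<in> X}. F X * (exp (- (mu / 2) * d) * E x))"
    using ptw E0 fin by (intro sum_mono) (auto simp: F_def opnorm_nonneg)
  also have "\<dots> = (\<Sum>x\<in>A. (\<Sum>X\<in>{X\<in>I. x \<in> X}. F X) * (exp (- (mu / 2) * d) * E x))"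
    by (simp add: sum_distrib_right)
  also have "\<dots> \<le> (\<Sum>x\<in>A. Delta * (exp (- (mu / 2) * d) * E x))"
    using Fx E0 by (intro sum_mono mult_right_mono) auto
  also have "\<dots> = Delta * exp (- (mu / 2) * d) * (\<Sum>x\<in>A. E x)"
    by (simp add: sum_distrib_left mult.assoc)
  also have "(\<Sum>x\<in>A. E x) = (\<Sum>y\<in>bdry A. \<Sum>x\<in>A. exp (- (mu / 2) * dist (rv x) (rv y)))"
    unfolding E_def by (rule sum.swap)
  also have "Delta * exp (- (mu / 2) * d) * \<dots>
      \<le> Delta * exp (- (mu / 2) * d) * (card (bdry A) * lattice_const TYPE('g) (mu / 2))"
  proof (rule mult_left_mono)
    show "(\<Sum>y\<in>bdry A. \<Sum>x\<in>A. exp (- (mu / 2) * dist (rv x) (rv y))) \<le> card (bdry A) * lattice_const TYPE('g) (mu / 2)"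
      using \<open>mu > 0\<close> finA by (intro sum_bounded_above sum_exp_dist_le) auto
    \<comment> \<open>The sign of \<open>Delta\<close> is obtained from its role as an upper bound
      of a nonnegative sum, taken at an arbitrary site.\<close>
    have "0 \<le> (\<Sum>X\<in>{X\<in>I. undefined \<in> X}. F X)" using fin by (intro sum_nonneg) (auto simp: F_def opnorm_nonneg)
    then show "0 \<le> Delta * exp (- (mu / 2) * d)" using Fx[of undefined] by simp
  qed
  finally show ?thesis by (simp add: d_def mult_ac)
qed

section \<open>Marginals of Gibbs states\<close>

lemma selfadj_emb:
  assumes "X \<subseteq> Y" "selfadj D X A"
  shows "selfadj D Y (emb D X Y A)"
  unfolding selfadj_def
proof (intro ballI)
  fix \<sigma> \<tau> assume st: "\<sigma> \<in> conf D Y" "\<tau> \<in> conf D Y"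
  have "A (restr X \<sigma>) (restr X \<tau>) = cnj (A (restr X \<tau>) (restr X \<sigma>))"
    by (rule selfadjD[OF assms(2)]) (use st assms(1) restr_in_conf in blast)+
  then show "emb D X Y A \<sigma> \<tau> = cnj (emb D X Y A \<tau> \<sigma>)"
    unfolding emb_def using st by (auto simp: eq_commute)
qed

lemma selfadj_ham:
  assumes "local_interaction D Phi" "finite Lam"
  shows "selfadj D Lam (ham D Phi Lam)"
  unfolding selfadj_def
proof (intro ballI)
  fix \<sigma> \<tau> assume st: "\<sigma> \<in> conf D Lam" "\<tau> \<in> conf D Lam"
  show "ham D Phi Lam \<sigma> \<tau> = cnj (ham D Phi Lam \<tau> \<sigma>)"
    unfolding ham_def cnj_sum
  proof (rule sum.cong[OF refl])
    fix X assume "X \<in> {X. X \<subseteq> Lam \<and> X \<noteq> {}}"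
    then have X: "X \<subseteq> Lam" "selfadj D X (Phi X)"
      using assms finite_subset by (auto simp: local_interaction_def)
    show "emb D X Lam (Phi X) \<sigma> \<tau> = cnj (emb D X Lam (Phi X) \<tau> \<sigma>)"
      by (rule selfadjD[OF selfadj_emb[OF X] st])
  qed
qed

text \<open>\<open>Q\<close> is the exponential with half the inverse temperature. Its
  self-adjointness gives the Gram form of the Boltzmann operator, its invertibility the strict
  positivity.\<close>

lemma bexp_square:
  fixes Lam :: "'g::finite site set"
  assumes "D > 0" "local_interaction D Phi" "finite Lam"
  obtains Q Q' where "selfadj D Lam Q" "bexp D Phi \<beta> Lam = opmult D Lam Q Q"
    "opmult D Lam Q Q' = idop D Lam" "opmult D Lam Q' Q = idop D Lam"
proof -
  define H where "H = (\<lambda>\<sigma> \<tau>. complex_of_real (- \<beta> / 2) * ham D Phi Lam \<sigma> \<tau>)"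
  define H' where "H' = (\<lambda>\<sigma> \<tau>. - H \<sigma> \<tau>)"
  have "selfadj D Lam H"
    unfolding selfadj_def
  proof (intro ballI)
    fix \<sigma> \<tau> assume "\<sigma> \<in> conf D Lam" "\<tau> \<in> conf D Lam"
    from selfadjD[OF selfadj_ham[OF assms(2,3)] this] show "H \<sigma> \<tau> = cnj (H \<tau> \<sigma>)" by (simp add: H_def)
  qed
  then have 1: "selfadj D Lam (mexp D Lam H)" by (rule selfadj_mexp[OF assms(1,3)])
  have 2: "bexp D Phi \<beta> Lam = opmult D Lam (mexp D Lam H) (mexp D Lam H)"
    unfolding bexp_def
    by (rule mexp_add_commuting[OF assms(1,3) refl]) (simp add: opscale_def H_def field_simps)
  show ?thesis
    by (rule that[OF 1 2 mexp_inverse[OF assms(1,3), of H' H]]) (simp_all add: H'_def)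
qed

lemma optrace_ptrace:
  assumes "L \<subseteq> Lam"
  shows "optrace D L (ptrace D Lam L A) = optrace D Lam A"
  unfolding optrace_def sum_conf_split[OF assms]
  using assms by (intro sum.cong refl) (simp add: ptrace_def Int_absorb1 join_def)

text \<open>The Gram vectors are columns of \<open>Q\<close> restricted to a fixed configuration
  outside \<open>L\<close>. For the lower bound the zero configuration alone suffices: its part of
  the quadratic form is the squared norm of \<open>Q\<close> applied to \<open>vext L Lam v\<close>,
  bounded below through the inverse of \<open>Q\<close>.\<close>

lemma ptrace_bexp_gram:
  fixes Lam :: "'g::finite site set"
  assumes "D > 0" "local_interaction D Phi" "finite Lam" "L \<subseteq> Lam"
  obtains I :: "('g cfg \<times> 'g cfg) set" and x \<delta>
    where "\<And>\<sigma> \<tau>. \<sigma> \<in> conf D L \<Longrightarrow> \<tau> \<in> conf D L \<Longrightarrow>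
        ptrace D Lam L (bexp D Phi \<beta> Lam) \<sigma> \<tau> = (\<Sum>k\<in>I. x k \<sigma> * cnj (x k \<tau>))"
      and "\<delta> > 0" "\<And>v. \<delta> * (vnorm D L v)\<^sup>2 \<le> Re (qform D L (ptrace D Lam L (bexp D Phi \<beta> Lam)) v)"
proof -
  obtain Q Q' where Q: "selfadj D Lam Q" "bexp D Phi \<beta> Lam = opmult D Lam Q Q"
    "opmult D Lam Q' Q = idop D Lam"
    using bexp_square[OF assms(1-3)] by metis
  define I where "I = conf D (Lam - L) \<times> conf D Lam"
  define x where "x = (\<lambda>(\<rho>, \<omega>) \<sigma>. Q (join L \<sigma> \<rho>) \<omega>)"
  have gram: "ptrace D Lam L (bexp D Phi \<beta> Lam) \<sigma> \<tau> = (\<Sum>k\<in>I. x k \<sigma> * cnj (x k \<tau>))"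
    if st: "\<sigma> \<in> conf D L" "\<tau> \<in> conf D L" for \<sigma> \<tau>
  proof -
    have "ptrace D Lam L (bexp D Phi \<beta> Lam) \<sigma> \<tau>
        = (\<Sum>\<rho>\<in>conf D (Lam - L). opmult D Lam Q Q (join L \<sigma> \<rho>) (join L \<tau> \<rho>))"
      using st assms(4) by (simp add: ptrace_def Int_absorb1 Q(2) join_def)
    also have "\<dots> = (\<Sum>\<rho>\<in>conf D (Lam - L). \<Sum>\<omega>\<in>conf D Lam. Q (join L \<sigma> \<rho>) \<omega> * cnj (Q (join L \<tau> \<rho>) \<omega>))"
    proof (rule sum.cong[OF refl])
      fix \<rho> assume "\<rho> \<in> conf D (Lam - L)"
      then have j: "join L \<sigma> \<rho> \<in> conf D Lam" "join L \<tau> \<rho> \<in> conf D Lam"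
        using st assms(4) by (auto intro: join_in_conf)
      have "Q \<omega> (join L \<tau> \<rho>) = cnj (Q (join L \<tau> \<rho>) \<omega>)" if "\<omega> \<in> conf D Lam" for \<omega>
        by (rule selfadjD[OF Q(1) that j(2)])
      then show "opmult D Lam Q Q (join L \<sigma> \<rho>) (join L \<tau> \<rho>)
          = (\<Sum>\<omega>\<in>conf D Lam. Q (join L \<sigma> \<rho>) \<omega> * cnj (Q (join L \<tau> \<rho>) \<omega>))"
        using j by (simp add: opmult_def)
    qed
    finally show ?thesis by (simp add: I_def x_def sum.cartesian_product case_prod_beta)
  qed
  define N where "N = opnorm D Lam Q' + 1"
  have N: "N > 0" "opnorm D Lam Q' \<le> N" using opnorm_nonneg[OF assms(3), of D Q'] by (auto simp: N_def)
  show ?thesis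
  proof (rule that[OF gram])
    show "1 / N\<^sup>2 > 0" using N by simp
    fix v
    define V where "V = vext L Lam v"
    have z: "(\<lambda>_. 0) \<in> conf D (Lam - L)" by (rule zero_in_conf[OF assms(1)])
    have "vnorm D L v = vnorm D Lam V" by (simp add: V_def vnorm_vext assms)
    also have "\<dots> = vnorm D Lam (opapply D Lam Q' (opapply D Lam Q V))"
      by (rule vnorm_cong) (simp add: opapply_opmult[symmetric] Q(3) opapply_idop assms)
    also have "\<dots> \<le> opnorm D Lam Q' * vnorm D Lam (opapply D Lam Q V)"
      by (rule vnorm_opapply_le[OF assms(3)])
    also have "\<dots> \<le> N * vnorm D Lam (opapply D Lam Q V)"
      using N by (intro mult_right_mono) auto
    finally have "(vnorm D L v)\<^sup>2 \<le> (N * vnorm D Lam (opapply D Lam Q V))\<^sup>2"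
      by (intro power_mono) auto
    then have "1 / N\<^sup>2 * (vnorm D L v)\<^sup>2 \<le> (vnorm D Lam (opapply D Lam Q V))\<^sup>2"
      using N by (simp add: power_mult_distrib field_simps)
    also have "\<dots> = (\<Sum>\<omega>\<in>conf D Lam. (cmod (\<Sum>\<sigma>\<in>conf D L. cnj (x (\<lambda>_. 0, \<omega>) \<sigma>) * v \<sigma>))\<^sup>2)"
    proof -
      have "opapply D Lam Q V \<omega> = (\<Sum>\<sigma>\<in>conf D L. cnj (x (\<lambda>_. 0, \<omega>) \<sigma>) * v \<sigma>)" if "\<omega> \<in> conf D Lam" for \<omega>
      proof -
        have "Q \<omega> (join L \<sigma> (\<lambda>_. 0)) = cnj (Q (join L \<sigma> (\<lambda>_. 0)) \<omega>)" if s: "\<sigma> \<in> conf D L" for \<sigma>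
          by (rule selfadjD[OF Q(1) \<open>\<omega> \<in> conf D Lam\<close> join_in_conf[OF assms(4) s z]])
        then show ?thesis by (simp add: V_def opapply_vext assms x_def)
      qed
      then show ?thesis by (simp add: vnorm_def sum_nonneg)
    qed
    also have "\<dots> = (\<Sum>k\<in>(\<lambda>\<omega>. (\<lambda>_. 0, \<omega>)) ` conf D Lam. (cmod (\<Sum>\<sigma>\<in>conf D L. cnj (x k \<sigma>) * v \<sigma>))\<^sup>2)"
      by (subst sum.reindex) (auto simp: inj_on_def)
    also have "\<dots> \<le> (\<Sum>k\<in>I. (cmod (\<Sum>\<sigma>\<in>conf D L. cnj (x k \<sigma>) * v \<sigma>))\<^sup>2)"
      by (rule sum_mono2) (use z assms in \<open>auto simp: I_def finite_conf\<close>)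
    also have "\<dots> = Re (qform D L (ptrace D Lam L (bexp D Phi \<beta> Lam)) v)"
      by (simp add: qform_gram[OF gram] del: of_real_sum)
    finally show "1 / N\<^sup>2 * (vnorm D L v)\<^sup>2 \<le> Re (qform D L (ptrace D Lam L (bexp D Phi \<beta> Lam)) v)" .
  qed
qed

text \<open>The trace of \<open>Q\<close> squared is the sum of all squared moduli of entries of
  \<open>Q\<close>, and an invertible \<open>Q\<close> has no zero row.\<close>

lemma Zpart_pos:
  fixes Lam :: "'g::finite site set"
  assumes "D > 0" "local_interaction D Phi" "finite Lam"
  shows "Zpart D Phi \<beta> Lam > 0" "optrace D Lam (bexp D Phi \<beta> Lam) = complex_of_real (Zpart D Phi \<beta> Lam)"
proof -
  obtain Q Q' where Q: "selfadj D Lam Q" "bexp D Phi \<beta> Lam = opmult D Lam Q Q"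
    "opmult D Lam Q Q' = idop D Lam"
    using bexp_square[OF assms] by metis
  have tr: "optrace D Lam (bexp D Phi \<beta> Lam) = complex_of_real (\<Sum>\<sigma>\<in>conf D Lam. \<Sum>\<tau>\<in>conf D Lam. (cmod (Q \<sigma> \<tau>))\<^sup>2)"
    unfolding optrace_def Q(2) of_real_sum[of _ "conf D Lam"]
    by (rule sum.cong[OF refl]) (simp add: selfadj_opmult_self_diag[OF Q(1)])
  then show "optrace D Lam (bexp D Phi \<beta> Lam) = complex_of_real (Zpart D Phi \<beta> Lam)"
    unfolding Zpart_def by (simp only: Re_complex_of_real)
  have Z: "Zpart D Phi \<beta> Lam = (\<Sum>\<sigma>\<in>conf D Lam. \<Sum>\<tau>\<in>conf D Lam. (cmod (Q \<sigma> \<tau>))\<^sup>2)"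
    unfolding Zpart_def tr by (simp only: Re_complex_of_real)
  have z: "(\<lambda>_. 0) \<in> conf D Lam" by (rule zero_in_conf[OF assms(1)])
  have "\<exists>\<tau>\<in>conf D Lam. Q (\<lambda>_. 0) \<tau> \<noteq> 0"
  proof (rule ccontr)
    assume "\<not> ?thesis"
    then have "opmult D Lam Q Q' (\<lambda>_. 0) (\<lambda>_. 0) = 0" by (simp add: opmult_def)
    then show False using z by (simp add: Q(3) idop_def)
  qed
  then obtain \<tau> where t: "\<tau> \<in> conf D Lam" "Q (\<lambda>_. 0) \<tau> \<noteq> 0" by blast
  have fin: "finite (conf D Lam)" by (rule finite_conf[OF assms(3)])
  have "0 < (cmod (Q (\<lambda>_. 0) \<tau>))\<^sup>2" using t by simp
  also have "\<dots> \<le> (\<Sum>\<tau>\<in>conf D Lam. (cmod (Q (\<lambda>_. 0) \<tau>))\<^sup>2)"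
    using t fin by (intro member_le_sum[of \<tau> _ "\<lambda>\<tau>. (cmod (Q (\<lambda>_. 0) \<tau>))\<^sup>2"]) auto
  also have "\<dots> \<le> Zpart D Phi \<beta> Lam"
    unfolding Z using z fin
    by (intro member_le_sum[of "\<lambda>_. 0" _ "\<lambda>\<sigma>. \<Sum>\<tau>\<in>conf D Lam. (cmod (Q \<sigma> \<tau>))\<^sup>2"]) (auto intro: sum_nonneg)
  finally show "Zpart D Phi \<beta> Lam > 0" .
qed

lemma emb_scale: "emb D X Y (\<lambda>\<sigma> \<tau>. c * A \<sigma> \<tau>) = (\<lambda>\<sigma> \<tau>. c * emb D X Y A \<sigma> \<tau>)"
  by (auto simp: emb_def fun_eq_iff)

lemma emb_diff: "emb D X Y (\<lambda>\<sigma> \<tau>. A \<sigma> \<tau> - B \<sigma> \<tau>) = (\<lambda>\<sigma> \<tau>. emb D X Y A \<sigma> \<tau> - emb D X Y B \<sigma> \<tau>)"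
  by (auto simp: emb_def fun_eq_iff)

lemma optrace_scale: "optrace D X (\<lambda>\<sigma> \<tau>. c * A \<sigma> \<tau>) = c * optrace D X A"
  by (simp add: optrace_def sum_distrib_left)

lemma weak_local_eff_hamD:
  assumes "weak_local_eff_ham D Phi \<beta> PhiH"
  shows "finite X \<Longrightarrow> X \<inter> L' = X \<inter> L \<Longrightarrow> op_eq D X (PhiH L X) (PhiH L' X)"
    and "finite Lam \<Longrightarrow> op_eq D Lam (emb D (Lam \<inter> L) Lam
       (opadd D (Lam \<inter> L)
         (opscale D (Lam \<inter> L) (complex_of_real (- 1 / \<beta>)) (oplog D (Lam \<inter> L) (ptrace D Lam L (bexp D Phi \<beta> Lam))))
         (opscale D (Lam \<inter> L) (complex_of_real (ln (Zpart D Phi \<beta> (Lam - L)) / \<beta>)) (idop D (Lam \<inter> L)))))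
       (\<lambda>\<sigma> \<tau>. \<Sum>X\<in>{X. X \<subseteq> Lam \<and> X \<inter> L \<noteq> {}}. emb D X Lam (PhiH L X) \<sigma> \<tau>)"
proof -
  note W = assms[unfolded weak_local_eff_ham_def, THEN spec, of L, THEN conjunct2, THEN conjunct2]
  show "finite X \<Longrightarrow> X \<inter> L' = X \<inter> L \<Longrightarrow> op_eq D X (PhiH L X) (PhiH L' X)"
    using W[THEN conjunct1, THEN spec, of L', THEN spec, of X] by (simp only: simp_thms)
  show "finite Lam \<Longrightarrow> op_eq D Lam (emb D (Lam \<inter> L) Lam
       (opadd D (Lam \<inter> L)
         (opscale D (Lam \<inter> L) (complex_of_real (- 1 / \<beta>)) (oplog D (Lam \<inter> L) (ptrace D Lam L (bexp D Phi \<beta> Lam))))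
         (opscale D (Lam \<inter> L) (complex_of_real (ln (Zpart D Phi \<beta> (Lam - L)) / \<beta>)) (idop D (Lam \<inter> L)))))
       (\<lambda>\<sigma> \<tau>. \<Sum>X\<in>{X. X \<subseteq> Lam \<and> X \<inter> L \<noteq> {}}. emb D X Lam (PhiH L X) \<sigma> \<tau>)"
    by (rule W[THEN conjunct2, THEN spec, THEN mp])
qed

text \<open>The \<open>Hh L\<close> of the overview. All of them are placed at the same region
  \<open>Lam\<close>, so that those of \<open>A\<close>, \<open>C\<close> and
  \<open>A \<union> C\<close> can be added and exponentiated in one algebra.\<close>

definition eff_ham where
  "eff_ham D PhiH L Lam = (\<Sum>X\<in>{X. X \<subseteq> Lam \<and> X \<inter> L \<noteq> {}}. qinj D Lam (emb D X Lam (PhiH L X)))"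

text \<open>The identity for the effective Hamiltonian determines the logarithm of the partial trace
  up to a scalar, which goes into \<open>\<zeta>\<close>. The generator \<open>G\<close> lives on
  \<open>L\<close>, and only its embedding is a sum of effective terms. The last two conclusions say
  that the marginal is normalised and defines a state of norm 1.\<close>

lemma red_eq_scaled_exp:
  fixes Lam :: "'g::finite site set"
  assumes D: "D > 0" "local_interaction D Phi" and \<beta>: "\<beta> > 0" and W: "weak_local_eff_ham D Phi \<beta> PhiH"
    and Lam: "finite Lam" "L \<subseteq> Lam"
  obtains \<zeta> G where "\<zeta> > 0" "red D Phi \<beta> Lam L = (\<lambda>\<sigma> \<tau>. complex_of_real \<zeta> * mexp D L G \<sigma> \<tau>)"
    "qinj D Lam (emb D L Lam G) = (- \<beta>) *\<^sub>R eff_ham D PhiH L Lam"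
    "optrace D L (red D Phi \<beta> Lam L) = 1"
    "\<And>V. cmod (optrace D L (opmult D L V (red D Phi \<beta> Lam L))) \<le> opnorm D L V"
proof -
  have finL: "finite L" using Lam finite_subset by blast
  have int: "Lam \<inter> L = L" using Lam by blast
  obtain I :: "('g cfg \<times> 'g cfg) set" and x \<delta> where
    gram0: "\<And>\<sigma> \<tau>. \<sigma> \<in> conf D L \<Longrightarrow> \<tau> \<in> conf D L \<Longrightarrow>
      ptrace D Lam L (bexp D Phi \<beta> Lam) \<sigma> \<tau> = (\<Sum>k\<in>I. x k \<sigma> * cnj (x k \<tau>))"
    and \<delta>0: "\<delta> > 0" "\<And>v. \<delta> * (vnorm D L v)\<^sup>2 \<le> Re (qform D L (ptrace D Lam L (bexp D Phi \<beta> Lam)) v)"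
    by (rule ptrace_bexp_gram[OF D Lam, of \<beta>], rule that)
  define M where "M = ptrace D Lam L (bexp D Phi \<beta> Lam)"
  note gram = gram0[folded M_def] and \<delta> = \<delta>0[folded M_def]
  define Z where "Z = Zpart D Phi \<beta> Lam"
  have Z: "Z > 0" "optrace D Lam (bexp D Phi \<beta> Lam) = complex_of_real Z"
    using Zpart_pos[OF D Lam(1)] by (auto simp: Z_def)
  have Mc: "canon D L M" by (auto simp: M_def ptrace_def canon_def int)
  have Ms: "selfadj D L M"
    unfolding selfadj_def by (simp add: gram mult.commute)
  define K where "K = oplog D L M"
  have K: "canon D L K" "mexp D L K = M"
    unfolding K_def using oplog_props[OF D(1) finL Mc Ms \<delta>] by auto
  define c where "c = ln (Zpart D Phi \<beta> (Lam - L))"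
  define J where "J = opadd D L (opscale D L (complex_of_real (- 1 / \<beta>)) K)
     (opscale D L (complex_of_real (c / \<beta>)) (idop D L))"
  \<comment> \<open>Multiplying by \<open>- \<beta>\<close> undoes the factor
    \<open>- 1 / \<beta>\<close> at the logarithm, so \<open>G\<close> is \<open>K\<close> minus
    \<open>c\<close> times the identity.\<close>
  define G where "G = (\<lambda>\<sigma> \<tau>. complex_of_real (- \<beta>) * J \<sigma> \<tau>)"
  have eM: "mexp D L K = (\<lambda>\<sigma> \<tau>. complex_of_real (exp c) * mexp D L G \<sigma> \<tau>)"
  proof (rule mexp_add_scalar[OF D(1) finL])
    fix \<sigma> \<tau> assume "\<sigma> \<in> conf D L" "\<tau> \<in> conf D L"
    then show "K \<sigma> \<tau> = G \<sigma> \<tau> + complex_of_real c * idop D L \<sigma> \<tau>"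
      using \<beta> by (simp add: G_def J_def opadd_def opscale_def field_simps)
  qed
  have redM: "red D Phi \<beta> Lam L = (\<lambda>\<sigma> \<tau>. complex_of_real (1 / Z) * M \<sigma> \<tau>)"
  proof (intro ext)
    fix \<sigma> \<tau>
    show "red D Phi \<beta> Lam L \<sigma> \<tau> = complex_of_real (1 / Z) * M \<sigma> \<tau>"
    proof (cases "\<sigma> \<in> conf D L \<and> \<tau> \<in> conf D L")
      case True
      then have "red D Phi \<beta> Lam L \<sigma> \<tau>
          = (\<Sum>\<rho>\<in>conf D (Lam - L). gibbs D Phi \<beta> Lam (join L \<sigma> \<rho>) (join L \<tau> \<rho>))"
        by (simp add: red_def ptrace_def int join_def)
      also have "\<dots> = (\<Sum>\<rho>\<in>conf D (Lam - L). complex_of_real (1 / Z) * bexp D Phi \<beta> Lam (join L \<sigma> \<rho>) (join L \<tau> \<rho>))"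
        using True Lam by (intro sum.cong refl) (simp add: gibbs_def opscale_def Z_def join_in_conf)
      also have "\<dots> = complex_of_real (1 / Z) * M \<sigma> \<tau>"
        using True by (simp add: M_def ptrace_def int join_def sum_distrib_left)
      finally show ?thesis .
    qed (auto simp: red_def M_def ptrace_def int)
  qed
  have trM: "optrace D L M = complex_of_real Z" by (simp add: M_def optrace_ptrace Lam Z)
  show ?thesis
  proof (rule that[of "exp c / Z" G])
    show "exp c / Z > 0" using Z by simp
    show "red D Phi \<beta> Lam L = (\<lambda>\<sigma> \<tau>. complex_of_real (exp c / Z) * mexp D L G \<sigma> \<tau>)"
      unfolding redM K(2)[symmetric] eM by (simp add: fun_eq_iff)
    show "optrace D L (red D Phi \<beta> Lam L) = 1"
      unfolding redM optrace_scale trM using Z by simp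
    have W': "op_eq D Lam (emb D L Lam J) (\<lambda>\<sigma> \<tau>. \<Sum>X\<in>{X. X \<subseteq> Lam \<and> X \<inter> L \<noteq> {}}. emb D X Lam (PhiH L X) \<sigma> \<tau>)"
      using weak_local_eff_hamD(2)[OF W Lam(1), of L] unfolding J_def K_def M_def c_def int .
    have "qinj D Lam (emb D L Lam G) = (- \<beta>) *\<^sub>R qinj D Lam (emb D L Lam J)"
      unfolding G_def emb_scale
      by (rule qalg_eqI) (simp add: qinj.rep_eq component_scaleR component_uminus)
    also have "qinj D Lam (emb D L Lam J) = eff_ham D PhiH L Lam"
      unfolding eff_ham_def qinj_cong[OF W'] by (rule qinj_sum)
    finally show "qinj D Lam (emb D L Lam G) = (- \<beta>) *\<^sub>R eff_ham D PhiH L Lam" .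
    fix V
    have "opmult D L V (red D Phi \<beta> Lam L) = (\<lambda>\<sigma> \<tau>. complex_of_real (1 / Z) * opmult D L V M \<sigma> \<tau>)"
      unfolding redM opmult_def by (auto simp: sum_distrib_left mult_ac fun_eq_iff sum_divide_distrib)
    then have "optrace D L (opmult D L V (red D Phi \<beta> Lam L)) = complex_of_real (1 / Z) * optrace D L (opmult D L V M)"
      by (simp only: optrace_scale)
    then have "cmod (optrace D L (opmult D L V (red D Phi \<beta> Lam L))) = cmod (optrace D L (opmult D L V M)) / Z"
      using Z by (simp add: norm_divide)
    also have "\<dots> \<le> opnorm D L V * Z / Z"
    proof -
      have "cmod (optrace D L (opmult D L V M)) \<le> opnorm D L V * Re (optrace D L M)"
        by (rule cmod_optrace_mult_gram_le[OF finL]) (rule gram)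
      then show ?thesis using Z by (simp add: trM field_simps)
    qed
    finally show "cmod (optrace D L (opmult D L V (red D Phi \<beta> Lam L))) \<le> opnorm D L V" using Z by simp
  qed
qed

text \<open>\<open>opinv\<close> is described by a right inverse; multiplying by the left inverse
  \<open>B\<close> shows that it is unique.\<close>

lemma opinv_eqI:
  assumes "finite X" "canon D X B" "opmult D X A B = idop D X" "opmult D X B A = idop D X"
  shows "opinv D X A = B"
  unfolding opinv_def
proof (rule the_equality)
  show "canon D X B \<and> op_eq D X (opmult D X A B) (idop D X)" using assms by (simp add: op_eq_def)
  fix B' assume B': "canon D X B' \<and> op_eq D X (opmult D X A B') (idop D X)"
  have "opmult D X A B' = idop D X"
    by (rule canon_eqI) (use B' in \<open>auto simp: op_eq_def\<close>)
  then have "opmult D X (opmult D X B A) B' = opmult D X B (idop D X)" by (simp only: opmult_assoc)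
  then show "B' = B" using assms B' by (simp add: opmult_idop_left opmult_idop_right)
qed

lemma opinv_scaled_mexp:
  fixes X :: "'g::finite site set"
  assumes "D > 0" "finite X" "\<zeta> > 0"
  shows "opinv D X (\<lambda>\<sigma> \<tau>. complex_of_real \<zeta> * mexp D X G \<sigma> \<tau>)
    = (\<lambda>\<sigma> \<tau>. complex_of_real (1 / \<zeta>) * mexp D X (\<lambda>\<sigma> \<tau>. - G \<sigma> \<tau>) \<sigma> \<tau>)"
proof (rule opinv_eqI[OF assms(2)])
  define E where "E = mexp D X G"
  define E' where "E' = mexp D X (\<lambda>\<sigma> \<tau>. - G \<sigma> \<tau>)"
  have E: "opmult D X E E' = idop D X" "opmult D X E' E = idop D X"
    unfolding E_def E'_def by (rule mexp_inverse[OF assms(1,2)], simp)+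
  have sc: "opmult D X (\<lambda>\<sigma> \<tau>. a * A \<sigma> \<tau>) (\<lambda>\<sigma> \<tau>. b * B \<sigma> \<tau>) = (\<lambda>\<sigma> \<tau>. (a * b) * opmult D X A B \<sigma> \<tau>)" for a b A B
    by (auto simp: opmult_def sum_distrib_left mult_ac fun_eq_iff)
  show "canon D X (\<lambda>\<sigma> \<tau>. complex_of_real (1 / \<zeta>) * mexp D X (\<lambda>\<sigma> \<tau>. - G \<sigma> \<tau>) \<sigma> \<tau>)"
    using canon_mexp[OF assms(1,2), of "\<lambda>\<sigma> \<tau>. - G \<sigma> \<tau>"] unfolding canon_def by simp
  show "opmult D X (\<lambda>\<sigma> \<tau>. complex_of_real \<zeta> * mexp D X G \<sigma> \<tau>)
      (\<lambda>\<sigma> \<tau>. complex_of_real (1 / \<zeta>) * mexp D X (\<lambda>\<sigma> \<tau>. - G \<sigma> \<tau>) \<sigma> \<tau>) = idop D X"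
    unfolding sc using E(1) assms(3) by (simp add: E_def E'_def)
  show "opmult D X (\<lambda>\<sigma> \<tau>. complex_of_real (1 / \<zeta>) * mexp D X (\<lambda>\<sigma> \<tau>. - G \<sigma> \<tau>) \<sigma> \<tau>)
      (\<lambda>\<sigma> \<tau>. complex_of_real \<zeta> * mexp D X G \<sigma> \<tau>) = idop D X"
    unfolding sc using E(2) assms(3) by (simp add: E_def E'_def)
qed

text \<open>The diameter weight is at least 1, and a finite part of a nonnegative summable family
  stays below its sum.\<close>

lemma decay_bound_finite_sum:
  fixes Psi :: "'g::finite site set \<Rightarrow> 'g op"
  assumes "decay_bound D Psi lam mu Delta" "mu > 0" "finite Lam" "I \<subseteq> Pow Lam"
  shows "(\<Sum>X\<in>{X\<in>I. x \<in> X}. opnorm D X (Psi X) * exp (lam * card X)) \<le> Delta"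
proof -
  define F where "F X = opnorm D X (Psi X) * exp (lam * card X + mu * sdiam X)" for X
  have fin: "finite X" if "X \<in> I" for X using that assms finite_subset by blast
  have finI: "finite I" using assms by (meson finite_Pow_iff finite_subset)
  have s: "F summable_on {X. finite X \<and> x \<in> X}" "infsum F {X. finite X \<and> x \<in> X} \<le> Delta"
    using assms(1) unfolding decay_bound_def F_def by auto
  have "(\<Sum>X\<in>{X\<in>I. x \<in> X}. opnorm D X (Psi X) * exp (lam * card X)) \<le> (\<Sum>X\<in>{X\<in>I. x \<in> X}. F X)"
  proof (rule sum_mono)
    fix X assume "X \<in> {X\<in>I. x \<in> X}"
    then have X: "finite X" using fin by auto
    have "sdiam X \<ge> 0" unfolding sdiam_def using X by (intro diameter_ge_0 finite_imp_bounded) simp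
    then show "opnorm D X (Psi X) * exp (lam * card X) \<le> F X"
      unfolding F_def using assms(2) X by (intro mult_left_mono opnorm_nonneg) auto
  qed
  also have "\<dots> \<le> infsum F {X. finite X \<and> x \<in> X}"
    by (rule finite_sum_le_infsum[OF s(1)]) (use finI fin in \<open>auto simp: F_def opnorm_nonneg\<close>)
  also have "\<dots> \<le> Delta" by (rule s(2))
  finally show ?thesis .
qed

text \<open>A set meeting only one of \<open>A\<close> and \<open>C\<close> has the same
  intersection with that region and with \<open>A \<union> C\<close>, so its effective terms
  coincide and cancel.\<close>

lemma eff_ham_Un:
  fixes Lam :: "'g::finite site set"
  assumes W: "weak_local_eff_ham D Phi \<beta> PhiH" and Lam: "finite Lam" and AC: "A \<inter> C = {}"
  defines "h \<equiv> \<lambda>L X. qinj D Lam (emb D X Lam (PhiH L X))"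
  shows "eff_ham D PhiH (A \<union> C) Lam
      - (\<Sum>X\<in>{X. X \<subseteq> Lam \<and> X \<inter> A \<noteq> {} \<and> X \<inter> C \<noteq> {}}. h (A \<union> C) X - h A X - h C X)
    = eff_ham D PhiH A Lam + eff_ham D PhiH C Lam"
proof -
  define IA where "IA = {X. X \<subseteq> Lam \<and> X \<inter> A \<noteq> {} \<and> X \<inter> C = {}}"
  define IC where "IC = {X. X \<subseteq> Lam \<and> X \<inter> A = {} \<and> X \<inter> C \<noteq> {}}"
  define J where "J = {X. X \<subseteq> Lam \<and> X \<inter> A \<noteq> {} \<and> X \<inter> C \<noteq> {}}"
  have fin: "finite IA" "finite IC" "finite J"
    using Lam by (auto simp: IA_def IC_def J_def)
  have eq: "h L X = h L' X" if "X \<subseteq> Lam" "X \<inter> L' = X \<inter> L" for L L' X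
  proof -
    have "op_eq D X (PhiH L X) (PhiH L' X)"
      by (rule weak_local_eff_hamD(1)[OF W finite_subset[OF that(1) Lam] that(2)])
    then show ?thesis unfolding h_def using emb_cong[OF that(1)] by metis
  qed
  have split: "(\<Sum>X\<in>P \<union> Q. k X) = (\<Sum>X\<in>P. k X) + (\<Sum>X\<in>Q. k X)"
    if "finite P" "finite Q" "P \<inter> Q = {}" for P Q and k :: "'g site set \<Rightarrow> 'g qalg"
    using that by (rule sum.union_disjoint)
  have "{X. X \<subseteq> Lam \<and> X \<inter> (A \<union> C) \<noteq> {}} = IA \<union> (IC \<union> J)"
    "{X. X \<subseteq> Lam \<and> X \<inter> A \<noteq> {}} = IA \<union> J" "{X. X \<subseteq> Lam \<and> X \<inter> C \<noteq> {}} = IC \<union> J"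
    by (auto simp: IA_def IC_def J_def)
  moreover have "IA \<inter> (IC \<union> J) = {}" "IA \<inter> J = {}" "IC \<inter> J = {}" by (auto simp: IA_def IC_def J_def)
  ultimately have 1: "eff_ham D PhiH (A \<union> C) Lam = sum (h (A \<union> C)) IA + (sum (h (A \<union> C)) IC + sum (h (A \<union> C)) J)"
    "eff_ham D PhiH A Lam = sum (h A) IA + sum (h A) J" "eff_ham D PhiH C Lam = sum (h C) IC + sum (h C) J"
    using fin by (simp_all add: eff_ham_def h_def split)
  have "sum (h (A \<union> C)) IA = sum (h A) IA"
    by (rule sum.cong[OF refl], rule eq) (auto simp: IA_def)
  moreover have "sum (h (A \<union> C)) IC = sum (h C) IC"
    by (rule sum.cong[OF refl], rule eq) (auto simp: IC_def)
  ultimately show ?thesis unfolding 1 J_def[symmetric] by (simp add: sum_subtractf sum.distrib algebra_simps)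
qed

section \<open>Comparison of the joint marginal with the product of the marginals\<close>

text \<open>The generator is the joint effective Hamiltonian. The perturbation at \<open>X\<close>
  combines the terms of three effective interactions, each bounded by
  \<open>decay_across_boundary\<close>, hence the factor 3; the denominator is that of the geometric
  series.\<close>

lemma norm_eff_ham_perturbation:
  fixes Lam :: "'g::finite site set"
  assumes W: "weak_local_eff_ham D Phi \<beta> PhiH"
    and par: "lam > 0" "mu > 0" "Delta > 0" "\<beta> > 0" "2 * Delta * \<beta> < lam"
    and dec: "\<And>L. decay_bound D (PhiH L) lam mu Delta"
    and Lam: "finite Lam" "A \<subseteq> Lam" "C \<subseteq> Lam" "A \<inter> C = {}"
    and omega: "3 * Delta * lattice_const TYPE('g) (mu / 2) * card (bdry A) * exp (- (mu / 2) * sdist A C)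
      / (1 - 2 * Delta * \<beta> / lam) \<le> \<omega>"
  defines "Z \<equiv> eff_ham D PhiH (A \<union> C) Lam" and "Y \<equiv> eff_ham D PhiH A Lam + eff_ham D PhiH C Lam"
  shows "norm (exp (- (\<beta> *\<^sub>R Z)) * exp (\<beta> *\<^sub>R Y) - 1) \<le> exp (\<omega> * \<beta>) - 1"
    and "norm (exp (- (\<beta> *\<^sub>R Y)) * exp (\<beta> *\<^sub>R Z) - 1) \<le> exp (\<omega> * \<beta>) - 1"
proof -
  define h where "h L X = qinj D Lam (emb D X Lam (PhiH L X))" for L X
  define I where "I = {X. X \<subseteq> Lam \<and> X \<inter> (A \<union> C) \<noteq> {}}"
  define J where "J = {X. X \<subseteq> Lam \<and> X \<inter> A \<noteq> {} \<and> X \<inter> C \<noteq> {}}"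
  define w where "w X = h (A \<union> C) X - h A X - h C X" for X
  have sub: "X \<subseteq> Lam" "finite X" if "X \<in> I \<or> X \<in> J" for X
    using that Lam(1) by (auto simp: I_def J_def intro: finite_subset)
  have finIJ: "finite I" "finite J" using Lam(1) by (auto simp: I_def J_def)
  have comm: "h L X * h L' X' = h L' X' * h L X" if "X \<subseteq> Lam" "X' \<subseteq> Lam" "X \<inter> X' = {}" for L L' X X'
    unfolding h_def qinj_mult using emb_commute_disjoint[OF that Lam(1)] by simp
  have nh: "norm (h L X) \<le> opnorm D X (PhiH L X)" if "X \<subseteq> Lam" for L X
    unfolding h_def
    using norm_qinj_le[OF Lam(1), of D "emb D X Lam (PhiH L X)"] opnorm_emb_le[OF that Lam(1), of D "PhiH L X"]
    by linarith
  interpret local_hamiltonian I "h (A \<union> C)" lam Delta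
  proof
    show "finite I" by (rule finIJ)
    show "finite Y" if "Y \<in> I" for Y using sub that by blast
    show "h (A \<union> C) X * h (A \<union> C) Y = h (A \<union> C) Y * h (A \<union> C) X" if "X \<in> I" "Y \<in> I" "X \<inter> Y = {}" for X Y
      using that sub by (intro comm) auto
    show "lam > 0" "Delta > 0" by fact+
    fix x
    have "(\<Sum>Y\<in>{Y\<in>I. x \<in> Y}. norm (h (A \<union> C) Y) * exp (lam * card Y))
        \<le> (\<Sum>Y\<in>{Y\<in>I. x \<in> Y}. opnorm D Y (PhiH (A \<union> C) Y) * exp (lam * card Y))"
      using sub nh by (intro sum_mono mult_right_mono) auto
    also have "\<dots> \<le> Delta"
      by (rule decay_bound_finite_sum[OF dec par(2) Lam(1)]) (use sub in blast)
    finally show "(\<Sum>Y\<in>{Y\<in>I. x \<in> Y}. norm (h (A \<union> C) Y) * exp (lam * card Y)) \<le> Delta" .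
  qed
  have r: "1 - 2 * Delta * \<beta> / lam > 0" using par by simp
  \<comment> \<open>Whatever \<open>L\<close> is, \<open>h L X\<close> is embedded from
    \<open>X\<close>; terms on regions disjoint from \<open>X\<close> therefore commute with all
    three parts of \<open>w X\<close>.\<close>
  have locw: "loc X (w X)" if "X \<in> J" for X
    unfolding loc_def
  proof (intro ballI impI)
    fix Y assume Y: "Y \<in> I" "Y \<inter> X = {}"
    have "h (A \<union> C) Y * h L X = h L X * h (A \<union> C) Y" for L
      using Y that sub by (intro comm) auto
    then show "h (A \<union> C) Y * w X = w X * h (A \<union> C) Y"
      by (simp add: w_def algebra_simps)
  qed
  have sumL: "(\<Sum>X\<in>J. norm (h L X) * exp (lam * card X))
      \<le> Delta * lattice_const TYPE('g) (mu / 2) * card (bdry A) * exp (- (mu / 2) * sdist A C)" for L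
  proof -
    have "(\<Sum>X\<in>J. norm (h L X) * exp (lam * card X)) \<le> (\<Sum>X\<in>J. opnorm D X (PhiH L X) * exp (lam * card X))"
      using sub nh by (intro sum_mono mult_right_mono) auto
    also have "\<dots> \<le> Delta * lattice_const TYPE('g) (mu / 2) * card (bdry A) * exp (- (mu / 2) * sdist A C)"
      unfolding J_def by (rule decay_across_boundary[OF dec par(2) Lam(1,2,4)])
    finally show ?thesis .
  qed
  have "(\<Sum>X\<in>J. norm (w X) * exp (lam * card X))
      \<le> (\<Sum>X\<in>J. norm (h (A \<union> C) X) * exp (lam * card X) + norm (h A X) * exp (lam * card X)
          + norm (h C X) * exp (lam * card X))"
  proof (rule sum_mono)
    fix X
    have "norm (w X) \<le> norm (h (A \<union> C) X) + norm (h A X) + norm (h C X)"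
      unfolding w_def using norm_triangle_ineq4[of "h (A \<union> C) X - h A X" "h C X"]
        norm_triangle_ineq4[of "h (A \<union> C) X" "h A X"] by linarith
    then have "norm (w X) * exp (lam * card X) \<le> (norm (h (A \<union> C) X) + norm (h A X) + norm (h C X)) * exp (lam * card X)"
      by (intro mult_right_mono) auto
    then show "norm (w X) * exp (lam * card X) \<le> norm (h (A \<union> C) X) * exp (lam * card X) + norm (h A X) * exp (lam * card X)
          + norm (h C X) * exp (lam * card X)" by (simp add: distrib_right)
  qed
  also have "\<dots> \<le> 3 * Delta * lattice_const TYPE('g) (mu / 2) * card (bdry A) * exp (- (mu / 2) * sdist A C)"
    using sumL[of "A \<union> C"] sumL[of A] sumL[of C] by (simp add: sum.distrib)
  finally have "(\<Sum>X\<in>J. norm (w X) * exp (lam * card X)) / (1 - 2 * Delta * \<beta> / lam) \<le> \<omega>"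
    using omega r by (smt (verit) divide_right_mono)
  note pert = norm_exp_perturbation[OF finIJ(2) _ locw _ par(5) this]
  have Z: "(\<Sum>Y\<in>I. h (A \<union> C) Y) = Z" by (simp add: Z_def eff_ham_def I_def h_def)
  have ZW: "Z - (\<Sum>X\<in>J. w X) = Y"
    unfolding Z_def Y_def w_def J_def h_def by (rule eff_ham_Un[OF W Lam(1,4)])
  show "norm (exp (- (\<beta> *\<^sub>R Z)) * exp (\<beta> *\<^sub>R Y) - 1) \<le> exp (\<omega> * \<beta>) - 1"
    using pert(1) sub par(4) by (simp add: Z ZW)
  show "norm (exp (- (\<beta> *\<^sub>R Y)) * exp (\<beta> *\<^sub>R Z) - 1) \<le> exp (\<omega> * \<beta>) - 1"
    using pert(2) sub par(4) by (simp add: Z ZW)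
qed

text \<open>With \<open>B = exp (\<omega> * \<beta>) - 1\<close> bounding both the deviation of
  \<open>\<kappa>\<close> and that of \<open>u\<close>, the product deviates by at most
  \<open>(B + 1)\<^sup>2 - 1\<close>, which explains the 2 in the exponent.\<close>

lemma opnorm_marginals_le:
  fixes Lam :: "'g::finite site set"
  assumes D: "D > 0" "local_interaction D Phi" and W: "weak_local_eff_ham D Phi \<beta> PhiH"
    and par: "lam > 0" "mu > 0" "Delta > 0" "\<beta> > 0" "2 * Delta * \<beta> < lam"
    and decay: "\<And>L. decay_bound D (PhiH L) lam mu Delta"
    and Lam: "finite Lam" "A \<subseteq> Lam" "C \<subseteq> Lam" "A \<inter> C = {}"
    and omega: "3 * Delta * lattice_const TYPE('g) (mu / 2) * card (bdry A) * exp (- (mu / 2) * sdist A C)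
      / (1 - 2 * Delta * \<beta> / lam) \<le> \<omega>"
  shows "opnorm D (A \<union> C)
          (opsub D (A \<union> C)
             (opmult D (A \<union> C) (red D Phi \<beta> Lam (A \<union> C))
                (opmult D (A \<union> C) (emb D A (A \<union> C) (opinv D A (red D Phi \<beta> Lam A)))
                                   (emb D C (A \<union> C) (opinv D C (red D Phi \<beta> Lam C)))))
             (idop D (A \<union> C))) \<le> exp (2 * \<omega> * \<beta>) - 1"
proof -
  define S where "S = A \<union> C"
  have S: "S \<subseteq> Lam" "finite S" "A \<subseteq> S" "C \<subseteq> S" using Lam finite_subset by (auto simp: S_def)
  have fin: "finite A" "finite C" using Lam by (auto intro: finite_subset)
  note red_exp = red_eq_scaled_exp[OF D par(4) W Lam(1)]
  obtain \<zeta>A GA where A: "\<zeta>A > 0" "red D Phi \<beta> Lam A = (\<lambda>\<sigma> \<tau>. complex_of_real \<zeta>A * mexp D A GA \<sigma> \<tau>)"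
    "qinj D Lam (emb D A Lam GA) = (- \<beta>) *\<^sub>R eff_ham D PhiH A Lam"
    "optrace D A (red D Phi \<beta> Lam A) = 1" by (rule red_exp[OF Lam(2)])
  obtain \<zeta>C GC where C: "\<zeta>C > 0" "red D Phi \<beta> Lam C = (\<lambda>\<sigma> \<tau>. complex_of_real \<zeta>C * mexp D C GC \<sigma> \<tau>)"
    "qinj D Lam (emb D C Lam GC) = (- \<beta>) *\<^sub>R eff_ham D PhiH C Lam"
    "optrace D C (red D Phi \<beta> Lam C) = 1" by (rule red_exp[OF Lam(3)])
  obtain \<zeta>S GS where SS: "\<zeta>S > 0" "red D Phi \<beta> Lam S = (\<lambda>\<sigma> \<tau>. complex_of_real \<zeta>S * mexp D S GS \<sigma> \<tau>)"
    "qinj D Lam (emb D S Lam GS) = (- \<beta>) *\<^sub>R eff_ham D PhiH S Lam"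
    "optrace D S (red D Phi \<beta> Lam S) = 1"
    and trS: "\<And>V. cmod (optrace D S (opmult D S V (red D Phi \<beta> Lam S))) \<le> opnorm D S V"
    by (rule red_exp[OF S(1)], rule that)
  define Z where "Z = eff_ham D PhiH S Lam"
  define HA where "HA = eff_ham D PhiH A Lam"
  define HC where "HC = eff_ham D PhiH C Lam"
  define u where "u = exp (- (\<beta> *\<^sub>R Z)) * exp (\<beta> *\<^sub>R (HA + HC))"
  define v where "v = exp (- (\<beta> *\<^sub>R (HA + HC))) * exp (\<beta> *\<^sub>R Z)"
  define B where "B = exp (\<omega> * \<beta>) - 1"
  have nu: "norm (u - 1) \<le> B" and nv: "norm (v - 1) \<le> B"
    using norm_eff_ham_perturbation[OF W par decay Lam omega]
    by (simp_all add: u_def v_def B_def Z_def HA_def HC_def S_def)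
  define \<kappa> where "\<kappa> = \<zeta>S / (\<zeta>A * \<zeta>C)"
  have comp: "emb D L Lam (mexp D L G) = component (exp (- (\<beta> *\<^sub>R H))) D Lam"
    "emb D L Lam (mexp D L (\<lambda>\<sigma> \<tau>. - G \<sigma> \<tau>)) = component (exp (\<beta> *\<^sub>R H)) D Lam"
    if "L \<subseteq> Lam" "qinj D Lam (emb D L Lam G) = (- \<beta>) *\<^sub>R H" for L G H
  proof -
    show "emb D L Lam (mexp D L G) = component (exp (- (\<beta> *\<^sub>R H))) D Lam"
      using that(2) by (simp add: emb_mexp[OF that(1) Lam(1)] mexp_eq_component[OF D(1) Lam(1)])
    have "qinj D Lam (emb D L Lam (\<lambda>\<sigma> \<tau>. - G \<sigma> \<tau>)) = - qinj D Lam (emb D L Lam G)"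
      by (rule qalg_eqI) (simp add: qinj.rep_eq component_uminus emb_def)
    then show "emb D L Lam (mexp D L (\<lambda>\<sigma> \<tau>. - G \<sigma> \<tau>)) = component (exp (\<beta> *\<^sub>R H)) D Lam"
      using that(2) by (simp add: emb_mexp[OF that(1) Lam(1)] mexp_eq_component[OF D(1) Lam(1)])
  qed
  note compS = comp[OF S(1) SS(3), folded Z_def]
  note compA = comp[OF Lam(2) A(3), folded HA_def]
  note compC = comp[OF Lam(3) C(3), folded HC_def]
  \<comment> \<open>The separate effective terms extend over overlapping regions, but the full sums
    are multiples of the embedded generators \<open>GA\<close> and \<open>GC\<close>, which act on
    disjoint regions.\<close>
  have commAC: "HA * HC = HC * HA"
  proof -
    have "qinj D Lam (emb D A Lam GA) * qinj D Lam (emb D C Lam GC)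
        = qinj D Lam (emb D C Lam GC) * qinj D Lam (emb D A Lam GA)"
      unfolding qinj_mult using emb_commute_disjoint[OF Lam(2,3,4,1)] by simp
    then show ?thesis using par(4) by (simp add: A(3) C(3) HA_def HC_def)
  qed
  have expAC: "exp (\<beta> *\<^sub>R HA) * exp (\<beta> *\<^sub>R HC) = exp (\<beta> *\<^sub>R (HA + HC))"
    "exp (- (\<beta> *\<^sub>R HA)) * exp (- (\<beta> *\<^sub>R HC)) = exp (- (\<beta> *\<^sub>R (HA + HC)))"
    by (subst exp_add_commuting[symmetric]; simp add: commAC scaleR_add_right)+
  have emb2: "emb D S Lam (opmult D S (emb D A S a) (emb D C S c)) = opmult D Lam (emb D A Lam a) (emb D C Lam c)"
    for a c
    by (simp add: emb_opmult[OF S(1) Lam(1)] emb_emb[OF S(3,1)] emb_emb[OF S(4,1)])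
  define T where "T = opmult D S (red D Phi \<beta> Lam S)
     (opmult D S (emb D A S (opinv D A (red D Phi \<beta> Lam A))) (emb D C S (opinv D C (red D Phi \<beta> Lam C))))"
  have embT: "emb D S Lam T = component (\<kappa> *\<^sub>R u) D Lam"
  proof -
    have "emb D S Lam T = opmult D Lam (emb D S Lam (red D Phi \<beta> Lam S))
        (opmult D Lam (emb D A Lam (opinv D A (red D Phi \<beta> Lam A))) (emb D C Lam (opinv D C (red D Phi \<beta> Lam C))))"
      unfolding T_def emb_opmult[OF S(1) Lam(1), of D "red D Phi \<beta> Lam S"] emb2 ..
    also have "emb D S Lam (red D Phi \<beta> Lam S) = component (\<zeta>S *\<^sub>R exp (- (\<beta> *\<^sub>R Z))) D Lam"
      unfolding SS(2) emb_scale compS component_scaleR ..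
    also have "emb D A Lam (opinv D A (red D Phi \<beta> Lam A)) = component ((1 / \<zeta>A) *\<^sub>R exp (\<beta> *\<^sub>R HA)) D Lam"
      unfolding A(2) opinv_scaled_mexp[OF D(1) fin(1) A(1)] emb_scale compA component_scaleR ..
    also have "emb D C Lam (opinv D C (red D Phi \<beta> Lam C)) = component ((1 / \<zeta>C) *\<^sub>R exp (\<beta> *\<^sub>R HC)) D Lam"
      unfolding C(2) opinv_scaled_mexp[OF D(1) fin(2) C(1)] emb_scale compC component_scaleR ..
    finally have "emb D S Lam T = component (\<zeta>S *\<^sub>R exp (- (\<beta> *\<^sub>R Z))
        * ((1 / \<zeta>A) *\<^sub>R exp (\<beta> *\<^sub>R HA) * (1 / \<zeta>C) *\<^sub>R exp (\<beta> *\<^sub>R HC))) D Lam"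
      by (simp only: component_times)
    moreover have "\<zeta>S *\<^sub>R exp (- (\<beta> *\<^sub>R Z)) * ((1 / \<zeta>A) *\<^sub>R exp (\<beta> *\<^sub>R HA) * (1 / \<zeta>C) *\<^sub>R exp (\<beta> *\<^sub>R HC)) = \<kappa> *\<^sub>R u"
      by (simp add: u_def \<kappa>_def expAC)
    ultimately show ?thesis by simp
  qed
  \<comment> \<open>The perturbation estimates hold on \<open>Lam\<close>; since embedding does not
    decrease the operator norm, they descend to \<open>S\<close>.\<close>
  have norm_diff: "opnorm D S (\<lambda>\<sigma> \<tau>. P \<sigma> \<tau> - idop D S \<sigma> \<tau>) \<le> norm (p - 1)"
    if "emb D S Lam P = component p D Lam" for P p
  proof -
    have "emb D S Lam (\<lambda>\<sigma> \<tau>. P \<sigma> \<tau> - idop D S \<sigma> \<tau>) = component (p - 1) D Lam"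
      unfolding emb_diff that emb_idop[OF S(1)]
      by (intro ext) (simp add: component_minus component_one D Lam)
    then show ?thesis
      using opnorm_le_emb[OF S(1) Lam(1) D(1), of "\<lambda>\<sigma> \<tau>. P \<sigma> \<tau> - idop D S \<sigma> \<tau>"]
        opnorm_component_le_norm[of D Lam "p - 1"] by simp
  qed
  \<comment> \<open>\<open>EE\<close> is the product of the unnormalised marginals of
    \<open>A\<close> and \<open>C\<close>. The operator \<open>V\<close> built from it lives on
    \<open>S\<close>, so that it can be paired with the marginal there, and embeds to
    \<open>v\<close>, the inverse of \<open>u\<close>.\<close>
  define EE where "EE = opmult D S (emb D A S (mexp D A GA)) (emb D C S (mexp D C GC))"
  define V where "V = opmult D S EE (mexp D S (\<lambda>\<sigma> \<tau>. - GS \<sigma> \<tau>))"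
  have "emb D S Lam V = component v D Lam"
    unfolding V_def emb_opmult[OF S(1) Lam(1)] EE_def emb_emb[OF S(3,1)] emb_emb[OF S(4,1)] compA compC compS v_def
    by (simp only: component_times[symmetric] expAC)
  then have V: "opnorm D S (\<lambda>\<sigma> \<tau>. V \<sigma> \<tau> - idop D S \<sigma> \<tau>) \<le> B"
    using norm_diff nv order_trans by blast
  text \<open>Since \<open>V\<close> turns \<open>red S\<close> into \<open>\<kappa>\<close> times the product of the marginals, taking traces evaluates \<open>\<kappa>\<close>.\<close>
  have \<kappa>: "\<bar>\<kappa> - 1\<bar> \<le> B"
  proof -
    have "opmult D S V (red D Phi \<beta> Lam S) = (\<lambda>\<sigma> \<tau>. complex_of_real \<zeta>S * opmult D S V (mexp D S GS) \<sigma> \<tau>)"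
      unfolding SS(2) opmult_def by (auto simp: fun_eq_iff sum_distrib_left mult_ac)
    also have "opmult D S V (mexp D S GS) = EE"
      unfolding V_def opmult_assoc
      by (simp add: mexp_inverse(2)[OF D(1) S(2), of "\<lambda>\<sigma> \<tau>. - GS \<sigma> \<tau>" GS] opmult_idop_right S EE_def)
    finally have "optrace D S (opmult D S V (red D Phi \<beta> Lam S)) = complex_of_real \<zeta>S * optrace D S EE"
      by (simp add: optrace_scale)
    also have "optrace D S EE = optrace D A (mexp D A GA) * optrace D C (mexp D C GC)"
      unfolding EE_def S_def by (rule optrace_emb_disjoint[OF Lam(4) fin])
    also have "optrace D A (mexp D A GA) = complex_of_real (1 / \<zeta>A)"
      using A(4) A(1) unfolding A(2) optrace_scale by (simp add: field_simps)
    also have "optrace D C (mexp D C GC) = complex_of_real (1 / \<zeta>C)"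
      using C(4) C(1) unfolding C(2) optrace_scale by (simp add: field_simps)
    finally have tr: "optrace D S (opmult D S V (red D Phi \<beta> Lam S)) = complex_of_real \<kappa>"
      by (simp add: \<kappa>_def)
    have rc: "canon D S (red D Phi \<beta> Lam S)"
      using canon_mexp[OF D(1) S(2), of GS] unfolding SS(2) canon_def by simp
    have "opmult D S (\<lambda>\<sigma> \<tau>. V \<sigma> \<tau> - idop D S \<sigma> \<tau>) (red D Phi \<beta> Lam S)
        = (\<lambda>\<sigma> \<tau>. opmult D S V (red D Phi \<beta> Lam S) \<sigma> \<tau> - opmult D S (idop D S) (red D Phi \<beta> Lam S) \<sigma> \<tau>)"
      unfolding opmult_def by (auto simp: fun_eq_iff left_diff_distrib sum_subtractf)
    then have "optrace D S (opmult D S (\<lambda>\<sigma> \<tau>. V \<sigma> \<tau> - idop D S \<sigma> \<tau>) (red D Phi \<beta> Lam S))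
        = optrace D S (opmult D S V (red D Phi \<beta> Lam S)) - optrace D S (red D Phi \<beta> Lam S)"
      unfolding opmult_idop_left[OF S(2) rc] by (simp add: optrace_def sum_subtractf)
    also have "\<dots> = complex_of_real (\<kappa> - 1)" by (simp add: tr SS(4))
    finally have "\<bar>\<kappa> - 1\<bar> \<le> opnorm D S (\<lambda>\<sigma> \<tau>. V \<sigma> \<tau> - idop D S \<sigma> \<tau>)"
      using trS[of "\<lambda>\<sigma> \<tau>. V \<sigma> \<tau> - idop D S \<sigma> \<tau>"] by (simp only: norm_of_real)
    then show ?thesis using V by linarith
  qed
  have "norm (\<kappa> *\<^sub>R u - 1) = norm ((\<kappa> - 1) *\<^sub>R u + (u - 1))" by (simp add: algebra_simps)
  also have "\<dots> \<le> \<bar>\<kappa> - 1\<bar> * norm u + norm (u - 1)"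
    using norm_triangle_ineq[of "(\<kappa> - 1) *\<^sub>R u" "u - 1"] by simp
  also have "\<dots> \<le> B * (B + 1) + B"
  proof -
    have "norm u \<le> B + 1" using norm_triangle_ineq[of "u - 1" 1] nu by simp
    moreover have "B \<ge> 0" using \<kappa> by linarith
    ultimately have "\<bar>\<kappa> - 1\<bar> * norm u \<le> B * (B + 1)" using \<kappa> by (intro mult_mono) auto
    then show ?thesis using nu by linarith
  qed
  also have "\<dots> = exp (2 * \<omega> * \<beta>) - 1"
  proof -
    have "exp (2 * \<omega> * \<beta>) = exp (\<omega> * \<beta>) * exp (\<omega> * \<beta>)" by (simp flip: exp_add)
    then show ?thesis by (simp add: B_def algebra_simps)
  qed
  finally have "opnorm D S (\<lambda>\<sigma> \<tau>. T \<sigma> \<tau> - idop D S \<sigma> \<tau>) \<le> exp (2 * \<omega> * \<beta>) - 1"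
    using norm_diff[OF embT] by linarith
  moreover have "opnorm D S (opsub D S T (idop D S)) = opnorm D S (\<lambda>\<sigma> \<tau>. T \<sigma> \<tau> - idop D S \<sigma> \<tau>)"
    by (rule opnorm_cong) (simp add: opsub_def)
  ultimately show ?thesis unfolding T_def S_def by simp
qed

text \<open>Makes the operator of the theorem symmetric in the two regions, so that the bound by the
  boundary of the first one also holds with the roles exchanged.\<close>

lemma opmult_emb_swap:
  assumes "A \<inter> C = {}" "finite A" "finite C"
  shows "opmult D (A \<union> C) (emb D A (A \<union> C) a) (emb D C (A \<union> C) c)
    = opmult D (C \<union> A) (emb D C (C \<union> A) c) (emb D A (C \<union> A) a)"
  using emb_commute_disjoint[of A "A \<union> C" C D a c] assms by (simp add: Un_commute)

theorem theorem6p5: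
  fixes D :: nat and Phi :: "'g::finite site set \<Rightarrow> 'g op"
    and lam mu Delta \<beta> :: real
    and PhiH :: "'g site set \<Rightarrow> 'g site set \<Rightarrow> 'g op"
    and \<epsilon> :: "real \<Rightarrow> real" and b :: nat
    and gf :: "'g site set \<Rightarrow> real" and f :: "'g site set \<Rightarrow> 'g site set \<Rightarrow> real"
  assumes "D \<ge> 1"
    and "local_interaction D Phi"
    and "lam > 0" "mu > 0" "Delta > 0"
    and "decay_bound D Phi lam mu Delta"
    and "0 < \<beta>" "\<beta> < lam / (2 * Delta)"
    and "weak_local_eff_ham D Phi \<beta> PhiH"
    and "\<forall>L. decay_bound D (PhiH L) lam mu Delta"
    and "uniform_clustering D Phi \<beta> \<epsilon> b gf f"
    and "exp_decaying \<epsilon>"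
  shows "\<exists>c' K1 K2. c' > 0 \<and> K1 > 0 \<and> K2 > 0 \<and>
     (\<forall>Lam A C. finite Lam \<and> A \<subseteq> Lam \<and> C \<subseteq> Lam \<and> A \<inter> C = {} \<and> A \<noteq> {} \<and> C \<noteq> {} \<longrightarrow>
        opnorm D (A \<union> C)
          (opsub D (A \<union> C)
             (opmult D (A \<union> C) (red D Phi \<beta> Lam (A \<union> C))
                (opmult D (A \<union> C) (emb D A (A \<union> C) (opinv D A (red D Phi \<beta> Lam A)))
                                   (emb D C (A \<union> C) (opinv D C (red D Phi \<beta> Lam C)))))
             (idop D (A \<union> C)))
        \<le> K2 * min (exp (K1 * real (card (bdry A))) * (real (card (bdry A)) + real (card C) * gf A))
                   (exp (K1 * real (card (bdry C))) * (real (card (bdry C)) + real (card A) * gf C))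
             * exp (- c' * sdist A C))"
proof -
  have D: "D > 0" using assms(1) by simp
  have par: "lam > 0" "mu > 0" "Delta > 0" "\<beta> > 0" "2 * Delta * \<beta> < lam"
    using assms by (simp_all add: field_simps)
  define r where "r = 1 - 2 * Delta * \<beta> / lam"
  have r: "r > 0" using par by (simp add: r_def)
  \<comment> \<open>With \<open>p\<close> boundary sites and decay factor \<open>e\<close>, the
    required strength is \<open>\<omega> = k * p * e\<close>.\<close>
  define k where "k = 3 * Delta * lattice_const TYPE('g) (mu / 2) / r"
  have k: "k > 0" using par r lattice_const_pos[of "mu / 2", where 'g = 'g] by (simp add: k_def)
  \<comment> \<open>The 2 comes from \<open>opnorm_marginals_le\<close>. The same \<open>K\<close>
    serves as prefactor and as rate in the exponential of the boundary size.\<close>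
  define K where "K = 2 * k * \<beta>"
  have K: "K > 0" using k par by (simp add: K_def)
  define N where "N Lam A C = opnorm D (A \<union> C)
          (opsub D (A \<union> C)
             (opmult D (A \<union> C) (red D Phi \<beta> Lam (A \<union> C))
                (opmult D (A \<union> C) (emb D A (A \<union> C) (opinv D A (red D Phi \<beta> Lam A)))
                                   (emb D C (A \<union> C) (opinv D C (red D Phi \<beta> Lam C)))))
             (idop D (A \<union> C)))" for Lam A C
  have gf: "gf A \<ge> 0" if "finite A" for A using assms(11) that by (auto simp: uniform_clustering_def)
  have bound: "N Lam A C \<le> K * (exp (K * card (bdry A)) * (card (bdry A) + card C * gf A)) * exp (- (mu / 2) * sdist A C)"
    if Lam: "finite Lam" "A \<subseteq> Lam" "C \<subseteq> Lam" "A \<inter> C = {}" for Lam A C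
  proof -
    define p where "p = real (card (bdry A))"
    define e where "e = exp (- (mu / 2) * sdist A C)"
    have e: "0 < e" "e \<le> 1" using par by (auto simp: e_def sdist_def setdist_pos_le)
    have "N Lam A C \<le> exp (2 * (k * p * e) * \<beta>) - 1"
      unfolding N_def
    proof (rule opnorm_marginals_le[OF D assms(2) assms(9) par _ Lam])
      show "decay_bound D (PhiH L) lam mu Delta" for L using assms(10) by blast
      show "3 * Delta * lattice_const TYPE('g) (mu / 2) * card (bdry A) * exp (- (mu / 2) * sdist A C)
        / (1 - 2 * Delta * \<beta> / lam) \<le> k * p * e"
        by (simp add: k_def p_def e_def r_def)
    qed
    also have "\<dots> = exp (K * p * e) - 1" by (simp add: K_def mult_ac)
    \<comment> \<open>This is \<open>exp x - 1 \<le> x * exp x\<close>, a rearrangement of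
      \<open>1 - x \<le> exp (- x)\<close>.\<close>
    also have "\<dots> \<le> K * p * e * exp (K * p * e)"
    proof -
      have "1 - K * p * e \<le> exp (- (K * p * e))" using exp_ge_add_one_self[of "- (K * p * e)"] by simp
      then have "(1 - K * p * e) * exp (K * p * e) \<le> exp (- (K * p * e)) * exp (K * p * e)"
        by (intro mult_right_mono) auto
      then show ?thesis by (simp add: algebra_simps flip: exp_add)
    qed
    \<comment> \<open>The decay factor is given up in the exponent only; the one in front supplies
      the decay of the final bound.\<close>
    also have "\<dots> \<le> K * p * e * exp (K * p)"
      using K e by (intro mult_left_mono) (auto simp: p_def mult_left_le)
    also have "\<dots> \<le> K * (exp (K * p) * (p + card C * gf A)) * e"
    proof -
      have "gf A \<ge> 0" using gf Lam finite_subset by blast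
      then have "p * (K * exp (K * p) * e) \<le> (p + card C * gf A) * (K * exp (K * p) * e)"
        using K e by (intro mult_right_mono) auto
      then show ?thesis by (simp add: mult_ac)
    qed
    finally show ?thesis by (simp add: p_def e_def)
  qed
  have "N Lam A C \<le> K * min (exp (K * card (bdry A)) * (card (bdry A) + card C * gf A))
      (exp (K * card (bdry C)) * (card (bdry C) + card A * gf C)) * exp (- (mu / 2) * sdist A C)"
    if Lam: "finite Lam" "A \<subseteq> Lam" "C \<subseteq> Lam" "A \<inter> C = {}" for Lam A C
  proof -
    have fin: "finite A" "finite C" using Lam by (auto intro: finite_subset)
    have "N Lam C A = N Lam A C"
      unfolding N_def using opmult_emb_swap[OF Lam(4) fin] by (simp add: Un_commute)
    then have "N Lam A C \<le> K * (exp (K * card (bdry C)) * (card (bdry C) + card A * gf C)) * exp (- (mu / 2) * sdist A C)"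
      using bound[of Lam C A] Lam by (simp add: Int_commute sdist_def setdist_sym)
    then show ?thesis using bound[OF Lam] by (auto simp: min_def)
  qed
  then show ?thesis
    using K par unfolding N_def by (intro exI[of _ "mu / 2"] exI[of _ K]) auto
qed

end
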